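(* Let $X_1,X_2,\ldots$ be i.i.d. random vectors in $\mathbb{R}^q$ with distribution $P$, let $Q=Q(P)=\mathcal{L}(X_1-X_2)$, and suppose that $\boldsymbol{\Sigma}$ is as in case (a) or case (b) of the context, with $Q\in\mathcal{Q}$. Let $J=J_Q$ and define, for $x,y\in\mathbb{R}^q$, \[ H_1(x):=\mathbb{E}\,J(x-X_1),\qquad H_2(x,y):=J(x-y)-H_1(x)-H_1(y). \] Let $\boldsymbol{G}_1,\boldsymbol{G}_2$ be stochastically independent centered Gaussian random matrices in $\mathbb{R}^{q\times q}_{\rm sym}$ such that for all $A\in\mathbb{R}^{q\times q}_{\rm sym}$, \[ \mathbb{E}\langle A,\boldsymbol{G}_1\rangle^2=\mathbb{E}\langle A,H_1(X_1)\rangle^2,\qquad \mathbb{E}\langle A,\boldsymbol{G}_2\rangle^2=\mathbb{E}\langle A,H_2(X_1,X_2)\rangle^2 . \] Then: (i) If $d(n)$ are integers with $1\le d(n)\le (n-1)/2$ and $d(n)\to\infty$, then both $\boldsymbol{\Sigma}(\hat Q_n)$ and $\boldsymbol{\Sigma}(\hat Q_{n,d(n)})$ equal $\boldsymbol{\Sigma}(Q)+2\int H_1\,d\hat P_n+o_p(n^{-1/2})$. (ii) For each fixed integer $d\ge1$, $\boldsymbol{\Sigma}(\hat Q_{n,d})=\boldsymbol{\Sigma}(\hat Q_n)+\boldsymbol{M}_{n,d}+o_p(n^{-1/2})$, where $\boldsymbol{M}_{n,d}:=(nd)^{-1}\sum_{i=1}^n\sum_{j=i+1}^{i+d}H_2(X_i,X_j)$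 (with $X_{n+s}:=X_s$). (iii) For each fixed $d\ge1$, $\bigl(\sqrt n\int H_1\,d\hat P_n,\ \sqrt{nd}\,\boldsymbol{M}_{n,d}\bigr)\to_{\mathcal L}(\boldsymbol{G}_1,\boldsymbol{G}_2)$. (iv) In particular, if $d(n)\to\infty$ as in (i), then $\sqrt n(\boldsymbol{\Sigma}(\hat Q_n)-\boldsymbol{\Sigma}(Q))\to_{\mathcal L}2\boldsymbol{G}_1$ and $\sqrt n(\boldsymbol{\Sigma}(\hat Q_{n,d(n)})-\boldsymbol{\Sigma}(Q))\to_{\mathcal L}2\boldsymbol{G}_1$, whereas for each fixed integer $d\ge1$, $\sqrt n(\boldsymbol{\Sigma}(\hat Q_{n,d})-\boldsymbol{\Sigma}(Q))\to_{\mathcal L}2\boldsymbol{G}_1+d^{-1/2}\boldsymbol{G}_2$. All limits are as $n\to\infty$.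
   Context: Notation: $\mathbb{R}^{q\times q}_{\rm sym}$ is the space of symmetric $q\times q$ matrices, $\mathbb{R}^{q\times q}_{\rm sym,+}$ its subset of positive definite matrices; $\langle M,N\rangle=\mathrm{tr}(M^\top N)$ and $\|M\|$ is the Frobenius norm. $\delta_z$ is the Dirac measure at $z$ and $\delta^{\rm s}_z:=\frac12(\delta_z+\delta_{-z})$. For i.i.d. $X_1,\dots,X_n\sim P$ on $\mathbb{R}^q$: $\hat P_n:=n^{-1}\sum_{i=1}^n\delta_{X_i}$; $\hat Q_n:=\binom n2^{-1}\sum_{1\le i<j\le n}\delta^{\rm s}_{X_j-X_i}$; and for an integer $1\le d\le (n-1)/2$, $\hat Q_{n,d}:=(nd)^{-1}\sum_{i=1}^n\sum_{j=i+1}^{i+d}\delta^{\rm s}_{X_j-X_i}$ with the cyclic convention $X_{n+s}:=X_s$ for $1\le s\le n$. $\mathcal L(\cdot)$ denotes distribution, $\to_{\mathcal L}$ convergence in distribution, $o_p(a_n)$ a term $R_n$ with $R_n/a_n\to0$ in probability. Estimators $\boldsymbol{\Sigma}(\hat Q)$ are defined on the event $\hat Q\in\mathcal{Q}$ (and arbitrarily, e.g. as $I_q$, otherwise). Case (a): $\mathcal{Q}$ is a family of probability distributions on $\mathbb{R}^q$ which is open in the topology of weak convergence, and $\boldsymbol{\Sigma}:\mathcal{Q}\to\mathbb{R}^{q\times q}_{\rm sym,+}$ satisfies: (linear equivariance) for every nonsingular $B\in\mathbb{R}^{q\times q}$ and $Q\in\mathcal{Q}$, the law $Q^B$ of $BY$,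 $Y\sim Q$, lies in $\mathcal{Q}$ and $\boldsymbol{\Sigma}(Q^B)=B\boldsymbol{\Sigma}(Q)B^\top$; (differentiability) for each $Q\in\mathcal{Q}$ there is a bounded, measurable, even function $J=J_Q:\mathbb{R}^q\to\mathbb{R}^{q\times q}_{\rm sym}$ with $\int J\,dQ=0$ such that for $\check Q\in\mathcal{Q}$, $\boldsymbol{\Sigma}(\check Q)=\boldsymbol{\Sigma}(Q)+\int J\,d\check Q+o(\|\int J\,d\check Q\|)$ as $\check Q\to Q$ weakly. Case (b) (Tyler's functional): $P$ has no atoms; $\mathcal{Q}=\mathcal{Q}_0$ is the set of distributions $Q$ on $\mathbb{R}^q$ with $Q(\{0\})=0$ and $Q(\mathbb{W})<\dim(\mathbb{W})/q$ for every linear subspace $\mathbb{W}$ with $1\le\dim\mathbb{W}<q$; $\boldsymbol{\Sigma}(Q)=\boldsymbol{\Sigma}_0(Q)$ is the unique minimizer over $\{\Sigma\in\mathbb{R}^{q\times q}_{\rm sym,+}:\det\Sigma=1\}$ of $L_0(\Sigma,Q)=q\int\log\bigl(y^\top\Sigma^{-1}y/y^\top y\bigr)Q(dy)+\log\det\Sigma$; it has the differentiability property that for each $Q\in\mathcal{Q}_0$ there is a bounded, continuous, even $J=J_Q:\mathbb{R}^q\setminus\{0\}\to\mathbb{R}^{q\times q}_{\rm sym}$ with $\int J\,dQ=0$ and $\boldsymbol{\Sigma}_0(\check Q)=\boldsymbol{\Sigma}_0(Q)+\int J\,d\check Q+o(\|\int J\,d\check Q\|)$ as $\check Q\to Q$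 weakly, $\check Q\in\mathcal{Q}_0$; one sets $J(0):=0$. *)

theory Defs
  imports "HOL-Probability.Probability"
begin

type_synonym 'q mat = "real^'q^'q"

definition sym_mat :: "'q::finite mat \<Rightarrow> bool" where
  "sym_mat A \<longleftrightarrow> transpose A = A"

definition pos_def_mat :: "'q::finite mat \<Rightarrow> bool" where
  "pos_def_mat A \<longleftrightarrow> sym_mat A \<and> (\<forall>x. x \<noteq> 0 \<longrightarrow> x \<bullet> (A *v x) > 0)"

text \<open>Frobenius inner product tr(M^T N). (The library norm on real^'q^'q is the Frobenius norm.)\<close>
definition frob :: "'q::finite mat \<Rightarrow> 'q mat \<Rightarrow> real" where
  "frob M N = trace (transpose M ** N)"

definition prob_dists :: "(real^'q::finite) measure set" where
  "prob_dists = {Q. prob_space Q \<and> sets Q = sets borel}"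

definition weak_conv :: "(nat \<Rightarrow> (real^'q::finite) measure) \<Rightarrow> (real^'q) measure \<Rightarrow> bool" where
  "weak_conv Qs Q \<longleftrightarrow> (\<forall>f :: real^'q \<Rightarrow> real. continuous_on UNIV f \<and> bounded (range f) \<longrightarrow>
      (\<lambda>k. integral\<^sup>L (Qs k) f) \<longlonglongrightarrow> integral\<^sup>L Q f)"

text \<open>Openness in the (metrizable) topology of weak convergence, stated sequentially.\<close>
definition weak_open :: "(real^'q::finite) measure set \<Rightarrow> bool" where
  "weak_open \<Q> \<longleftrightarrow> \<Q> \<subseteq> prob_dists \<and>
     (\<forall>Q\<in>\<Q>. \<forall>Qs. (\<forall>k. Qs k \<in> prob_dists) \<longrightarrow> weak_conv Qs Q \<longrightarrow> (\<forall>\<^sub>F k in sequentially. Qs k \<in> \<Q>))"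

definition lin_image :: "'q::finite mat \<Rightarrow> (real^'q) measure \<Rightarrow> (real^'q) measure" where
  "lin_image B Q = distr Q borel (\<lambda>y. B *v y)"

definition is_deriv :: "(real^'q::finite) measure set \<Rightarrow> ((real^'q) measure \<Rightarrow> 'q mat)
     \<Rightarrow> (real^'q) measure \<Rightarrow> (real^'q \<Rightarrow> 'q mat) \<Rightarrow> bool" where
  "is_deriv \<Q> Sig Q J \<longleftrightarrow>
     bounded (range J) \<and> J \<in> borel_measurable borel \<and> (\<forall>y. J (- y) = J y) \<and> (\<forall>y. sym_mat (J y)) \<and>
     integral\<^sup>L Q J = 0 \<and>
     (\<forall>Qs. (\<forall>k. Qs k \<in> \<Q>) \<longrightarrow> weak_conv Qs Q \<longrightarrow>
        (\<forall>e>0. \<forall>\<^sub>F k in sequentially.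
            norm (Sig (Qs k) - Sig Q - integral\<^sup>L (Qs k) J) \<le> e * norm (integral\<^sup>L (Qs k) J)))"

definition case_a :: "(real^'q::finite) measure set \<Rightarrow> ((real^'q) measure \<Rightarrow> 'q mat) \<Rightarrow> bool" where
  "case_a \<Q> Sig \<longleftrightarrow> weak_open \<Q> \<and>
     (\<forall>Q\<in>\<Q>. pos_def_mat (Sig Q)) \<and>
     (\<forall>B Q. invertible B \<longrightarrow> Q \<in> \<Q> \<longrightarrow>
          lin_image B Q \<in> \<Q> \<and> Sig (lin_image B Q) = B ** Sig Q ** transpose B) \<and>
     (\<forall>Q\<in>\<Q>. \<exists>J. is_deriv \<Q> Sig Q J)"

definition tyler_dom :: "(real^'q::finite) measure set" where
  "tyler_dom = {Q \<in> prob_dists. measure Q {0} = 0 \<and>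
      (\<forall>W. subspace W \<and> 1 \<le> dim W \<and> dim W < CARD('q) \<longrightarrow> measure Q W < real (dim W) / real CARD('q))}"

definition tyler_L0 :: "'q::finite mat \<Rightarrow> (real^'q) measure \<Rightarrow> real" where
  "tyler_L0 S Q = real CARD('q) * (\<integral>y. ln ((y \<bullet> (matrix_inv S *v y)) / (y \<bullet> y)) \<partial>Q) + ln (det S)"

definition tyler_fun :: "(real^'q::finite) measure \<Rightarrow> 'q mat" where
  "tyler_fun Q = (THE S. pos_def_mat S \<and> det S = 1 \<and>
      (\<forall>S'. pos_def_mat S' \<and> det S' = 1 \<longrightarrow> tyler_L0 S Q \<le> tyler_L0 S' Q))"

text \<open>\<hat>P_n: uniform distribution on X_0,...,X_{n-1} (0-based indexing of the sample).\<close>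
definition emp_P :: "nat \<Rightarrow> (nat \<Rightarrow> 'a \<Rightarrow> real^'q::finite) \<Rightarrow> 'a \<Rightarrow> (real^'q) measure" where
  "emp_P n X \<omega> = distr (uniform_count_measure {..<n}) borel (\<lambda>i. X i \<omega>)"

definition sgn_of :: "bool \<Rightarrow> real" where "sgn_of b = (if b then 1 else -1)"

definition emp_Q :: "nat \<Rightarrow> (nat \<Rightarrow> 'a \<Rightarrow> real^'q::finite) \<Rightarrow> 'a \<Rightarrow> (real^'q) measure" where
  "emp_Q n X \<omega> = distr (uniform_count_measure {(i, j, b). i < j \<and> j < n})
      borel (\<lambda>(i, j, b). sgn_of b *\<^sub>R (X j \<omega> - X i \<omega>))"

text \<open>\<hat>Q_{n,d}, with the cyclic convention X_{n+s} = X_s (here: index (i+k) mod n).\<close>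
definition emp_Qd :: "nat \<Rightarrow> nat \<Rightarrow> (nat \<Rightarrow> 'a \<Rightarrow> real^'q::finite) \<Rightarrow> 'a \<Rightarrow> (real^'q) measure" where
  "emp_Qd n d X \<omega> = distr (uniform_count_measure ({..<n} \<times> {1..d} \<times> (UNIV :: bool set)))
      borel (\<lambda>(i, k, b). sgn_of b *\<^sub>R (X ((i + k) mod n) \<omega> - X i \<omega>))"

definition est :: "(real^'q::finite) measure set \<Rightarrow> ((real^'q) measure \<Rightarrow> 'q mat) \<Rightarrow> (real^'q) measure \<Rightarrow> 'q mat" where
  "est \<Q> Sig Q = (if Q \<in> \<Q> then Sig Q else mat 1)"

text \<open>R_n = o_p(a_n), via outer probability (no measurability of R_n required).\<close>
definition o_p :: "'a measure \<Rightarrow> (nat \<Rightarrow> 'a \<Rightarrow> 'b::real_normed_vector) \<Rightarrow> (nat \<Rightarrow> real) \<Rightarrow> bool" where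
  "o_p M R a \<longleftrightarrow> (\<forall>e>0. \<exists>A. (\<forall>n. A n \<in> sets M \<and>
        {\<omega> \<in> space M. e * \<bar>a n\<bar> < norm (R n \<omega>)} \<subseteq> A n) \<and> (\<lambda>n. measure M (A n)) \<longlonglongrightarrow> 0)"

definition outer_exp :: "'a measure \<Rightarrow> ('a \<Rightarrow> real) \<Rightarrow> real" where
  "outer_exp M h = Inf {integral\<^sup>L M g | g. g \<in> borel_measurable M \<and> integrable M g \<and> (\<forall>\<omega>\<in>space M. h \<omega> \<le> g \<omega>)}"

text \<open>Convergence in distribution (Hoffmann-Joergensen sense; equals the usual notion for measurable Y_n).\<close>
definition conv_dist :: "'a measure \<Rightarrow> (nat \<Rightarrow> 'a \<Rightarrow> 'b::topological_space) \<Rightarrow> 'c measure \<Rightarrow> ('c \<Rightarrow> 'b) \<Rightarrow> bool" where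
  "conv_dist M Y N Z \<longleftrightarrow> (\<forall>f :: 'b \<Rightarrow> real. continuous_on UNIV f \<and> bounded (range f) \<longrightarrow>
      (\<lambda>n. outer_exp M (\<lambda>\<omega>. f (Y n \<omega>))) \<longlonglongrightarrow> integral\<^sup>L N (\<lambda>\<omega>. f (Z \<omega>)))"

definition centered_normal :: "'a measure \<Rightarrow> ('a \<Rightarrow> real) \<Rightarrow> bool" where
  "centered_normal N Y \<longleftrightarrow> Y \<in> borel_measurable N \<and>
     (\<exists>\<sigma>. (\<sigma> = 0 \<and> distr N borel Y = return borel 0) \<or>
          (\<sigma> > 0 \<and> distributed N lborel Y (normal_density 0 \<sigma>)))"

definition gauss_sym_mat :: "'a measure \<Rightarrow> ('a \<Rightarrow> 'q::finite mat) \<Rightarrow> bool" where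
  "gauss_sym_mat N G \<longleftrightarrow> G \<in> borel_measurable N \<and> (\<forall>\<omega>\<in>space N. sym_mat (G \<omega>)) \<and>
     (\<forall>A. centered_normal N (\<lambda>\<omega>. frob A (G \<omega>)))"

end

theory Submission imports Defs begin

text \<open>
  Since \<open>J\<close> is even, the integral of \<open>J\<close> under either empirical measure is the average of \<open>J (X\<^sub>i - X\<^sub>j)\<close>
  over the edges of a regular graph on the sample: the complete graph for \<open>Q\<^sub>n\<close>, a circulant graph for
  \<open>Q\<^sub>n\<^sub>,\<^sub>d\<close>. By regularity, the Hoeffding decomposition \<open>J (x - y) = H\<^sub>1 x + H\<^sub>1 y + H\<^sub>2 x y\<close> turns it into
  twice the mean of \<open>H\<^sub>1\<close> plus the edge average of the degenerate kernel \<open>H\<^sub>2\<close>, whose second moment is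
  inversely proportional to the number of edges because distinct edges are uncorrelated. The same bound
  applied to a test function in place of \<open>J\<close> is a weak law of large numbers for the empirical measures.
  A countable convergence-determining class translates sequential differentiability into a statement
  about finitely many test functions, so this weak law makes the remainder negligible.

  For the joint limit, all linear combinations of the two sums are sums of locally dependent terms
  along a cycle. Cutting the cycle into long independent blocks separated by gaps of length \<open>d\<close> gives the
  Gaussian limit of their characteristic functions.
\<close>

subsection \<open>A countable convergence-determining class\<close>

text \<open>The cyclic edges change with every \<open>n\<close>, so the empirical measures form a
  triangular array, while differentiability of \<open>Sig\<close> is known only along weakly
  convergent sequences. Hence the detour over countably many test functions: if the expansion failed
  on every neighbourhood given by finitely many of them, one weakly convergent sequence would be a
  counterexample. Neighbourhoods, unlike sequences, combine with convergence in probability. In case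
  (b) the condition at the origin is not weakly open; it is carried as a separate implication, and
  the subspace conditions are handled by compactness of orthonormal frames.

  In the joint limit the summands are dependent but uncorrelated, so partial sums have variance
  exactly proportional to their number of terms; the block length \<open>p\<close> is fixed while
  \<open>n\<close> grows and is sent to infinity only afterwards. Passing from characteristic
  functions to expectations uses trigonometric polynomials with quadratically growing error, paid
  for by second moments. Since the estimators may be nonmeasurable, remainders are controlled by
  covering events and outer expectations.\<close>

lemma integrable_bounded_prob_dist:
  fixes f :: "real^'q::finite \<Rightarrow> 'b::{banach, second_countable_topology}"
  assumes "Q \<in> prob_dists" "f \<in> borel_measurable borel" "bounded (range f)"
  shows "integrable Q f"
proof -
  interpret prob_space Q using assms(1) by (simp add: prob_dists_def)
  obtain C where "\<And>y. norm (f y) \<le> C"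
    using assms(3) by (auto simp: bounded_iff)
  moreover have "f \<in> borel_measurable Q"
    using assms(1,2) by (simp add: prob_dists_def cong: measurable_cong_sets)
  ultimately show ?thesis
    by (intro integrable_const_bound[where B = C]) auto
qed

text \<open>The triple \<open>p\<close> holds a centre, a radius and a height: for radius r > 0 the
  function equals the height up to distance r from the centre, falls off linearly, and vanishes from
  distance 2r on. No sign is imposed; for r at most 0 the function is constant, so continuity and
  the bound by the absolute height hold for every parameter.\<close>

definition bump :: "(real^'q::finite) \<times> real \<times> real \<Rightarrow> real^'q \<Rightarrow> real" where
  "bump p y = snd (snd p) * max 0 (min 1 (2 - dist y (fst p) / fst (snd p)))"

text \<open>Finite maxima rather than single bumps are the test functions, because a countable
  supremum is then reached through finite stages. Starting from 0 makes them nonnegative, so a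
  function lying above them serves as a majorant in dominated convergence.\<close>

definition max_bump :: "((real^'q::finite) \<times> real \<times> real) list \<Rightarrow> real^'q \<Rightarrow> real" where
  "max_bump L y = foldr (\<lambda>p m. max (bump p y) m) L 0"

lemma max_bump_simps [simp]:
  "max_bump [] y = 0" "max_bump (p # L) y = max (bump p y) (max_bump L y)"
  by (auto simp: max_bump_def)

lemma continuous_on_bump: "continuous_on UNIV (bump p)"
proof -
  have "continuous_on UNIV (\<lambda>y. dist y (fst p) * (1 / fst (snd p)))"
    by (intro continuous_intros)
  then have "continuous_on UNIV (\<lambda>y. dist y (fst p) / fst (snd p))" by simp
  then show ?thesis
    unfolding bump_def [abs_def] by (intro continuous_on_mult continuous_on_max continuous_on_min
      continuous_on_diff continuous_on_const)
qed

lemma continuous_on_max_bump: "continuous_on UNIV (max_bump L)"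
proof (induction L)
  case (Cons p L)
  have "max_bump (p # L) = (\<lambda>y. max (bump p y) (max_bump L y))" by (rule ext) simp
  then show ?case using Cons continuous_on_bump[of p] by (auto intro: continuous_on_max)
qed (simp add: max_bump_def [abs_def])

lemma abs_bump_le: "\<bar>bump p y\<bar> \<le> \<bar>snd (snd p)\<bar>"
  by (auto simp: bump_def abs_mult intro!: mult_left_le)

lemma bounded_max_bump: "bounded (range (max_bump L))"
proof -
  have "\<exists>C. \<forall>y. \<bar>max_bump L y\<bar> \<le> C"
  proof (induction L)
    case (Cons p L)
    then obtain C where "\<forall>y. \<bar>max_bump L y\<bar> \<le> C" by auto
    then have "\<bar>max_bump (p # L) y\<bar> \<le> max C \<bar>snd (snd p)\<bar>" for y
      using abs_bump_le[of p y] by (simp add: max_def abs_if) (smt (verit))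
    then show ?case by blast
  qed auto
  then show ?thesis by (auto simp: bounded_iff)
qed

lemma max_bump_nonneg: "0 \<le> max_bump L y"
  by (induction L) auto

lemma max_bump_le: "(\<And>p. p \<in> set L \<Longrightarrow> bump p y \<le> c) \<Longrightarrow> 0 \<le> c \<Longrightarrow> max_bump L y \<le> c"
  by (induction L) auto

lemma bump_le_max_bump: "p \<in> set L \<Longrightarrow> bump p y \<le> max_bump L y"
  by (induction L) auto

definition bump_params :: "((real^'q::finite) \<times> real \<times> real) set" where
  "bump_params = (SOME D. countable D \<and> (\<forall>X. open X \<and> X \<noteq> {} \<longrightarrow> (\<exists>d\<in>D. d \<in> X))) \<times> (\<rat> \<times> \<rat>)"

lemma
  shows countable_bump_params: "countable (bump_params :: ((real^'q::finite) \<times> real \<times> real) set)"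
    and bump_params_dense: "open X \<Longrightarrow> X \<noteq> {} \<Longrightarrow> r \<in> \<rat> \<Longrightarrow> h \<in> \<rat> \<Longrightarrow>
           \<exists>c\<in>X. (c :: real^'q, r, h) \<in> bump_params"
proof -
  define D where "D = (SOME D :: (real^'q) set. countable D \<and> (\<forall>X. open X \<and> X \<noteq> {} \<longrightarrow> (\<exists>d\<in>D. d \<in> X)))"
  have D: "countable D \<and> (\<forall>X. open X \<and> X \<noteq> {} \<longrightarrow> (\<exists>d\<in>D. d \<in> X))"
    unfolding D_def by (rule someI_ex) (metis countable_dense_exists)
  show "countable (bump_params :: ((real^'q) \<times> real \<times> real) set)"
    using D by (auto simp: bump_params_def countable_rat simp flip: D_def)
  show "open X \<Longrightarrow> X \<noteq> {} \<Longrightarrow> r \<in> \<rat> \<Longrightarrow> h \<in> \<rat> \<Longrightarrow> \<exists>c\<in>X. (c :: real^'q, r, h) \<in> bump_params"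
    using D by (auto simp: bump_params_def simp flip: D_def)
qed

text \<open>A nonnegative continuous function is the pointwise supremum of the countably many bumps
  below it: if \<open>f\<close> exceeds \<open>h\<close> on a ball around \<open>y\<close>, a bump
  of height \<open>h\<close> supported in that ball stays below \<open>f\<close>.\<close>

lemma bump_approx_below:
  fixes f :: "real^'q::finite \<Rightarrow> real"
  assumes cont: "continuous_on UNIV f" and nn: "\<And>y. 0 \<le> f y" and e: "0 < e"
  shows "\<exists>p\<in>bump_params. (\<forall>z. bump p z \<le> f z) \<and> f y - e < bump p y"
proof (cases "f y = 0")
  case True
  \<comment> \<open>Height 0 gives the zero function, which lies below \<open>f\<close> and attains
    \<open>f y\<close>.\<close>
  obtain c :: "real^'q" where "(c, 1, 0) \<in> bump_params"
    using bump_params_dense[of UNIV 1 0] by auto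
  then show ?thesis using True nn e by (intro bexI[of _ "(c, 1, 0)"]) (auto simp: bump_def)
next
  case False
  then have "max 0 (f y - e) < f y" using nn[of y] e by auto
  then obtain h where h: "h \<in> \<rat>" "max 0 (f y - e) < h" "h < f y"
    using Rats_dense_in_real by blast
  have "open {z. h < f z}"
    by (intro open_Collect_less continuous_intros cont)
  then obtain \<rho> where \<rho>: "0 < \<rho>" "ball y \<rho> \<subseteq> {z. h < f z}"
    using h unfolding open_contains_ball by blast
  \<comment> \<open>A centre within \<open>r\<close> of \<open>y\<close> and a support of radius
    \<open>2 * r\<close> keep the bump within \<open>3 * r\<close> of \<open>y\<close>, hence inside
    the ball of radius \<open>\<rho>\<close>.\<close>
  obtain r where r: "r \<in> \<rat>" "0 < r" "r < \<rho> / 3"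
    using Rats_dense_in_real[of 0 "\<rho> / 3"] \<rho> by auto
  obtain c where c: "c \<in> ball y r" "(c, r, h) \<in> bump_params"
    using bump_params_dense[of "ball y r" r h] r h by auto
  have "bump (c, r, h) z \<le> f z" for z
  proof (cases "dist z c < 2 * r")
    case True
    have "dist y z < \<rho>"
      using True c r dist_triangle[of y z c] by (auto simp: dist_commute)
    then have "h < f z" using \<rho> by auto
    moreover have "bump (c, r, h) z \<le> h"
      using abs_bump_le[of "(c, r, h)" z] h by auto
    ultimately show ?thesis by linarith
  next
    case F: False
    then have "2 - dist z c / r \<le> 0" using r by (simp add: field_simps)
    then show ?thesis using nn by (simp add: bump_def)
  qed
  moreover have "bump (c, r, h) y = h"
    using c r by (auto simp: bump_def field_simps min_def max_def)
  ultimately show ?thesis using c h by (intro bexI[of _ "(c, r, h)"]) auto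
qed

text \<open>The portmanteau argument: some finite maximum of bumps below \<open>f\<close> already
  has \<open>Q\<close>-integral within \<open>e / 2\<close> of that of \<open>f\<close>; convergence
  is known for this one function, and monotonicity passes the lower bound on to \<open>f\<close>.
  Approximation from below yields one side only.\<close>

lemma liminf_integral_of_bumps:
  fixes f :: "real^'q::finite \<Rightarrow> real"
  assumes Q: "Q \<in> prob_dists" and Qs: "\<And>k. Qs k \<in> prob_dists"
    and conv: "\<And>L. set L \<subseteq> bump_params \<Longrightarrow>
        (\<lambda>k. integral\<^sup>L (Qs k) (max_bump L)) \<longlonglongrightarrow> integral\<^sup>L Q (max_bump L)"
    and cont: "continuous_on UNIV f" and nn: "\<And>y. 0 \<le> f y" and bd: "bounded (range f)" and e: "0 < e"
  shows "\<forall>\<^sub>F k in sequentially. integral\<^sup>L Q f - e < integral\<^sup>L (Qs k) f"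
proof -
  define K where "K = {p \<in> bump_params. \<forall>z. bump p z \<le> f z}"
  have K: "countable K" "K \<noteq> {}"
    using countable_subset[OF _ countable_bump_params, of K] bump_approx_below[OF cont nn zero_less_one]
    unfolding K_def by (blast, blast)
  define g where "g m = max_bump (map (from_nat_into K) [0..<m])" for m
  have gK: "set (map (from_nat_into K) [0..<m]) \<subseteq> K" for m
    using from_nat_into[OF K(2)] by auto
  have meas: "max_bump L \<in> borel_measurable borel" for L :: "((real^'q) \<times> real \<times> real) list"
    by (intro borel_measurable_continuous_onI continuous_on_max_bump)
  have fm: "f \<in> borel_measurable borel"
    by (intro borel_measurable_continuous_onI cont)
  have g_le: "g m y \<le> f y" for m y
    unfolding g_def using gK[of m] nn by (intro max_bump_le) (auto simp: K_def)
  have g_lim: "(\<lambda>m. g m y) \<longlonglongrightarrow> f y" for y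
  proof (rule LIMSEQ_I)
    fix r :: real assume "0 < r"
    then obtain p where p: "p \<in> K" "f y - r < bump p y"
      using bump_approx_below[OF cont nn, of r y] by (auto simp: K_def)
    then obtain i where i: "from_nat_into K i = p"
      using from_nat_into_surj[OF K(1)] by blast
    have "norm (g m y - f y) < r" if "m \<ge> Suc i" for m
    proof -
      have "bump p y \<le> g m y"
        unfolding g_def using i that by (intro bump_le_max_bump) auto
      then show ?thesis using p g_le[of m y] by auto
    qed
    then show "\<exists>no. \<forall>m\<ge>no. norm (g m y - f y) < r" by blast
  qed
  have sQ: "sets Q = sets borel" using Q by (simp add: prob_dists_def)
  have "(\<lambda>m. integral\<^sup>L Q (g m)) \<longlonglongrightarrow> integral\<^sup>L Q f"
  proof (rule integral_dominated_convergence[where w = f])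
    show "integrable Q f" by (rule integrable_bounded_prob_dist[OF Q fm bd])
    show "f \<in> borel_measurable Q" "\<And>i. g i \<in> borel_measurable Q"
      using fm meas sQ by (auto simp: g_def cong: measurable_cong_sets)
    show "AE x in Q. (\<lambda>i. g i x) \<longlonglongrightarrow> f x" using g_lim by auto
    show "AE x in Q. norm (g i x) \<le> f x" for i
      using g_le[of i] by (intro AE_I2) (simp add: g_def max_bump_nonneg abs_of_nonneg)
  qed
  then have "\<forall>\<^sub>F m in sequentially. integral\<^sup>L Q f - e / 2 < integral\<^sup>L Q (g m)"
    using e by (intro order_tendstoD(1)) auto
  then obtain m where m: "integral\<^sup>L Q f - e / 2 < integral\<^sup>L Q (g m)"
    by (auto simp: eventually_sequentially)
  have "(\<lambda>k. integral\<^sup>L (Qs k) (g m)) \<longlonglongrightarrow> integral\<^sup>L Q (g m)"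
    unfolding g_def using gK[of m] by (intro conv) (auto simp: K_def)
  then have "\<forall>\<^sub>F k in sequentially. integral\<^sup>L Q (g m) - e / 2 < integral\<^sup>L (Qs k) (g m)"
    using e by (intro order_tendstoD(1)) auto
  then show ?thesis
  proof eventually_elim
    case (elim k)
    have "integral\<^sup>L (Qs k) (g m) \<le> integral\<^sup>L (Qs k) f"
      unfolding g_def
      by (intro integral_mono integrable_bounded_prob_dist[OF Qs] fm bd meas bounded_max_bump)
        (use g_le in \<open>auto simp: g_def\<close>)
    then show ?case using elim m by linarith
  qed
qed

lemma weak_conv_of_bumps:
  fixes Q :: "(real^'q::finite) measure"
  assumes Q: "Q \<in> prob_dists" and Qs: "\<And>k. Qs k \<in> prob_dists"
    and conv: "\<And>L. set L \<subseteq> bump_params \<Longrightarrow>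
        (\<lambda>k. integral\<^sup>L (Qs k) (max_bump L)) \<longlonglongrightarrow> integral\<^sup>L Q (max_bump L)"
  shows "weak_conv Qs Q"
  unfolding weak_conv_def
proof safe
  fix f :: "real^'q \<Rightarrow> real"
  assume cont: "continuous_on UNIV f" and bd: "bounded (range f)"
  obtain C where C: "\<And>y. \<bar>f y\<bar> \<le> C"
    using bd by (auto simp: bounded_iff)
  \<comment> \<open>The one-sided bound is for nonnegative functions. Adding the bound
    \<open>C\<close> makes both \<open>f\<close> and \<open>- f\<close> admissible, and the sign
    \<open>s\<close> turns the two lower bounds into convergence.\<close>
  have shift: "integral\<^sup>L R (\<lambda>y. C + s * f y) = C + s * integral\<^sup>L R f" if "R \<in> prob_dists" for R s
  proof -
    interpret prob_space R using that by (simp add: prob_dists_def)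
    have "integrable R f"
      by (intro integrable_bounded_prob_dist[OF that] borel_measurable_continuous_onI cont bd)
    then show ?thesis by (simp add: prob_space)
  qed
  have one_sided: "\<forall>\<^sub>F k in sequentially. s * integral\<^sup>L Q f - e < s * integral\<^sup>L (Qs k) f"
    if "0 < e" "s \<in> {-1, 1}" for e s
  proof -
    have "\<forall>\<^sub>F k in sequentially. integral\<^sup>L Q (\<lambda>y. C + s * f y) - e < integral\<^sup>L (Qs k) (\<lambda>y. C + s * f y)"
    proof (rule liminf_integral_of_bumps[OF Q Qs conv _ _ _ \<open>0 < e\<close>])
      show "continuous_on UNIV (\<lambda>y. C + s * f y)" by (intro continuous_intros cont)
      show "0 \<le> C + s * f y" for y using C[of y] that by auto
      have "\<bar>C + s * f y\<bar> \<le> 2 * C" for y using C[of y] that by auto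
      then show "bounded (range (\<lambda>y. C + s * f y))" unfolding bounded_iff by (intro exI[of _ "2 * C"]) auto
    qed
    then show ?thesis using shift[OF Q] shift[OF Qs] by simp
  qed
  show "(\<lambda>k. integral\<^sup>L (Qs k) f) \<longlonglongrightarrow> integral\<^sup>L Q f"
  proof (rule order_tendstoI)
    fix a assume "a < integral\<^sup>L Q f"
    then show "\<forall>\<^sub>F k in sequentially. a < integral\<^sup>L (Qs k) f"
      using one_sided[of "integral\<^sup>L Q f - a" 1] by simp
  next
    fix a assume "integral\<^sup>L Q f < a"
    then show "\<forall>\<^sub>F k in sequentially. integral\<^sup>L (Qs k) f < a"
      using one_sided[of "a - integral\<^sup>L Q f" "-1"] by simp
  qed
qed

lemma countable_convergence_determining:
  obtains F :: "nat \<Rightarrow> real^'q::finite \<Rightarrow> real"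
  where "\<And>i. continuous_on UNIV (F i)" "\<And>i. bounded (range (F i))"
    and "\<And>Q Qs. Q \<in> prob_dists \<Longrightarrow> (\<And>k. Qs k \<in> prob_dists) \<Longrightarrow>
           (\<And>i. (\<lambda>k. integral\<^sup>L (Qs k) (F i)) \<longlonglongrightarrow> integral\<^sup>L Q (F i)) \<Longrightarrow> weak_conv Qs Q"
proof -
  define K where "K = lists (bump_params :: ((real^'q) \<times> real \<times> real) set)"
  have K: "countable K" "K \<noteq> {}"
    using countable_lists[OF countable_bump_params] by (auto simp: K_def)
  define F where "F i = max_bump (from_nat_into K i)" for i
  show thesis
  proof (rule that[of F])
    fix Q Qs
    assume *: "Q \<in> prob_dists" "\<And>k. Qs k \<in> prob_dists"
      "\<And>i. (\<lambda>k. integral\<^sup>L (Qs k) (F i)) \<longlonglongrightarrow> integral\<^sup>L Q (F i)"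
    show "weak_conv Qs Q"
    proof (rule weak_conv_of_bumps[OF *(1,2)])
      fix L :: "((real^'q) \<times> real \<times> real) list" assume "set L \<subseteq> bump_params"
      then have "L \<in> K" by (auto simp: K_def)
      then obtain i where "from_nat_into K i = L" using from_nat_into_surj[OF K(1)] by blast
      then show "(\<lambda>k. integral\<^sup>L (Qs k) (max_bump L)) \<longlonglongrightarrow> integral\<^sup>L Q (max_bump L)"
        using *(3)[of i] by (simp add: F_def)
    qed
  qed (auto simp: F_def continuous_on_max_bump bounded_max_bump)
qed

subsection \<open>Weak openness of Tyler's domain\<close>

text \<open>The zero rows act as padding: frames of subspaces of every dimension then live in one
  compact set of square matrices.\<close>

definition orthonormal_rows :: "real^'q^'q::finite \<Rightarrow> bool" where
  "orthonormal_rows U \<longleftrightarrow> (\<forall>i. norm (U $ i) \<in> {0, 1}) \<and> (\<forall>i j. i \<noteq> j \<longrightarrow> U $ i \<bullet> U $ j = 0)"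

definition row_space :: "real^'q^'q::finite \<Rightarrow> (real^'q) set" where
  "row_space U = span (range (($) U))"

lemma orthonormal_rows_inner:
  "orthonormal_rows U \<Longrightarrow> U $ i \<bullet> U $ j = (if i = j then (norm (U $ i))\<^sup>2 else 0)"
  by (auto simp: orthonormal_rows_def power2_norm_eq_inner)

text \<open>Pythagoras, the sum over the rows being the orthogonal projection onto the row space.
  For a zero row the identity \<open>z \<bullet> U $ i = y \<bullet> U $ i\<close> holds because
  both sides vanish.\<close>

lemma orthonormal_rows_residual:
  assumes U: "orthonormal_rows U"
  shows "(norm (y - (\<Sum>i\<in>UNIV. (y \<bullet> U $ i) *\<^sub>R U $ i)))\<^sup>2 = (norm y)\<^sup>2 - (\<Sum>i\<in>UNIV. (y \<bullet> U $ i)\<^sup>2)"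
proof -
  define z where "z = (\<Sum>i\<in>UNIV. (y \<bullet> U $ i) *\<^sub>R U $ i)"
  have yz: "y \<bullet> z = (\<Sum>i\<in>UNIV. (y \<bullet> U $ i)\<^sup>2)"
    by (simp add: z_def inner_sum_right power2_eq_square)
  have zU: "z \<bullet> U $ i = y \<bullet> U $ i" for i
  proof -
    have "z \<bullet> U $ i = (\<Sum>j\<in>UNIV. (y \<bullet> U $ j) * (U $ j \<bullet> U $ i))"
      by (simp add: z_def inner_sum_left)
    also have "\<dots> = (\<Sum>j\<in>UNIV. if j = i then (y \<bullet> U $ i) * (norm (U $ i))\<^sup>2 else 0)"
      by (intro sum.cong) (auto simp: orthonormal_rows_inner[OF U])
    also have "\<dots> = (y \<bullet> U $ i) * (norm (U $ i))\<^sup>2" by simp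
    also have "\<dots> = y \<bullet> U $ i"
      using U by (cases "U $ i = 0") (auto simp: orthonormal_rows_def)
    finally show ?thesis .
  qed
  have zz: "z \<bullet> z = (\<Sum>i\<in>UNIV. (y \<bullet> U $ i)\<^sup>2)"
  proof -
    have "z \<bullet> z = (\<Sum>i\<in>UNIV. (y \<bullet> U $ i) * (z \<bullet> U $ i))"
      by (subst (2) z_def) (simp add: inner_sum_right)
    then show ?thesis by (simp add: zU power2_eq_square)
  qed
  have "(norm (y - z))\<^sup>2 = y \<bullet> y - 2 * (y \<bullet> z) + z \<bullet> z"
    by (simp add: power2_norm_eq_inner inner_diff inner_commute)
  then have "(norm (y - z))\<^sup>2 = (norm y)\<^sup>2 - (\<Sum>i\<in>UNIV. (y \<bullet> U $ i)\<^sup>2)"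
    by (simp add: yz zz power2_norm_eq_inner)
  then show ?thesis by (simp only: z_def)
qed

lemma row_space_iff:
  assumes U: "orthonormal_rows U"
  shows "y \<in> row_space U \<longleftrightarrow> (norm y)\<^sup>2 = (\<Sum>i\<in>UNIV. (y \<bullet> U $ i)\<^sup>2)"
proof -
  let ?p = "\<lambda>y. \<Sum>i\<in>UNIV. (y \<bullet> U $ i) *\<^sub>R U $ i"
  have "y \<in> row_space U \<longleftrightarrow> y = ?p y"
  proof
    assume "y \<in> row_space U"
    then show "y = ?p y"
      unfolding row_space_def
    proof (induction rule: span_induct)
      case base
      show ?case
      proof (rule subspaceI)
        fix c x assume "x \<in> {x. x = ?p x}"
        then have "c *\<^sub>R x = c *\<^sub>R ?p x" by simp
        also have "\<dots> = ?p (c *\<^sub>R x)" by (simp add: scaleR_sum_right)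
        finally show "c *\<^sub>R x \<in> {x. x = ?p x}" by (rule CollectI)
      qed (auto simp: inner_add_left scaleR_add_left sum.distrib)
    next
      case (step x)
      then obtain j where x: "x = U $ j" by auto
      have "?p (U $ j) = (\<Sum>i\<in>UNIV. if i = j then (norm (U $ j))\<^sup>2 *\<^sub>R U $ j else 0)"
        by (intro sum.cong) (auto simp: orthonormal_rows_inner[OF U])
      also have "\<dots> = U $ j"
        using U by (cases "U $ j = 0") (auto simp: orthonormal_rows_def)
      finally show ?case by (simp add: x)
    qed
  next
    assume "y = ?p y"
    moreover have "?p y \<in> row_space U"
      unfolding row_space_def by (intro span_sum span_scale span_base) auto
    ultimately show "y \<in> row_space U" by simp
  qed
  also have "\<dots> \<longleftrightarrow> (norm (y - ?p y))\<^sup>2 = 0" by simp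
  finally show ?thesis using orthonormal_rows_residual[OF U, of y] by simp
qed

text \<open>Each row contributes 0 or 1. This writes the dimension as a continuous function of the
  frame, so that dimensions converge along converging frames.\<close>

lemma dim_row_space:
  assumes U: "orthonormal_rows U"
  shows "real (dim (row_space U)) = (\<Sum>i\<in>UNIV. (norm (U $ i))\<^sup>2)"
proof -
  define I where "I = {i. U $ i \<noteq> 0}"
  have n1: "norm (U $ i) = 1" if "i \<in> I" for i
    using U that by (auto simp: I_def orthonormal_rows_def)
  have inj: "inj_on (($) U) I"
  proof (rule inj_onI)
    fix i j assume ij: "i \<in> I" "j \<in> I" "U $ i = U $ j"
    have "U $ i \<bullet> U $ j \<noteq> 0" using ij by (auto simp: I_def)
    then show "i = j" using orthonormal_rows_inner[OF U, of i j] by (auto split: if_splits)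
  qed
  have "independent (($) U ` I)"
  proof (rule pairwise_orthogonal_independent)
    show "pairwise orthogonal (($) U ` I)"
      using orthonormal_rows_inner[OF U] by (auto simp: pairwise_def orthogonal_def)
    show "0 \<notin> ($) U ` I" by (auto simp: I_def)
  qed
  moreover have "row_space U = span (($) U ` I)"
  proof -
    have "span (($) U ` I) = span (insert 0 (($) U ` I))"
      by (rule span_insert_0[symmetric])
    also have "insert 0 (($) U ` I) = insert 0 (range (($) U))"
      by (auto simp: I_def)
    finally show ?thesis by (simp add: row_space_def span_insert_0)
  qed
  ultimately have "dim (row_space U) = card I"
    by (simp add: dim_eq_card_independent card_image[OF inj])
  also have "real (card I) = (\<Sum>i\<in>I. (norm (U $ i))\<^sup>2)" by (simp add: n1)
  also have "\<dots> = (\<Sum>i\<in>UNIV. (norm (U $ i))\<^sup>2)"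
    by (intro sum.mono_neutral_left) (auto simp: I_def)
  finally show ?thesis .
qed

lemma subspace_eq_row_space:
  fixes W :: "(real^'q::finite) set"
  assumes "subspace W"
  obtains U where "orthonormal_rows U" "W = row_space U"
proof -
  obtain B where B: "pairwise orthogonal B" "\<And>x. x \<in> B \<Longrightarrow> norm x = 1" "independent B"
      "card B = dim W" "span B = W"
    using orthonormal_basis_subspace[OF assms] by metis
  have fB: "finite B" using B(3) by (simp add: finiteI_independent)
  have "card B \<le> card (UNIV :: 'q set)"
    using dim_subset_UNIV[of W] B(4) by simp
  then obtain I :: "'q set" where "card I = card B" using ex_card by metis
  then obtain b where b: "bij_betw b I B"
    using finite_same_card_bij[of I B] fB by auto
  define U :: "real^'q^'q" where "U = (\<chi> i. if i \<in> I then b i else 0)"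
  have bB: "b i \<in> B" if "i \<in> I" for i using b that by (auto simp: bij_betw_def)
  have "b i \<bullet> b j = 0" if "i \<in> I" "j \<in> I" "i \<noteq> j" for i j
  proof -
    have "b i \<noteq> b j" using b that by (auto simp: bij_betw_def inj_on_def)
    then show ?thesis using B(1) bB that by (auto simp: pairwise_def orthogonal_def)
  qed
  then have "orthonormal_rows U"
    using B(2) bB by (auto simp: orthonormal_rows_def U_def)
  moreover have "insert 0 (range (($) U)) = insert 0 B"
    using b by (auto simp: U_def bij_betw_def image_iff)
  then have "row_space U = W"
    unfolding row_space_def B(5)[symmetric] by (metis span_insert_0)
  ultimately show thesis using that by blast
qed

text \<open>For orthonormal rows the numerator is the squared distance from \<open>y\<close> to the
  row space. The denominator keeps the zero set and makes the dependence on \<open>U\<close>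
  Lipschitz, uniformly in \<open>y\<close>.\<close>

definition row_defect :: "real^'q^'q::finite \<Rightarrow> real^'q \<Rightarrow> real" where
  "row_defect U y = ((norm y)\<^sup>2 - (\<Sum>i\<in>UNIV. (y \<bullet> U $ i)\<^sup>2)) / (1 + (norm y)\<^sup>2)"

lemma one_plus_norm_pos [simp]: "0 < 1 + (norm y)\<^sup>2" "1 + (norm y)\<^sup>2 \<noteq> 0"
  by (smt (verit) zero_le_power2)+

lemma row_defect_nonneg: "orthonormal_rows U \<Longrightarrow> 0 \<le> row_defect U y"
  unfolding row_defect_def using orthonormal_rows_residual[of U y, symmetric]
  by (intro divide_nonneg_pos) simp_all

lemma row_defect_eq_0_iff: "orthonormal_rows U \<Longrightarrow> row_defect U y = 0 \<longleftrightarrow> y \<in> row_space U"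
  by (simp add: row_defect_def row_space_iff)

lemma continuous_on_row_defect: "continuous_on UNIV (row_defect U)"
  unfolding row_defect_def [abs_def] by (intro continuous_intros) auto

text \<open>A difference of two squared inner products factors and is quadratic in \<open>y\<close>,
  so the denominator absorbs it. Each of the \<open>CARD('q)\<close> rows costs at most
  \<open>2 * norm (U - V)\<close>, because rows have norm at most 1.\<close>

lemma row_defect_diff:
  fixes U V :: "real^'q^'q::finite"
  assumes U: "orthonormal_rows U" and V: "orthonormal_rows V"
  shows "\<bar>row_defect U y - row_defect V y\<bar> \<le> 2 * real CARD('q) * norm (U - V)"
proof -
  have "row_defect U y - row_defect V y = (\<Sum>i\<in>UNIV. ((y \<bullet> V $ i)\<^sup>2 - (y \<bullet> U $ i)\<^sup>2) / (1 + (norm y)\<^sup>2))"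
    by (simp add: row_defect_def sum_subtractf diff_divide_distrib sum_divide_distrib)
  also have "\<bar>\<dots>\<bar> \<le> (\<Sum>i\<in>UNIV. \<bar>((y \<bullet> V $ i)\<^sup>2 - (y \<bullet> U $ i)\<^sup>2) / (1 + (norm y)\<^sup>2)\<bar>)"
    by (rule sum_abs)
  also have "\<dots> \<le> (\<Sum>i\<in>(UNIV::'q set). 2 * norm (U - V))"
  proof (rule sum_mono)
    fix i :: 'q
    have le1: "norm (V $ i + U $ i) \<le> 2"
    proof -
      have "norm (U $ i) \<le> 1" "norm (V $ i) \<le> 1"
        using U V unfolding orthonormal_rows_def by (metis insert_iff singletonD order_refl zero_le_one)+
      then show ?thesis using norm_triangle_ineq[of "V $ i" "U $ i"] by linarith
    qed
    have le2: "norm (V $ i - U $ i) \<le> norm (U - V)"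
      using Finite_Cartesian_Product.norm_nth_le[of "V - U" i] by (simp add: norm_minus_commute)
    have "(y \<bullet> V $ i)\<^sup>2 - (y \<bullet> U $ i)\<^sup>2 = (y \<bullet> (V $ i - U $ i)) * (y \<bullet> (V $ i + U $ i))"
      by (simp add: inner_diff_right inner_add_right power2_eq_square algebra_simps)
    also have "\<bar>\<dots>\<bar> \<le> (norm y * norm (V $ i - U $ i)) * (norm y * norm (V $ i + U $ i))"
      unfolding abs_mult by (intro mult_mono Cauchy_Schwarz_ineq2) auto
    also have "\<dots> \<le> (norm y * norm (U - V)) * (norm y * 2)"
      using le1 le2 by (intro mult_mono) auto
    also have "\<dots> = (norm y)\<^sup>2 * (2 * norm (U - V))" by (simp add: power2_eq_square)
    also have "\<dots> \<le> (1 + (norm y)\<^sup>2) * (2 * norm (U - V))" by (intro mult_right_mono) auto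
    finally show "\<bar>((y \<bullet> V $ i)\<^sup>2 - (y \<bullet> U $ i)\<^sup>2) / (1 + (norm y)\<^sup>2)\<bar> \<le> 2 * norm (U - V)"
      by (simp add: abs_divide divide_le_eq mult.commute)
  qed
  finally show ?thesis by simp
qed

lemma compact_orthonormal_rows: "compact {U :: real^'q^'q::finite. orthonormal_rows U}"
proof -
  have "bounded {U :: real^'q^'q. orthonormal_rows U}"
    unfolding bounded_iff
  proof (intro exI ballI)
    fix U :: "real^'q^'q" assume "U \<in> {U. orthonormal_rows U}"
    then have U: "norm (U $ i) = 0 \<or> norm (U $ i) = 1" for i
      unfolding orthonormal_rows_def by blast
    have "norm (U $ i) \<le> 1" for i using U[of i] by linarith
    then have "(\<Sum>i\<in>UNIV. norm (U $ i)) \<le> (\<Sum>i\<in>(UNIV::'q set). 1)" by (intro sum_mono) auto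
    moreover have "norm U \<le> (\<Sum>i\<in>UNIV. norm (U $ i))" by (simp add: norm_vec_def L2_set_le_sum)
    ultimately show "norm U \<le> real CARD('q)" by simp
  qed
  moreover have "closed {U :: real^'q^'q. orthonormal_rows U}"
  proof -
    have *: "{U :: real^'q^'q. orthonormal_rows U} =
       (\<Inter>i. {U. norm (U $ i) = 0} \<union> {U. norm (U $ i) = 1}) \<inter> (\<Inter>i. \<Inter>j\<in>-{i}. {U. U $ i \<bullet> U $ j = 0})"
      by (auto simp: orthonormal_rows_def)
    show ?thesis
      unfolding * by (intro closed_Int closed_INT ballI closed_Un closed_Collect_eq continuous_intros)
  qed
  ultimately show ?thesis by (simp add: compact_eq_bounded_closed)
qed

text \<open>If infinitely many \<open>Qs k\<close> violate a subspace condition, frames of the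
  offending subspaces converge along a subsequence to some \<open>V\<close>, and so do the
  dimensions. The mass bound survives in the limit and contradicts the strict inequality for
  \<open>Q\<close> at \<open>row_space V\<close>. Mass at 0 is not controlled by weak convergence,
  hence the separate hypothesis.\<close>

lemma eventually_tyler_dom:
  fixes Q :: "(real^'q::finite) measure"
  assumes Q: "Q \<in> tyler_dom" and Qs: "\<And>k. Qs k \<in> prob_dists" "\<And>k. measure (Qs k) {0} = 0"
    and conv: "weak_conv Qs Q"
  shows "\<forall>\<^sub>F k in sequentially. Qs k \<in> tyler_dom"
proof (rule ccontr)
  let ?q = "real CARD('q)"
  have Qp: "Q \<in> prob_dists" using Q by (simp add: tyler_dom_def)
  assume "\<not> ?thesis"
  then have "\<exists>\<^sub>F k in sequentially. Qs k \<notin> tyler_dom" by (simp add: frequently_def)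
  then have "infinite {k. Qs k \<notin> tyler_dom}" by (simp add: frequently_sequentially infinite_nat_iff_unbounded_le)
  then obtain s :: "nat \<Rightarrow> nat" where s: "strict_mono s" "\<And>k. Qs (s k) \<notin> tyler_dom"
    using infinite_enumerate by blast
  have "\<exists>U. orthonormal_rows U \<and> 1 \<le> dim (row_space U) \<and> dim (row_space U) < CARD('q) \<and>
          real (dim (row_space U)) / ?q \<le> measure (Qs (s k)) (row_space U)" for k
  proof -
    obtain W where "subspace W" "1 \<le> dim W" "dim W < CARD('q)" "real (dim W) / ?q \<le> measure (Qs (s k)) W"
      using s(2)[of k] Qs[of "s k"] unfolding tyler_dom_def by (auto simp: not_less)
    then show ?thesis by (metis subspace_eq_row_space)
  qed
  then obtain U where U: "\<And>k. orthonormal_rows (U k)" "\<And>k. 1 \<le> dim (row_space (U k))"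
      "\<And>k. dim (row_space (U k)) < CARD('q)"
      "\<And>k. real (dim (row_space (U k))) / ?q \<le> measure (Qs (s k)) (row_space (U k))"
    by metis
  obtain V r where V: "orthonormal_rows V" and r: "strict_mono r" "(U \<circ> r) \<longlonglongrightarrow> V"
    using compact_orthonormal_rows[unfolded compact_def] U(1) by (metis (mono_tags, lifting) mem_Collect_eq)
  define D where "D k = real (dim (row_space (U (r k))))" for k
  have D: "D \<longlonglongrightarrow> real (dim (row_space V))"
    unfolding D_def dim_row_space[OF U(1)] dim_row_space[OF V]
    using r(2) by (intro tendsto_intros) (auto simp: o_def)
  have D1: "1 \<le> real (dim (row_space V))"
    using U(2) by (intro tendsto_lowerbound[OF D]) (auto simp: D_def Suc_le_eq)
  \<comment> \<open>A strict inequality could be lost in the limit; integrality first turns it into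
    the closed condition with bound \<open>?q - 1\<close>.\<close>
  have D2: "real (dim (row_space V)) \<le> ?q - 1"
  proof (rule tendsto_upperbound[OF D])
    have "D k \<le> ?q - 1" for k
      using U(3)[of "r k"] unfolding D_def by linarith
    then show "\<forall>\<^sub>F k in sequentially. D k \<le> ?q - 1" by simp
  qed simp
  define \<epsilon> where "\<epsilon> k = 2 * ?q * norm (U (r k) - V)" for k
  have "(\<lambda>k. 2 * ?q * norm (U (r k) - V)) \<longlonglongrightarrow> 2 * ?q * norm (V - V)"
    using r(2) by (intro tendsto_intros) (auto simp: o_def)
  then have \<epsilon>: "\<epsilon> \<longlonglongrightarrow> 0" by (simp add: \<epsilon>_def [abs_def])
  \<comment> \<open>A continuous cut-off around the limit subspace, replacing its indicator, to
    which weak convergence does not apply. On the subspace of \<open>U (r k)\<close> the defect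
    relative to \<open>V\<close> is at most \<open>\<epsilon> k\<close>, so
    \<open>h \<delta>\<close> is at least \<open>1 - \<epsilon> k / \<delta>\<close> there.\<close>
  define h where "h \<delta> y = max 0 (1 - row_defect V y / \<delta>)" for \<delta> y
  have h_range: "0 \<le> h \<delta> y" "h \<delta> y \<le> 1" if "0 < \<delta>" for \<delta> y
    using row_defect_nonneg[OF V, of y] that by (auto simp: h_def)
  have h_cont: "continuous_on UNIV (h \<delta>)" if "0 < \<delta>" for \<delta>
    unfolding h_def [abs_def] using that
    by (intro continuous_intros continuous_on_max continuous_on_divide continuous_on_row_defect) auto
  have h_bd: "bounded (range (h \<delta>))" if "0 < \<delta>" for \<delta>
    using h_range[OF that] by (auto simp: bounded_iff intro!: exI[of _ 1])
  have h_meas: "h \<delta> \<in> borel_measurable borel" if "0 < \<delta>" for \<delta>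
    by (intro borel_measurable_continuous_onI h_cont that)
  have key: "real (dim (row_space V)) / ?q \<le> integral\<^sup>L Q (h \<delta>)" if \<delta>: "0 < \<delta>" for \<delta>
  proof -
    have "(\<lambda>k. integral\<^sup>L (Qs (s (r k))) (h \<delta>)) \<longlonglongrightarrow> integral\<^sup>L Q (h \<delta>)"
      using conv h_cont[OF \<delta>] h_bd[OF \<delta>] LIMSEQ_subseq_LIMSEQ[OF _ strict_mono_o[OF s(1) r(1)]]
      unfolding weak_conv_def by (fastforce simp: o_def)
    moreover have "(\<lambda>k. (D k / ?q) * (1 - \<epsilon> k / \<delta>)) \<longlonglongrightarrow> real (dim (row_space V)) / ?q * (1 - 0 / \<delta>)"
      using \<delta> by (intro tendsto_intros D \<epsilon>) auto
    moreover have "(D k / ?q) * (1 - \<epsilon> k / \<delta>) \<le> integral\<^sup>L (Qs (s (r k))) (h \<delta>)" for k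
    proof (cases "1 - \<epsilon> k / \<delta> \<ge> 0")
      case True
      let ?R = "Qs (s (r k))" and ?W = "row_space (U (r k))"
      interpret prob_space ?R using Qs[of "s (r k)"] by (simp add: prob_dists_def)
      have sR: "sets ?R = sets borel" using Qs[of "s (r k)"] by (simp add: prob_dists_def)
      have W: "?W \<in> sets ?R"
        unfolding sR row_space_def by (intro borel_closed closed_subspace) simp
      have "(D k / ?q) * (1 - \<epsilon> k / \<delta>) \<le> measure ?R ?W * (1 - \<epsilon> k / \<delta>)"
        using U(4)[of "r k"] True by (intro mult_right_mono) (auto simp: D_def)
      also have "\<dots> = (\<integral>y. (1 - \<epsilon> k / \<delta>) * indicator ?W y \<partial>?R)" using W by (simp add: mult.commute)
      also have "\<dots> \<le> integral\<^sup>L ?R (h \<delta>)"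
      proof (rule integral_mono)
        show "integrable ?R (\<lambda>y. (1 - \<epsilon> k / \<delta>) * indicator ?W y)" using W by (simp add: emeasure_eq_measure)
        show "integrable ?R (h \<delta>)" by (intro integrable_bounded_prob_dist[OF Qs(1)] h_meas h_bd \<delta>)
        fix y show "(1 - \<epsilon> k / \<delta>) * indicator ?W y \<le> h \<delta> y"
        proof (cases "y \<in> ?W")
          case yW: True
          then have "row_defect V y \<le> \<epsilon> k"
            using row_defect_diff[OF U(1) V, of "r k" y] row_defect_eq_0_iff[OF U(1), of "r k" y]
            by (simp add: \<epsilon>_def)
          then show ?thesis using \<delta> yW by (simp add: h_def divide_right_mono le_max_iff_disj)
        qed (simp add: h_range[OF \<delta>])
      qed
      finally show ?thesis .
    next
      case False
      have "(D k / ?q) * (1 - \<epsilon> k / \<delta>) \<le> 0"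
        using False by (intro mult_nonneg_nonpos) (auto simp: D_def)
      also have "0 \<le> integral\<^sup>L (Qs (s (r k))) (h \<delta>)" using h_range[OF \<delta>] by (intro Bochner_Integration.integral_nonneg) auto
      finally show ?thesis .
    qed
    ultimately show ?thesis
      using LIMSEQ_le[of "\<lambda>k. (D k / ?q) * (1 - \<epsilon> k / \<delta>)" _ "\<lambda>k. integral\<^sup>L (Qs (s (r k))) (h \<delta>)"] by auto
  qed
  interpret prob_space Q using Qp by (simp add: prob_dists_def)
  have sQ: "sets Q = sets borel" using Qp by (simp add: prob_dists_def)
  have W: "row_space V \<in> sets Q"
    unfolding sQ row_space_def by (intro borel_closed closed_subspace) simp
  \<comment> \<open>With \<open>\<delta>\<close> tending to 0 the cut-offs shrink to the indicator
    of the subspace itself, since the defect is positive off it.\<close>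
  have "(\<lambda>n. integral\<^sup>L Q (h (1 / real (Suc n)))) \<longlonglongrightarrow> integral\<^sup>L Q (indicator (row_space V))"
  proof (rule integral_dominated_convergence[where w = "\<lambda>_. 1"])
    show "AE y in Q. (\<lambda>n. h (1 / real (Suc n)) y) \<longlonglongrightarrow> indicator (row_space V) y"
    proof (rule AE_I2)
      fix y
      show "(\<lambda>n. h (1 / real (Suc n)) y) \<longlonglongrightarrow> indicator (row_space V) y"
      proof (cases "y \<in> row_space V")
        case True
        then show ?thesis using row_defect_eq_0_iff[OF V, of y] by (simp add: h_def)
      next
        case False
        then have pos: "0 < row_defect V y"
          using row_defect_eq_0_iff[OF V, of y] row_defect_nonneg[OF V, of y] by linarith
        obtain m where m: "1 / row_defect V y < real m" using reals_Archimedean2 by blast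
        have "h (1 / real (Suc n)) y = 0" if "n \<ge> m" for n
        proof -
          have "1 / row_defect V y < real (Suc n)" using m that by linarith
          then have "1 < row_defect V y * real (Suc n)" using pos by (simp add: field_simps)
          then show ?thesis by (simp add: h_def)
        qed
        then have "\<forall>\<^sub>F n in sequentially. h (1 / real (Suc n)) y = 0"
          by (auto simp: eventually_sequentially)
        then show ?thesis using False by (simp add: tendsto_eventually)
      qed
    qed
    show "indicator (row_space V) \<in> borel_measurable Q" using W by simp
    show "h (1 / real (Suc n)) \<in> borel_measurable Q" for n
      using h_meas[of "1 / real (Suc n)"] sQ by (simp cong: measurable_cong_sets)
    show "AE y in Q. norm (h (1 / real (Suc n)) y) \<le> 1" for n
      using h_range[of "1 / real (Suc n)"] by (intro AE_I2) simp
  qed simp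
  then have "real (dim (row_space V)) / ?q \<le> integral\<^sup>L Q (indicator (row_space V))"
    using key by (intro LIMSEQ_le_const) auto
  then have "real (dim (row_space V)) / ?q \<le> measure Q (row_space V)" using W by simp
  moreover have "measure Q (row_space V) < real (dim (row_space V)) / ?q"
  proof -
    have "subspace (row_space V)" by (simp add: row_space_def)
    moreover have "1 \<le> dim (row_space V)" using D1 by linarith
    moreover have "dim (row_space V) < CARD('q)" using D2 by linarith
    ultimately show ?thesis using Q unfolding tyler_dom_def by blast
  qed
  ultimately show False by linarith
qed

subsection \<open>Differentiability on weak neighbourhoods\<close>

text \<open>Puts both cases into one form of sequential openness. The condition at the origin is an
  implication: it is vacuous when \<open>Q\<close> charges 0, as may happen in case (a), and in case
  (b) it keeps the sequence free of mass at 0.\<close>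

lemma sequentially_open_domain:
  assumes dom: "case_a \<Q> Sig \<or> \<Q> = tyler_dom" and Q: "Q \<in> \<Q>"
  shows "Q \<in> prob_dists"
    and "(\<And>k. Qs k \<in> prob_dists) \<Longrightarrow> (\<And>k. measure Q {0} = 0 \<Longrightarrow> measure (Qs k) {0} = 0) \<Longrightarrow>
           weak_conv Qs Q \<Longrightarrow> \<forall>\<^sub>F k in sequentially. Qs k \<in> \<Q>"
proof -
  show "Q \<in> prob_dists"
    using dom Q by (auto simp: case_a_def weak_open_def tyler_dom_def)
  assume *: "\<And>k. Qs k \<in> prob_dists" "\<And>k. measure Q {0} = 0 \<Longrightarrow> measure (Qs k) {0} = 0" "weak_conv Qs Q"
  from dom show "\<forall>\<^sub>F k in sequentially. Qs k \<in> \<Q>"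
  proof
    assume "case_a \<Q> Sig"
    then show ?thesis using * Q unfolding case_a_def weak_open_def by blast
  next
    assume t: "\<Q> = tyler_dom"
    then have "measure Q {0} = 0" using Q by (simp add: tyler_dom_def)
    then show ?thesis using eventually_tyler_dom[of Q Qs] * Q t by simp
  qed
qed

text \<open>Sequential differentiability is turned into a statement about finitely many test functions, so
  that convergence in probability of the empirical measures suffices and no almost sure
  convergence is needed.\<close>

lemma estimator_neighbourhood:
  fixes Q :: "(real^'q::finite) measure"
  assumes dom: "case_a \<Q> Sig \<or> \<Q> = tyler_dom" and Q: "Q \<in> \<Q>"
    and deriv: "is_deriv \<Q> Sig Q J" and e: "0 < e"
  shows "\<exists>(Fs :: (real^'q \<Rightarrow> real) set) \<delta>. finite Fs \<and> (\<forall>f\<in>Fs. continuous_on UNIV f \<and> bounded (range f)) \<and> 0 < \<delta> \<and>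
     (\<forall>R\<in>prob_dists. (measure Q {0} = 0 \<longrightarrow> measure R {0} = 0) \<longrightarrow>
        (\<forall>f\<in>Fs. \<bar>integral\<^sup>L R f - integral\<^sup>L Q f\<bar> < \<delta>) \<longrightarrow>
        R \<in> \<Q> \<and> norm (Sig R - Sig Q - integral\<^sup>L R J) \<le> e * norm (integral\<^sup>L R J))"
proof -
  obtain F :: "nat \<Rightarrow> real^'q \<Rightarrow> real" where
    F: "\<And>i. continuous_on UNIV (F i)" "\<And>i. bounded (range (F i))"
    and det: "\<And>Q Qs. Q \<in> prob_dists \<Longrightarrow> (\<And>k. Qs k \<in> prob_dists) \<Longrightarrow>
           (\<And>i. (\<lambda>k. integral\<^sup>L (Qs k) (F i)) \<longlonglongrightarrow> integral\<^sup>L Q (F i)) \<Longrightarrow> weak_conv Qs Q"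
    using countable_convergence_determining by metis
  define good where "good R \<longleftrightarrow> R \<in> \<Q> \<and> norm (Sig R - Sig Q - integral\<^sup>L R J) \<le> e * norm (integral\<^sup>L R J)" for R
  \<comment> \<open>The first \<open>m\<close> test functions are controlled with tolerance
    \<open>1 / real (Suc m)\<close>, so that picking one bad measure from each \<open>near m\<close>
    yields a sequence along which every test function converges.\<close>
  define near where "near m R \<longleftrightarrow> R \<in> prob_dists \<and> (measure Q {0} = 0 \<longrightarrow> measure R {0} = 0) \<and>
       (\<forall>i<m. \<bar>integral\<^sup>L R (F i) - integral\<^sup>L Q (F i)\<bar> < 1 / real (Suc m))" for m R
  have "\<exists>m. \<forall>R. near m R \<longrightarrow> good R"
  proof (rule ccontr)
    assume "\<not> ?thesis"
    then obtain Rs where Rs: "\<And>m. near m (Rs m)" "\<And>m. \<not> good (Rs m)" by metis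
    have Rp: "Rs k \<in> prob_dists" for k using Rs(1) by (simp add: near_def)
    note Qp = sequentially_open_domain(1)[OF dom Q]
    have wc: "weak_conv Rs Q"
    proof (rule det[OF Qp Rp])
      fix i
      have "(\<lambda>k. integral\<^sup>L (Rs k) (F i) - integral\<^sup>L Q (F i)) \<longlonglongrightarrow> 0"
      proof (rule Lim_null_comparison[OF _ LIMSEQ_Suc[OF lim_1_over_n]])
        show "\<forall>\<^sub>F k in sequentially. norm (integral\<^sup>L (Rs k) (F i) - integral\<^sup>L Q (F i)) \<le> 1 / real (Suc k)"
          using eventually_gt_at_top[of i]
        proof eventually_elim
          case (elim k)
          then show ?case using Rs(1)[of k] unfolding near_def by (auto intro: less_imp_le)
        qed
      qed
      then show "(\<lambda>k. integral\<^sup>L (Rs k) (F i)) \<longlonglongrightarrow> integral\<^sup>L Q (F i)" by (simp add: LIM_zero_iff)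
    qed
    then have ev: "\<forall>\<^sub>F k in sequentially. Rs k \<in> \<Q>"
      using Rs(1) by (intro sequentially_open_domain(2)[OF dom Q]) (auto simp: near_def)
    \<comment> \<open>\<open>is_deriv\<close> speaks only about sequences lying in
      \<open>\<Q>\<close> throughout; the finitely many exceptional terms are replaced by
      \<open>Q\<close> itself.\<close>
    define Rs' where "Rs' k = (if Rs k \<in> \<Q> then Rs k else Q)" for k
    have eq: "\<forall>\<^sub>F k in sequentially. Rs' k = Rs k" using ev by eventually_elim (simp add: Rs'_def)
    have "weak_conv Rs' Q"
      unfolding weak_conv_def
    proof safe
      fix f :: "real^'q \<Rightarrow> real" assume f: "continuous_on UNIV f" "bounded (range f)"
      have "(\<lambda>k. integral\<^sup>L (Rs k) f) \<longlonglongrightarrow> integral\<^sup>L Q f" using wc f by (simp add: weak_conv_def)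
      moreover have "\<forall>\<^sub>F k in sequentially. integral\<^sup>L (Rs k) f = integral\<^sup>L (Rs' k) f"
        using eq by eventually_elim simp
      ultimately show "(\<lambda>k. integral\<^sup>L (Rs' k) f) \<longlonglongrightarrow> integral\<^sup>L Q f" by (rule Lim_transform_eventually)
    qed
    moreover have "\<forall>k. Rs' k \<in> \<Q>" using Q by (simp add: Rs'_def)
    ultimately have "\<forall>\<^sub>F k in sequentially.
        norm (Sig (Rs' k) - Sig Q - integral\<^sup>L (Rs' k) J) \<le> e * norm (integral\<^sup>L (Rs' k) J)"
      using deriv e unfolding is_deriv_def by blast
    then have "\<forall>\<^sub>F k in sequentially. good (Rs k)"
      using ev eq by eventually_elim (simp add: good_def)
    then show False using Rs(2) by (simp add: eventually_False)
  qed
  then obtain m where m: "\<And>R. near m R \<Longrightarrow> good R" by blast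
  have good: "good R" if "R \<in> prob_dists" "measure Q {0} = 0 \<longrightarrow> measure R {0} = 0"
      "\<forall>f\<in>F ` {..<m}. \<bar>integral\<^sup>L R f - integral\<^sup>L Q f\<bar> < 1 / real (Suc m)" for R
    using m[of R] that by (simp add: near_def)
  show ?thesis
  proof (intro exI conjI)
    show "finite (F ` {..<m})" by simp
    show "\<forall>f\<in>F ` {..<m}. continuous_on UNIV f \<and> bounded (range f)" using F by auto
    show "0 < 1 / real (Suc m)" by simp
    show "\<forall>R\<in>prob_dists. (measure Q {0} = 0 \<longrightarrow> measure R {0} = 0) \<longrightarrow>
        (\<forall>f\<in>F ` {..<m}. \<bar>integral\<^sup>L R f - integral\<^sup>L Q f\<bar> < 1 / real (Suc m)) \<longrightarrow>
        R \<in> \<Q> \<and> norm (Sig R - Sig Q - integral\<^sup>L R J) \<le> e * norm (integral\<^sup>L R J)"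
      using good by (simp add: good_def)
  qed
qed

subsection \<open>Second moments of degenerate sums\<close>

locale iid_sample = prob_space M for M :: "'a measure" +
  fixes X :: "nat \<Rightarrow> 'a \<Rightarrow> real^'q::finite" and P :: "(real^'q) measure"
  assumes indep: "indep_vars (\<lambda>_. borel) X UNIV" and law: "\<And>i. distr M borel (X i) = P"
begin

lemma X_measurable [measurable]: "X i \<in> borel_measurable M"
  using indep by (auto simp: indep_vars_def)

lemma sets_P [measurable_cong, simp]: "sets P = sets borel" and space_P [simp]: "space P = UNIV"
  using law[of 0] by auto

lemma prob_space_P: "prob_space P"
  using prob_space_distr[OF X_measurable[of 0]] by (simp add: law)

lemma integral_X: "f \<in> borel_measurable borel \<Longrightarrow> (\<integral>\<omega>. f (X i \<omega>) \<partial>M) = integral\<^sup>L P (f :: _ \<Rightarrow> 'b::{banach, second_countable_topology})"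
  by (subst law[of i, symmetric]) (simp add: integral_distr)

text \<open>Fubini for one coordinate independent of the others. Every orthogonality argument below
  that involves \<open>g\<close> integrates out a single sample point while the remaining ones are
  kept as a tuple.\<close>

lemma integrate_out:
  fixes \<psi> :: "(nat \<Rightarrow> real^'q) \<times> (real^'q) \<Rightarrow> real"
  assumes l: "l \<notin> S" and m [measurable]: "\<psi> \<in> borel_measurable (PiM S (\<lambda>_. borel) \<Otimes>\<^sub>M borel)"
    and bd: "\<And>z. \<bar>\<psi> z\<bar> \<le> C"
  shows "(\<integral>\<omega>. \<psi> (restrict (\<lambda>i. X i \<omega>) S, X l \<omega>) \<partial>M) =
         (\<integral>\<omega>. (\<integral>y. \<psi> (restrict (\<lambda>i. X i \<omega>) S, y) \<partial>P) \<partial>M)"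
proof -
  let ?S = "PiM S (\<lambda>_. borel) :: (nat \<Rightarrow> real^'q) measure" and ?Y = "\<lambda>\<omega>. restrict (\<lambda>i. X i \<omega>) S"
  have Y [measurable]: "?Y \<in> measurable M ?S" by measurable
  \<comment> \<open>Independence is obtained for restrictions to disjoint index sets, so
    \<open>X l\<close> is wrapped as a tuple over \<open>{l}\<close> and unwrapped again by
    \<open>\<psi>'\<close>.\<close>
  let ?L = "PiM {l} (\<lambda>_. borel) :: (nat \<Rightarrow> real^'q) measure" and ?Z = "\<lambda>\<omega>. restrict (\<lambda>i. X i \<omega>) {l}"
  have Z [measurable]: "?Z \<in> measurable M ?L" by measurable
  have "indep_var ?S ?Y ?L ?Z"
    using l by (intro indep_var_restrict[OF indep]) auto
  then have D: "distr M (?S \<Otimes>\<^sub>M ?L) (\<lambda>\<omega>. (?Y \<omega>, ?Z \<omega>)) = distr M ?S ?Y \<Otimes>\<^sub>M distr M ?L ?Z"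
    unfolding indep_var_distribution_eq by simp
  define \<psi>' where "\<psi>' z = \<psi> (fst z, snd z l)" for z
  have \<psi>' [measurable]: "\<psi>' \<in> borel_measurable (?S \<Otimes>\<^sub>M ?L)"
    unfolding \<psi>'_def [abs_def] by measurable
  interpret LL: prob_space "distr M ?L ?Z" by (rule prob_space_distr) measurable
  interpret DD: prob_space "distr M ?S ?Y" by (rule prob_space_distr) measurable
  interpret pair_prob_space "distr M ?S ?Y" "distr M ?L ?Z" ..
  have "(\<integral>\<omega>. \<psi> (?Y \<omega>, X l \<omega>) \<partial>M) = (\<integral>\<omega>. \<psi>' (?Y \<omega>, ?Z \<omega>) \<partial>M)"
    by (simp add: \<psi>'_def)
  also have "\<dots> = integral\<^sup>L (distr M (?S \<Otimes>\<^sub>M ?L) (\<lambda>\<omega>. (?Y \<omega>, ?Z \<omega>))) \<psi>'"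
    by (rule integral_distr[symmetric]) measurable
  also have "\<dots> = integral\<^sup>L (distr M ?S ?Y \<Otimes>\<^sub>M distr M ?L ?Z) \<psi>'" by (simp add: D)
  also have "\<dots> = (\<integral>z. (\<integral>w. \<psi>' (z, w) \<partial>distr M ?L ?Z) \<partial>distr M ?S ?Y)"
  proof (rule integral_fst'[symmetric])
    show "integrable (distr M ?S ?Y \<Otimes>\<^sub>M distr M ?L ?Z) \<psi>'"
      using bd by (intro P.integrable_const_bound[where B = C]) (auto simp: \<psi>'_def)
  qed
  also have "\<dots> = (\<integral>z. (\<integral>y. \<psi> (z, y) \<partial>P) \<partial>distr M ?S ?Y)"
  proof (rule Bochner_Integration.integral_cong[OF refl])
    fix z assume "z \<in> space (distr M ?S ?Y)"
    then have [measurable]: "z \<in> space ?S" by simp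
    have "(\<integral>w. \<psi>' (z, w) \<partial>distr M ?L ?Z) = (\<integral>\<omega>. \<psi>' (z, ?Z \<omega>) \<partial>M)"
      by (rule integral_distr) measurable
    also have "\<dots> = (\<integral>\<omega>. \<psi> (z, X l \<omega>) \<partial>M)" by (simp add: \<psi>'_def)
    also have "\<dots> = (\<integral>y. \<psi> (z, y) \<partial>P)" by (rule integral_X) measurable
    finally show "(\<integral>w. \<psi>' (z, w) \<partial>distr M ?L ?Z) = (\<integral>y. \<psi> (z, y) \<partial>P)" .
  qed
  also have "\<dots> = (\<integral>\<omega>. (\<integral>y. \<psi> (?Y \<omega>, y) \<partial>P) \<partial>M)"
  proof (rule integral_distr)
    interpret PP: prob_space P by (rule prob_space_P)
    show "(\<lambda>z. \<integral>y. \<psi> (z, y) \<partial>P) \<in> borel_measurable ?S" by measurable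
  qed measurable
  finally show ?thesis .
qed

lemma integral_pair:
  fixes \<phi> :: "real^'q \<Rightarrow> real^'q \<Rightarrow> real"
  assumes "i \<noteq> j" and m [measurable]: "case_prod \<phi> \<in> borel_measurable (borel \<Otimes>\<^sub>M borel)"
    and bd: "\<And>x y. \<bar>\<phi> x y\<bar> \<le> C"
  shows "(\<integral>\<omega>. \<phi> (X i \<omega>) (X j \<omega>) \<partial>M) = (\<integral>x. (\<integral>y. \<phi> x y \<partial>P) \<partial>P)"
proof -
  interpret PP: prob_space P by (rule prob_space_P)
  have "(\<integral>\<omega>. \<phi> (X i \<omega>) (X j \<omega>) \<partial>M) = (\<integral>\<omega>. (\<lambda>z. \<phi> (fst z i) (snd z)) (restrict (\<lambda>i. X i \<omega>) {i}, X j \<omega>) \<partial>M)"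
    by simp
  also have "\<dots> = (\<integral>\<omega>. (\<integral>y. \<phi> (X i \<omega>) y \<partial>P) \<partial>M)"
    using assms by (subst integrate_out[where C = C]) (auto simp: bd)
  also have "\<dots> = (\<integral>x. (\<integral>y. \<phi> x y \<partial>P) \<partial>P)"
    by (rule integral_X) measurable
  finally show ?thesis .
qed

end

lemma (in prob_space) second_moment_orthogonal_sum:
  fixes V :: "'i \<Rightarrow> 'a \<Rightarrow> real"
  assumes T: "finite T" and int: "\<And>s t. s \<in> T \<Longrightarrow> t \<in> T \<Longrightarrow> integrable M (\<lambda>\<omega>. V s \<omega> * V t \<omega>)"
    and orth: "\<And>s t. s \<in> T \<Longrightarrow> t \<in> T \<Longrightarrow> s \<noteq> t \<Longrightarrow> expectation (\<lambda>\<omega>. V s \<omega> * V t \<omega>) = 0"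
  shows "expectation (\<lambda>\<omega>. (\<Sum>t\<in>T. V t \<omega>)\<^sup>2) = (\<Sum>t\<in>T. expectation (\<lambda>\<omega>. (V t \<omega>)\<^sup>2))"
proof -
  have "expectation (\<lambda>\<omega>. (\<Sum>t\<in>T. V t \<omega>)\<^sup>2) = expectation (\<lambda>\<omega>. \<Sum>s\<in>T. \<Sum>t\<in>T. V s \<omega> * V t \<omega>)"
    by (simp add: power2_eq_square sum_product)
  also have "\<dots> = (\<Sum>s\<in>T. \<Sum>t\<in>T. expectation (\<lambda>\<omega>. V s \<omega> * V t \<omega>))"
    using int by (simp add: integral_sum)
  also have "\<dots> = (\<Sum>s\<in>T. \<Sum>t\<in>T. if s = t then expectation (\<lambda>\<omega>. (V s \<omega>)\<^sup>2) else 0)"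
    using orth by (intro sum.cong) (auto simp: power2_eq_square)
  finally show ?thesis using T by simp
qed

text \<open>\<open>h\<close> and \<open>g\<close> are not tied to the same kernel: the joint limit
  combines \<open>h\<close> from one direction of a test vector with \<open>g\<close> from
  another.\<close>

locale hoeffding_pair = iid_sample M X P
  for M :: "'a measure" and X :: "nat \<Rightarrow> 'a \<Rightarrow> real^'q::finite" and P +
  fixes h :: "real^'q \<Rightarrow> real" and g :: "real^'q \<Rightarrow> real^'q \<Rightarrow> real" and C :: real
  assumes h_measurable [measurable]: "h \<in> borel_measurable borel"
    and g_measurable [measurable]: "case_prod g \<in> borel_measurable (borel \<Otimes>\<^sub>M borel)"
    and h_bound: "\<bar>h x\<bar> \<le> C" and g_bound: "\<bar>g x y\<bar> \<le> C"
    and h_centered: "integral\<^sup>L P h = 0"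
    and g_degenerate: "integral\<^sup>L P (g x) = 0"
    and g_sym: "g x y = g y x"
begin

lemma C_nonneg: "0 \<le> C"
  using h_bound[of 0] by linarith

lemma h_X_centered: "expectation (\<lambda>\<omega>. h (X i \<omega>)) = 0"
  using h_centered by (simp add: integral_X)

lemma g_X_centered:
  assumes "i \<noteq> j" shows "expectation (\<lambda>\<omega>. g (X i \<omega>) (X j \<omega>)) = 0"
  using integral_pair[OF assms g_measurable g_bound] by (simp add: g_degenerate)

lemma h_h_orthogonal:
  assumes "i \<noteq> j" shows "expectation (\<lambda>\<omega>. h (X i \<omega>) * h (X j \<omega>)) = 0"
proof -
  have "\<bar>h x * h y\<bar> \<le> C * C" for x y
    unfolding abs_mult using h_bound C_nonneg by (intro mult_mono) auto
  then show ?thesis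
    using integral_pair[OF assms, of "\<lambda>x y. h x * h y" "C * C"] by (simp add: h_centered)
qed

text \<open>At least one endpoint of the edge differs from \<open>i\<close>; integrating it out
  first kills the product by degeneracy of \<open>g\<close>, even if \<open>i\<close> is the other
  endpoint.\<close>

lemma h_g_orthogonal:
  assumes "j \<noteq> k" shows "expectation (\<lambda>\<omega>. h (X i \<omega>) * g (X j \<omega>) (X k \<omega>)) = 0"
proof -
  have *: "expectation (\<lambda>\<omega>. h (X i \<omega>) * g (X j \<omega>) (X k \<omega>)) = 0" if "j \<noteq> k" "i \<noteq> k" for j k
  proof -
    have "expectation (\<lambda>\<omega>. h (X i \<omega>) * g (X j \<omega>) (X k \<omega>)) =
      (\<integral>\<omega>. (\<lambda>z. h (fst z i) * g (fst z j) (snd z)) (restrict (\<lambda>i. X i \<omega>) {i, j}, X k \<omega>) \<partial>M)"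
      by simp
    also have "\<dots> = 0"
    proof (subst integrate_out[where C = "C * C"])
      show "\<bar>h (fst z i) * g (fst z j) (snd z)\<bar> \<le> C * C" for z
        unfolding abs_mult using h_bound g_bound C_nonneg by (intro mult_mono) auto
    qed (use that in \<open>auto simp: g_degenerate\<close>)
    finally show ?thesis .
  qed
  show ?thesis
  proof (cases "i = k")
    case True
    then show ?thesis using *[of k j] assms g_sym by simp
  qed (use * assms in auto)
qed

text \<open>Of two different unordered edges, the second has an endpoint outside the first, and
  integrating it out gives 0. Edges sharing a vertex are thus orthogonal too, although in general
  dependent.\<close>

lemma g_g_orthogonal:
  assumes ij: "i \<noteq> j" and kl: "k \<noteq> l" and ne: "{i, j} \<noteq> {k, l}"
  shows "expectation (\<lambda>\<omega>. g (X i \<omega>) (X j \<omega>) * g (X k \<omega>) (X l \<omega>)) = 0"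
proof -
  have *: "expectation (\<lambda>\<omega>. g (X i \<omega>) (X j \<omega>) * g (X k \<omega>) (X l \<omega>)) = 0" if "k \<noteq> l" "l \<notin> {i, j}" for k l
  proof -
    have "expectation (\<lambda>\<omega>. g (X i \<omega>) (X j \<omega>) * g (X k \<omega>) (X l \<omega>)) =
      (\<integral>\<omega>. (\<lambda>z. g (fst z i) (fst z j) * g (fst z k) (snd z)) (restrict (\<lambda>i. X i \<omega>) {i, j, k}, X l \<omega>) \<partial>M)"
      by simp
    also have "\<dots> = 0"
    proof (subst integrate_out[where C = "C * C"])
      show "\<bar>g (fst z i) (fst z j) * g (fst z k) (snd z)\<bar> \<le> C * C" for z
        unfolding abs_mult using g_bound C_nonneg by (intro mult_mono) auto
    qed (use that in \<open>auto simp: g_degenerate\<close>)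
    finally show ?thesis .
  qed
  show ?thesis
  proof (cases "l \<in> {i, j}")
    case True
    then have "k \<notin> {i, j}" using assms by auto
    then show ?thesis using *[of l k] kl g_sym by simp
  qed (use * kl in auto)
qed

definition h_var where "h_var = expectation (\<lambda>\<omega>. (h (X 0 \<omega>))\<^sup>2)"
definition g_var where "g_var = expectation (\<lambda>\<omega>. (g (X 0 \<omega>) (X 1 \<omega>))\<^sup>2)"

lemma h_var_nonneg: "0 \<le> h_var" and g_var_nonneg: "0 \<le> g_var"
  by (auto simp: h_var_def g_var_def)

lemma h_second_moment: "expectation (\<lambda>\<omega>. (h (X i \<omega>))\<^sup>2) = h_var"
  using integral_X[of "\<lambda>x. (h x)\<^sup>2"] by (simp add: h_var_def)

lemma g_second_moment:
  assumes "i \<noteq> j" shows "expectation (\<lambda>\<omega>. (g (X i \<omega>) (X j \<omega>))\<^sup>2) = g_var"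
proof -
  have "\<bar>(g x y)\<^sup>2\<bar> \<le> C\<^sup>2" for x y
    using g_bound[of x y] by (simp add: abs_le_square_iff[symmetric])
  then show ?thesis
    using integral_pair[OF assms, of "\<lambda>x y. (g x y)\<^sup>2" "C\<^sup>2"]
      integral_pair[of 0 1, of "\<lambda>x y. (g x y)\<^sup>2" "C\<^sup>2"]
    by (simp add: g_var_def)
qed

text \<open>Vertex terms and edge terms form a single orthogonal family, indexed by a disjoint sum,
  so no cross terms appear. The condition on \<open>E\<close> excludes loops and reversed edges; by
  symmetry of \<open>g\<close> a reversed edge would repeat the same random variable.\<close>

lemma second_moment:
  assumes I: "finite I" and E: "finite E" "\<And>i j. (i, j) \<in> E \<Longrightarrow> i \<noteq> j \<and> (j, i) \<notin> E"
  shows "expectation (\<lambda>\<omega>. (a * (\<Sum>i\<in>I. h (X i \<omega>)) + b * (\<Sum>(i, j)\<in>E. g (X i \<omega>) (X j \<omega>)))\<^sup>2) =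
     a\<^sup>2 * real (card I) * h_var + b\<^sup>2 * real (card E) * g_var"
proof -
  define V where "V t \<omega> = (case t of Inl i \<Rightarrow> a * h (X i \<omega>) | Inr e \<Rightarrow> b * g (X (fst e) \<omega>) (X (snd e) \<omega>))" for t \<omega>
  define T where "T = Inl ` I \<union> Inr ` E"
  have fT: "finite T" using I E by (simp add: T_def)
  have split: "(\<Sum>t\<in>T. F t) = (\<Sum>i\<in>I. F (Inl i)) + (\<Sum>e\<in>E. F (Inr e))" for F :: "_ \<Rightarrow> real"
    unfolding T_def using I E by (subst sum.union_disjoint) (auto simp: sum.reindex)
  have Vm [measurable]: "V t \<in> borel_measurable M" for t
    by (cases t) (auto simp: V_def [abs_def])
  have Vb: "\<bar>V t \<omega>\<bar> \<le> (\<bar>a\<bar> + \<bar>b\<bar>) * C" for t \<omega>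
  proof -
    have "\<bar>a\<bar> * \<bar>h x\<bar> \<le> (\<bar>a\<bar> + \<bar>b\<bar>) * C" "\<bar>b\<bar> * \<bar>g x y\<bar> \<le> (\<bar>a\<bar> + \<bar>b\<bar>) * C" for x y
      using h_bound g_bound C_nonneg by (auto intro!: mult_mono)
    then show ?thesis by (auto simp: V_def abs_mult split: sum.split)
  qed
  have "expectation (\<lambda>\<omega>. (\<Sum>t\<in>T. V t \<omega>)\<^sup>2) = (\<Sum>t\<in>T. expectation (\<lambda>\<omega>. (V t \<omega>)\<^sup>2))"
  proof (rule second_moment_orthogonal_sum[OF fT])
    fix s t
    have "\<bar>V s \<omega> * V t \<omega>\<bar> \<le> ((\<bar>a\<bar> + \<bar>b\<bar>) * C) * ((\<bar>a\<bar> + \<bar>b\<bar>) * C)" for \<omega>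
      unfolding abs_mult using Vb C_nonneg by (intro mult_mono) auto
    then show "integrable M (\<lambda>\<omega>. V s \<omega> * V t \<omega>)"
      by (intro integrable_const_bound[where B = "((\<bar>a\<bar> + \<bar>b\<bar>) * C) * ((\<bar>a\<bar> + \<bar>b\<bar>) * C)"]) auto
  next
    fix s t assume st: "s \<in> T" "t \<in> T" "s \<noteq> t"
    have hg: "expectation (\<lambda>\<omega>. a * h (X i \<omega>) * (b * g (X (fst e) \<omega>) (X (snd e) \<omega>))) = 0"
      "expectation (\<lambda>\<omega>. b * g (X (fst e) \<omega>) (X (snd e) \<omega>) * (a * h (X i \<omega>))) = 0" if "e \<in> E" for i e
      using h_g_orthogonal[of "fst e" "snd e" i] E(2)[of "fst e" "snd e"] that
      by (simp_all add: mult.assoc mult.left_commute mult.commute)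
    have hh: "expectation (\<lambda>\<omega>. a * h (X i \<omega>) * (a * h (X j \<omega>))) = 0" if "i \<noteq> j" for i j
      using h_h_orthogonal[OF that] by (simp add: mult.assoc mult.left_commute)
    have gg: "expectation (\<lambda>\<omega>. b * g (X (fst e) \<omega>) (X (snd e) \<omega>) * (b * g (X (fst e') \<omega>) (X (snd e') \<omega>))) = 0"
      if "e \<in> E" "e' \<in> E" "e \<noteq> e'" for e e'
    proof -
      have "{fst e, snd e} \<noteq> {fst e', snd e'}"
        using that E(2)[of "fst e" "snd e"] by (auto simp: doubleton_eq_iff prod_eq_iff)
      then show ?thesis
        using g_g_orthogonal[of "fst e" "snd e" "fst e'" "snd e'"] E(2)[of "fst e" "snd e"]
          E(2)[of "fst e'" "snd e'"] that
        by (simp add: mult.assoc mult.left_commute)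
    qed
    show "expectation (\<lambda>\<omega>. V s \<omega> * V t \<omega>) = 0"
      using st unfolding T_def V_def by (elim UnE imageE) (simp_all add: hh hg gg)
  qed
  also have "\<dots> = (\<Sum>i\<in>I. expectation (\<lambda>\<omega>. (a * h (X i \<omega>))\<^sup>2)) + (\<Sum>e\<in>E. expectation (\<lambda>\<omega>. (b * g (X (fst e) \<omega>) (X (snd e) \<omega>))\<^sup>2))"
    unfolding split by (simp add: V_def)
  also have "\<dots> = (\<Sum>i\<in>I. a\<^sup>2 * h_var) + (\<Sum>e\<in>E. b\<^sup>2 * g_var)"
    using E(2) by (intro arg_cong2[where f = "(+)"] sum.cong refl)
      (auto simp: power_mult_distrib h_second_moment g_second_moment)
  finally show ?thesis
    unfolding split by (simp add: V_def sum_distrib_left split_beta mult_ac)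
qed

end

subsection \<open>Central limit theorem for cyclic sums\<close>

lemma norm_iexp_diff_le: "cmod (iexp a - iexp b) \<le> \<bar>a - b\<bar>"
proof -
  have "iexp a - iexp b = iexp b * (iexp (a - b) - 1)"
    by (simp add: right_diff_distrib flip: exp_add)
  then have "cmod (iexp a - iexp b) = cmod (iexp (a - b) - 1)" by (simp add: norm_mult)
  also have "\<dots> \<le> \<bar>a - b\<bar>" using iexp_approx1[of "a - b" 0] by simp
  finally show ?thesis .
qed

lemma exp_minus_approx:
  fixes u :: real assumes "0 \<le> u" shows "\<bar>exp (- u) - (1 - u)\<bar> \<le> u\<^sup>2"
proof -
  have "exp (- u) \<le> 1 / (1 + u)"
    using exp_ge_add_one_self[of u] assms by (simp add: exp_minus inverse_eq_divide frac_le)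
  \<comment> \<open>The product on the right equals 1 + u^3.\<close>
  also have "1 \<le> (1 - u + u\<^sup>2) * (1 + u)"
    using assms by (simp add: algebra_simps power2_eq_square)
  then have "1 / (1 + u) \<le> 1 - u + u\<^sup>2" using assms by (simp add: divide_le_eq)
  finally show ?thesis using exp_ge_add_one_self[of "- u"] by (simp add: abs_le_iff)
qed

lemma (in prob_space) expectation_abs_le_sqrt:
  fixes Z :: "'a \<Rightarrow> real"
  assumes [measurable]: "Z \<in> borel_measurable M" and i: "integrable M Z" "integrable M (\<lambda>\<omega>. (Z \<omega>)\<^sup>2)"
  shows "expectation (\<lambda>\<omega>. \<bar>Z \<omega>\<bar>) \<le> sqrt (expectation (\<lambda>\<omega>. (Z \<omega>)\<^sup>2))"
proof -
  have "0 \<le> variance (\<lambda>\<omega>. \<bar>Z \<omega>\<bar>)" by (rule variance_positive)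
  also have "\<dots> = expectation (\<lambda>\<omega>. \<bar>Z \<omega>\<bar>\<^sup>2) - (expectation (\<lambda>\<omega>. \<bar>Z \<omega>\<bar>))\<^sup>2"
    using i by (intro variance_eq) auto
  finally show ?thesis by (intro real_le_rsqrt) simp
qed

section \<open>Edges of circulant graphs\<close>

lemma add_mod_ne:
  fixes i k n :: nat
  assumes "i < n" "0 < k" "k < n" shows "(i + k) mod n \<noteq> i"
  using assms by (auto simp: mod_if)

text \<open>The set \<open>I\<close> of starting vertices is a parameter because the block argument
  needs partial sums; \<open>{..<n}\<close> gives the whole circulant graph.\<close>

definition cyclic_edges :: "nat \<Rightarrow> nat \<Rightarrow> nat set \<Rightarrow> (nat \<times> nat) set" where
  "cyclic_edges n d I = (\<lambda>(i, k). (i, (i + k) mod n)) ` (I \<times> {1..d})"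

lemma finite_cyclic_edges: "finite I \<Longrightarrow> finite (cyclic_edges n d I)"
  by (simp add: cyclic_edges_def)

lemma inj_on_cyclic_edges:
  fixes n d :: nat
  assumes I: "I \<subseteq> {..<n}" and d: "2 * d + 1 \<le> n"
  shows "inj_on (\<lambda>(i, k). (i, (i + k) mod n)) (I \<times> {1..d})"
proof (rule inj_onI)
  fix p q assume *: "p \<in> I \<times> {1..d}" "q \<in> I \<times> {1..d}"
    "(case p of (i, k) \<Rightarrow> (i, (i + k) mod n)) = (case q of (i, k) \<Rightarrow> (i, (i + k) mod n))"
  then have "fst p = fst q" "(fst p + snd p) mod n = (fst p + snd q) mod n" by (auto simp: split_beta)
  moreover have "fst p < n" "snd p < n" "snd q < n" using * I d by auto
  ultimately show "p = q" by (auto simp: mod_if prod_eq_iff split: if_splits)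
qed

lemma card_cyclic_edges:
  assumes "I \<subseteq> {..<n}" "2 * d + 1 \<le> n" shows "card (cyclic_edges n d I) = card I * d"
  unfolding cyclic_edges_def
  by (subst card_image[OF inj_on_cyclic_edges[OF assms]]) (simp add: card_cartesian_product)

lemma sum_cyclic_edges:
  assumes "I \<subseteq> {..<n}" "2 * d + 1 \<le> n"
  shows "(\<Sum>(i, j)\<in>cyclic_edges n d I. f i j) = (\<Sum>i\<in>I. \<Sum>k\<in>{1..d}. f i ((i + k) mod n))"
  unfolding cyclic_edges_def
  by (subst sum.reindex[OF inj_on_cyclic_edges[OF assms]]) (simp add: split_beta sum.cartesian_product)

text \<open>A reversed edge would make \<open>k + k'\<close> a multiple of \<open>n\<close>, but
  \<open>0 < k + k'\<close> and \<open>k + k' \<le> 2 * d < n\<close>. This is the purpose of the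
  bound d \<le> (n - 1) / 2.\<close>

lemma cyclic_edges_asym:
  assumes I: "I \<subseteq> {..<n}" and d: "2 * d + 1 \<le> n" and ij: "(i, j) \<in> cyclic_edges n d I"
  shows "i \<noteq> j \<and> (j, i) \<notin> cyclic_edges n d I"
proof -
  obtain k where k: "i \<in> I" "k \<in> {1..d}" "j = (i + k) mod n" using ij by (auto simp: cyclic_edges_def)
  have i: "i < n" using k I by auto
  have "(j, i) \<notin> cyclic_edges n d I"
  proof
    assume "(j, i) \<in> cyclic_edges n d I"
    then obtain k' where k': "k' \<in> {1..d}" "i = (j + k') mod n" by (auto simp: cyclic_edges_def)
    have "(i + (k + k')) mod n = ((i + k) mod n + k') mod n" by (simp add: mod_simps add.assoc)
    also have "\<dots> = i" by (simp only: k(3)[symmetric] k'(2)[symmetric])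
    finally have "(i + (k + k')) mod n = i" .
    moreover have "0 < k + k'" "k + k' < n" using k(2) k'(1) d by auto
    ultimately show False using add_mod_ne[OF i, of "k + k'"] by simp
  qed
  moreover have "i \<noteq> j" using add_mod_ne[OF i, of k] k d by auto
  ultimately show ?thesis by simp
qed

section \<open>Cyclic sums and their blocks\<close>

context hoeffding_pair
begin

text \<open>By orthogonality \<open>I\<close> enters only through its cardinality. Hence whatever
  the block construction discards has second moment proportional to the number of discarded
  terms.\<close>

lemma second_moment_cyclic:
  assumes I: "I \<subseteq> {..<n}" and d: "2 * d + 1 \<le> n"
  shows "expectation (\<lambda>\<omega>. (a * (\<Sum>i\<in>I. h (X i \<omega>)) +
            b * (\<Sum>i\<in>I. \<Sum>k\<in>{1..d}. g (X i \<omega>) (X ((i + k) mod n) \<omega>)))\<^sup>2) =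
     real (card I) * (a\<^sup>2 * h_var + b\<^sup>2 * real d * g_var)"
proof -
  have fI: "finite I" using I finite_subset by auto
  have sum_E: "(\<Sum>i\<in>I. \<Sum>k\<in>{1..d}. g (X i \<omega>) (X ((i + k) mod n) \<omega>)) =
      (\<Sum>(i, j)\<in>cyclic_edges n d I. g (X i \<omega>) (X j \<omega>))" for \<omega>
    by (rule sum_cyclic_edges[OF I d, symmetric])
  show ?thesis
    unfolding sum_E
    by (subst second_moment[OF fI finite_cyclic_edges[OF fI] cyclic_edges_asym[OF I d]])
      (simp_all add: card_cyclic_edges[OF I d] algebra_simps)
qed

text \<open>With weight \<open>1 / sqrt (real d)\<close> the \<open>d\<close> orthogonal edge terms
  together have variance \<open>g_var\<close>, so in a cycle with \<open>2 * d + 1 \<le> n\<close>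
  each summand has variance \<open>h_var + g_var\<close> whatever \<open>d\<close>. Only the indices
  \<open>i\<close> to \<open>i + d\<close> modulo \<open>n\<close> are read: dependence is
  local.\<close>

definition xi :: "nat \<Rightarrow> nat \<Rightarrow> nat \<Rightarrow> 'a \<Rightarrow> real" where
  "xi n d i \<omega> = h (X i \<omega>) + (1 / sqrt (real d)) * (\<Sum>k\<in>{1..d}. g (X i \<omega>) (X ((i + k) mod n) \<omega>))"

lemma xi_measurable [measurable]: "xi n d i \<in> borel_measurable M"
  unfolding xi_def [abs_def] by measurable

lemma xi_bound: "1 \<le> d \<Longrightarrow> \<bar>xi n d i \<omega>\<bar> \<le> C + real d * C"
proof -
  assume d: "1 \<le> d"
  have "\<bar>\<Sum>k\<in>{1..d}. g (X i \<omega>) (X ((i + k) mod n) \<omega>)\<bar> \<le> (\<Sum>k\<in>{1..d}. C)"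
    using g_bound by (intro order_trans[OF sum_abs] sum_mono)
  then have "\<bar>(1 / sqrt (real d)) * (\<Sum>k\<in>{1..d}. g (X i \<omega>) (X ((i + k) mod n) \<omega>))\<bar> \<le> 1 * (real d * C)"
    unfolding abs_mult using d by (intro mult_mono) auto
  then show ?thesis
    unfolding xi_def using h_bound[of "X i \<omega>"] by linarith
qed

lemma sum_xi_bound:
  assumes "1 \<le> d" shows "\<bar>\<Sum>i\<in>I. xi n d i \<omega>\<bar> \<le> real (card I) * (C + real d * C)"
proof -
  have "\<bar>\<Sum>i\<in>I. xi n d i \<omega>\<bar> \<le> (\<Sum>i\<in>I. C + real d * C)"
    using xi_bound[OF assms] by (intro order_trans[OF sum_abs] sum_mono)
  then show ?thesis by simp
qed

lemma integrable_sum_xi: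
  assumes "1 \<le> d" shows "integrable M (\<lambda>\<omega>. \<Sum>i\<in>I. xi n d i \<omega>)" "integrable M (\<lambda>\<omega>. (\<Sum>i\<in>I. xi n d i \<omega>)\<^sup>2)"
proof -
  let ?K = "real (card I) * (C + real d * C)"
  show "integrable M (\<lambda>\<omega>. \<Sum>i\<in>I. xi n d i \<omega>)"
    using sum_xi_bound[OF assms] by (intro integrable_const_bound[where B = ?K]) auto
  have "(\<Sum>i\<in>I. xi n d i \<omega>)\<^sup>2 \<le> ?K\<^sup>2" for \<omega>
    using power_mono[OF sum_xi_bound[OF assms, where I = I and n = n and \<omega> = \<omega>], of 2] by simp
  then show "integrable M (\<lambda>\<omega>. (\<Sum>i\<in>I. xi n d i \<omega>)\<^sup>2)"
    by (intro integrable_const_bound[where B = "?K\<^sup>2"]) auto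
qed

lemma sum_xi_second_moment:
  assumes "I \<subseteq> {..<n}" "1 \<le> d" "2 * d + 1 \<le> n"
  shows "expectation (\<lambda>\<omega>. (\<Sum>i\<in>I. xi n d i \<omega>)\<^sup>2) = real (card I) * (h_var + g_var)"
  using second_moment_cyclic[OF assms(1,3), of 1 "1 / sqrt (real d)"] assms(2)
  by (simp add: xi_def sum.distrib sum_distrib_left power_divide)

lemma sum_xi_mean:
  assumes "I \<subseteq> {..<n}" "d < n"
  shows "expectation (\<lambda>\<omega>. \<Sum>i\<in>I. xi n d i \<omega>) = 0"
proof -
  have ih: "integrable M (\<lambda>\<omega>. h (X i \<omega>))" for i
    using h_bound by (intro integrable_const_bound[where B = C]) auto
  have ig: "integrable M (\<lambda>\<omega>. g (X i \<omega>) (X j \<omega>))" for i j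
    using g_bound by (intro integrable_const_bound[where B = C]) auto
  have "expectation (\<lambda>\<omega>. g (X i \<omega>) (X ((i + k) mod n) \<omega>)) = 0" if "i \<in> I" "k \<in> {1..d}" for i k
  proof (rule g_X_centered)
    have "i < n" "0 < k" "k < n" using that assms by auto
    from add_mod_ne[OF this] show "i \<noteq> (i + k) mod n" by simp
  qed
  then show ?thesis
    by (simp add: xi_def ih ig h_X_centered integral_sum)
qed

text \<open>The cycle is cut into windows of length \<open>p + d\<close>; a block is the first
  \<open>p\<close> positions of its window and the other \<open>d\<close> positions are a gap.
  Summands started in a block read no index beyond their own window, which makes different blocks
  independent.\<close>

definition block :: "nat \<Rightarrow> nat \<Rightarrow> nat \<Rightarrow> nat set" where
  "block p d j = {j * (p + d)..<j * (p + d) + p}"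

text \<open>Written on a plain sequence, without reduction modulo \<open>n\<close>, so that it
  depends on the coordinates of one window and not on \<open>n\<close>. It agrees with the sum of
  \<open>xi\<close> when the window ends by \<open>n\<close>, since no index then wraps
  around.\<close>

definition block_sum :: "nat \<Rightarrow> nat \<Rightarrow> nat \<Rightarrow> (nat \<Rightarrow> real^'q) \<Rightarrow> real" where
  "block_sum p d j x = (\<Sum>i\<in>block p d j. h (x i) + (1 / sqrt (real d)) * (\<Sum>k\<in>{1..d}. g (x i) (x (i + k))))"

lemma block_sum_eq:
  assumes "(j + 1) * (p + d) \<le> n"
  shows "block_sum p d j (\<lambda>i. X i \<omega>) = (\<Sum>i\<in>block p d j. xi n d i \<omega>)"
  unfolding block_sum_def xi_def block_def using assms
  by (intro sum.cong arg_cong2[where f = "(+)"] arg_cong2[where f = "(*)"] refl)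
    (auto simp: algebra_simps)

lemma block_subset: "(j + 1) * (p + d) \<le> n \<Longrightarrow> block p d j \<subseteq> {..<n}"
  by (auto simp: block_def algebra_simps)

lemma card_block [simp]: "card (block p d j) = p"
  by (simp add: block_def)

lemma block_disjoint:
  fixes i j p d :: nat
  assumes "i \<noteq> j"
  shows "{i * (p + d)..<i * (p + d) + (p + d)} \<inter> {j * (p + d)..<j * (p + d) + (p + d)} = {}"
proof -
  have *: "i * (p + d) + (p + d) \<le> j * (p + d)" if "i < j" for i j :: nat
    using mult_le_mono1[of "Suc i" j "p + d"] that by (simp add: algebra_simps)
  show ?thesis using *[of i j] *[of j i] assms by (cases i j rule: linorder_cases) auto
qed

text \<open>Second-order Taylor expansion for one block with mean 0, second moment \<open>v\<close>
  and absolute bound \<open>K\<close>. The first error is the cubic remainder; the second compares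
  \<open>1 - v / (2 * real n)\<close> with the exponential. The factors 1/6 and 1/4 are
  dropped.\<close>

lemma block_char_approx:
  assumes p: "1 \<le> p" and d: "1 \<le> d" and n: "1 \<le> n"
  defines "K \<equiv> real p * (C + real d * C)" and "v \<equiv> real p * (h_var + g_var)"
  shows "cmod (expectation (\<lambda>\<omega>. iexp (block_sum p d j (\<lambda>i. X i \<omega>) / sqrt (real n))) - exp (- v / (2 * real n)))
     \<le> K ^ 3 / (real n * sqrt (real n)) + v\<^sup>2 / (real n)\<^sup>2"
proof -
  \<comment> \<open>The block sum is free of any sample size, so its moments are computed in an
    auxiliary cycle of length \<open>n'\<close>, long enough for block \<open>j\<close>; the given
    \<open>n\<close> is only a scale.\<close>
  define n' where "n' = (j + 1) * (p + d) + 2 * d + 1"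
  have n': "(j + 1) * (p + d) \<le> n'" "2 * d + 1 \<le> n'" "d < n'" by (auto simp: n'_def)
  define B where "B \<omega> = block_sum p d j (\<lambda>i. X i \<omega>)" for \<omega>
  have B: "B \<omega> = (\<Sum>i\<in>block p d j. xi n' d i \<omega>)" for \<omega>
    unfolding B_def by (rule block_sum_eq[OF n'(1)])
  note sub = block_subset[OF n'(1)]
  have Bm [measurable]: "B \<in> borel_measurable M" unfolding B by measurable
  have B0: "expectation B = 0" unfolding B by (rule sum_xi_mean[OF sub n'(3)])
  have B2: "expectation (\<lambda>\<omega>. (B \<omega>)\<^sup>2) = v"
    unfolding B using sum_xi_second_moment[OF sub d n'(2)] by (simp add: v_def)
  have Bi: "integrable M B" "integrable M (\<lambda>\<omega>. (B \<omega>)\<^sup>2)"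
    unfolding B using integrable_sum_xi[OF d] by auto
  have Bb: "\<bar>B \<omega>\<bar> \<le> K" for \<omega>
    unfolding B using sum_xi_bound[OF d, where I = "block p d j" and n = n' and \<omega> = \<omega>] by (simp add: K_def)
  define x where "x \<omega> = B \<omega> / sqrt (real n)" for \<omega>
  have xm [measurable]: "x \<in> borel_measurable M" unfolding x_def [abs_def] by measurable
  define r where "r \<omega> = iexp (x \<omega>) - (1 + \<i> * x \<omega> - (x \<omega>)\<^sup>2 / 2)" for \<omega>
  have rm [measurable]: "r \<in> borel_measurable M" unfolding r_def [abs_def] by measurable
  have rb: "cmod (r \<omega>) \<le> K ^ 3 / (real n * sqrt (real n))" for \<omega>
  proof -
    have "r \<omega> = iexp (x \<omega>) - (\<Sum>k\<le>2. (\<i> * x \<omega>) ^ k / fact k)"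
      by (simp add: r_def numeral_2_eq_2 power_mult_distrib)
    then have "cmod (r \<omega>) \<le> \<bar>x \<omega>\<bar> ^ 3 / 6"
      using iexp_approx1[of "x \<omega>" 2] by (simp add: eval_nat_numeral fact_Suc)
    also have "\<dots> \<le> \<bar>x \<omega>\<bar> ^ 3" by simp
    also have "\<dots> \<le> (K / sqrt (real n)) ^ 3"
      using Bb by (intro power_mono) (auto simp: x_def abs_divide divide_right_mono)
    also have "\<dots> = K ^ 3 / (real n * sqrt (real n))"
      by (simp add: power_divide eval_nat_numeral)
    finally show ?thesis .
  qed
  have ri: "integrable M r"
    using rb by (intro integrable_const_bound[where B = "K ^ 3 / (real n * sqrt (real n))"]) auto
  have xi': "integrable M x" "integrable M (\<lambda>\<omega>. (x \<omega>)\<^sup>2)"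
    using Bi by (auto simp: x_def [abs_def] power_divide)
  have x0: "expectation x = 0" using B0 by (simp add: x_def [abs_def])
  have x2: "expectation (\<lambda>\<omega>. (x \<omega>)\<^sup>2) = v / real n" using B2 by (simp add: x_def power_divide)
  have "expectation (\<lambda>\<omega>. iexp (x \<omega>)) = expectation (\<lambda>\<omega>. (1 + \<i> * x \<omega> - (x \<omega>)\<^sup>2 / 2) + r \<omega>)"
    by (simp add: r_def)
  also have "\<dots> = expectation (\<lambda>\<omega>. 1 + \<i> * x \<omega> - (x \<omega>)\<^sup>2 / 2) + expectation r"
  proof (rule Bochner_Integration.integral_add[OF _ ri])
    have "integrable M (\<lambda>\<omega>. complex_of_real (x \<omega>))" "integrable M (\<lambda>\<omega>. complex_of_real ((x \<omega>)\<^sup>2))"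
      using xi' by (auto simp del: of_real_power)
    then show "integrable M (\<lambda>\<omega>. 1 + \<i> * x \<omega> - (x \<omega>)\<^sup>2 / 2)" by simp
  qed
  also have "expectation (\<lambda>\<omega>. 1 + \<i> * x \<omega> - (x \<omega>)\<^sup>2 / 2) = 1 - v / (2 * real n)"
  proof -
    have i: "integrable M (\<lambda>\<omega>. complex_of_real (x \<omega>))" "integrable M (\<lambda>\<omega>. complex_of_real ((x \<omega>)\<^sup>2))"
      using xi' by (auto simp del: of_real_power)
    have e: "expectation (\<lambda>\<omega>. complex_of_real (x \<omega>)) = 0"
      "expectation (\<lambda>\<omega>. complex_of_real ((x \<omega>)\<^sup>2)) = of_real (v / real n)"
      using x0 x2 by (auto simp del: of_real_power simp: integral_complex_of_real)
    show ?thesis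
      using i e by (simp add: prob_space)
  qed
  finally have "expectation (\<lambda>\<omega>. iexp (x \<omega>)) - (1 - v / (2 * real n)) = expectation r" by simp
  moreover have "cmod (expectation r) \<le> K ^ 3 / (real n * sqrt (real n))"
  proof -
    have "cmod (expectation r) \<le> expectation (\<lambda>\<omega>. cmod (r \<omega>))" by simp
    also have "\<dots> \<le> expectation (\<lambda>\<omega>. K ^ 3 / (real n * sqrt (real n)))"
      using ri rb by (intro integral_mono) auto
    finally show ?thesis by (simp add: prob_space)
  qed
  moreover have "cmod (of_real (1 - v / (2 * real n)) - of_real (exp (- v / (2 * real n)))) \<le> v\<^sup>2 / (real n)\<^sup>2"
  proof -
    have v: "0 \<le> v" using h_var_nonneg g_var_nonneg by (simp add: v_def)
    have "\<bar>exp (- (v / (2 * real n))) - (1 - v / (2 * real n))\<bar> \<le> (v / (2 * real n))\<^sup>2"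
      using v by (intro exp_minus_approx) auto
    also have "\<dots> \<le> (v / real n)\<^sup>2"
      using v n by (intro power_mono divide_left_mono) auto
    finally show ?thesis
      unfolding of_real_diff[symmetric] norm_of_real by (simp add: abs_minus_commute power_divide)
  qed
  ultimately have "cmod (expectation (\<lambda>\<omega>. iexp (x \<omega>)) - (1 - v / (2 * real n))) +
      cmod (of_real (1 - v / (2 * real n)) - of_real (exp (- v / (2 * real n)))) \<le>
      K ^ 3 / (real n * sqrt (real n)) + v\<^sup>2 / (real n)\<^sup>2"
    by simp
  moreover have "cmod (expectation (\<lambda>\<omega>. iexp (x \<omega>)) - of_real (exp (- v / (2 * real n)))) \<le>
      cmod (expectation (\<lambda>\<omega>. iexp (x \<omega>)) - (1 - v / (2 * real n))) +
      cmod (of_real (1 - v / (2 * real n)) - of_real (exp (- v / (2 * real n))))"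
    by (rule order_trans[OF _ norm_triangle_ineq]) simp
  ultimately show ?thesis
    unfolding x_def B_def by linarith
qed

end

lemma tendsto_div_over_n:
  fixes l :: nat assumes "1 \<le> l"
  shows "(\<lambda>n. real (n div l) / real n) \<longlonglongrightarrow> 1 / real l"
proof (rule tendsto_sandwich)
  show "\<forall>\<^sub>F n in sequentially. 1 / real l - 1 / real n \<le> real (n div l) / real n"
    using eventually_gt_at_top[of 0]
  proof eventually_elim
    case (elim n)
    have "real n = real l * real (n div l) + real (n mod l)"
      by (metis mult_div_mod_eq of_nat_add of_nat_mult)
    moreover have "real (n mod l) \<le> real l" using assms by (simp add: less_imp_le)
    ultimately have "real n \<le> real l * (real (n div l) + 1)" by (simp add: algebra_simps)
    then have "real n / real l \<le> real (n div l) + 1" using assms by (simp add: divide_le_eq mult.commute)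
    from divide_right_mono[OF this, of "real n"] show ?case using elim by (simp add: add_divide_distrib)
  qed
  show "\<forall>\<^sub>F n in sequentially. real (n div l) / real n \<le> 1 / real l"
    using eventually_gt_at_top[of 0]
  proof eventually_elim
    case (elim n)
    have "real (n div l) * real l \<le> real n" by (metis div_times_less_eq_dividend of_nat_le_iff of_nat_mult)
    then show ?case using elim assms by (simp add: field_simps)
  qed
  have "(\<lambda>n. 1 / real l - 1 / real n) \<longlonglongrightarrow> 1 / real l - 0"
    by (intro tendsto_intros lim_1_over_n)
  then show "(\<lambda>n. 1 / real l - 1 / real n) \<longlonglongrightarrow> 1 / real l" by simp
qed simp

context hoeffding_pair
begin

lemma block_sum_measurable:
  "block_sum p d j \<in> borel_measurable (PiM {j * (p + d)..<j * (p + d) + (p + d)} (\<lambda>_. borel))"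
  unfolding block_sum_def [abs_def]
proof (intro borel_measurable_sum borel_measurable_add borel_measurable_times borel_measurable_const)
  let ?K = "{j * (p + d)..<j * (p + d) + (p + d)}"
  have c: "(\<lambda>x. x i) \<in> borel_measurable (PiM ?K (\<lambda>_. borel :: (real^'q) measure))" if "i \<in> ?K" for i
    using that by (rule measurable_component_singleton)
  fix i assume i: "i \<in> block p d j"
  then have iK: "i \<in> ?K" by (auto simp: block_def)
  show "(\<lambda>x. h (x i)) \<in> borel_measurable (PiM ?K (\<lambda>_. borel))"
    by (rule measurable_compose[OF c[OF iK] h_measurable])
  fix k assume "k \<in> {1..d}"
  then have "i + k \<in> ?K" using i by (auto simp: block_def)
  then have "(\<lambda>x. (x i, x (i + k))) \<in> PiM ?K (\<lambda>_. borel :: (real^'q) measure) \<rightarrow>\<^sub>M borel \<Otimes>\<^sub>M borel"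
    by (intro measurable_Pair c iK)
  from measurable_compose[OF this g_measurable]
  show "(\<lambda>x. g (x i) (x (i + k))) \<in> borel_measurable (PiM ?K (\<lambda>_. borel))" by simp
qed

text \<open>Windows are disjoint, gaps included, so the block sums are functions of disjoint groups
  of sample points.\<close>

lemma char_block_sums:
  "expectation (\<lambda>\<omega>. iexp (t * (\<Sum>j<m. block_sum p d j (\<lambda>i. X i \<omega>)))) =
     (\<Prod>j<m. expectation (\<lambda>\<omega>. iexp (t * block_sum p d j (\<lambda>i. X i \<omega>))))"
proof -
  define K where "K j = {j * (p + d)..<j * (p + d) + (p + d)}" for j
  have bs: "block_sum p d j (restrict (\<lambda>i. X i \<omega>) (K j)) = block_sum p d j (\<lambda>i. X i \<omega>)" for j \<omega>
    unfolding block_sum_def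
    by (intro sum.cong arg_cong2[where f = "(+)"] arg_cong2[where f = "(*)"] refl)
      (auto simp: block_def K_def)
  have "indep_vars (\<lambda>j. PiM (K j) (\<lambda>_. borel)) (\<lambda>j \<omega>. restrict (\<lambda>i. X i \<omega>) (K j)) {..<m}"
    by (intro indep_vars_restrict[OF indep]) (auto simp: disjoint_family_on_def K_def dest: block_disjoint)
  then have "indep_vars (\<lambda>_. borel) (\<lambda>j \<omega>. iexp (t * block_sum p d j (restrict (\<lambda>i. X i \<omega>) (K j)))) {..<m}"
  proof (rule indep_vars_compose2)
    fix j
    note [measurable] = block_sum_measurable[of p d j, folded K_def]
    show "(\<lambda>x. iexp (t * block_sum p d j x)) \<in> borel_measurable (PiM (K j) (\<lambda>_. borel))" by measurable
  qed
  then have ind: "indep_vars (\<lambda>_. borel) (\<lambda>j \<omega>. iexp (t * block_sum p d j (\<lambda>i. X i \<omega>))) {..<m}"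
    by (simp add: bs)
  have "expectation (\<lambda>\<omega>. \<Prod>j<m. iexp (t * block_sum p d j (\<lambda>i. X i \<omega>))) =
     (\<Prod>j<m. expectation (\<lambda>\<omega>. iexp (t * block_sum p d j (\<lambda>i. X i \<omega>))))"
  proof (rule indep_vars_lebesgue_integral[OF _ ind])
    fix j assume "j \<in> {..<m}"
    then have "(\<lambda>\<omega>. iexp (t * block_sum p d j (\<lambda>i. X i \<omega>))) \<in> borel_measurable M"
      using ind by (auto simp: indep_vars_def)
    then show "integrable M (\<lambda>\<omega>. iexp (t * block_sum p d j (\<lambda>i. X i \<omega>)))"
      by (intro integrable_const_bound[where B = 1]) auto
  qed simp
  then show ?thesis by (simp add: exp_sum sum_distrib_left)
qed

text \<open>Three errors in this order: dropping the terms outside the blocks, estimated in L2;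
  replacing each of the \<open>m\<close> block characteristic functions by a Gaussian one; and the
  variance lost because the blocks hold only \<open>m * p\<close> of the \<open>n\<close>
  terms.\<close>

lemma char_approx_blocks:
  assumes p: "1 \<le> p" and d: "1 \<le> d" and n: "2 * d + 1 \<le> n"
  defines "K \<equiv> real p * (C + real d * C)" and "v \<equiv> real p * (h_var + g_var)"
    and "m \<equiv> n div (p + d)" and "s \<equiv> h_var + g_var"
  shows "cmod (expectation (\<lambda>\<omega>. iexp ((\<Sum>i<n. xi n d i \<omega>) / sqrt (real n))) - exp (- s / 2)) \<le>
     sqrt ((1 - real m / real n * real p) * s) + (K ^ 3 / sqrt (real n) + v\<^sup>2 / real n) +
     \<bar>exp (- (real m / real n * v) / 2) - exp (- s / 2)\<bar>"
proof -
  have n0: "0 < n" using n by simp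
  define U where "U = (\<Union>j<m. block p d j)"
  have le: "(j + 1) * (p + d) \<le> n" if "j < m" for j
  proof -
    have "(j + 1) * (p + d) \<le> m * (p + d)" using that by (intro mult_le_mono1) simp
    also have "\<dots> \<le> n" by (simp add: m_def)
    finally show ?thesis .
  qed
  have disj: "block p d i \<inter> block p d j = {}" if "i \<noteq> j" for i j
    using block_disjoint[OF that, of p d] unfolding block_def by fastforce
  have U: "U \<subseteq> {..<n}" using block_subset[OF le] by (auto simp: U_def)
  have fin: "finite (block p d j)" for j by (simp add: block_def)
  have cU: "card U = m * p"
    unfolding U_def by (subst card_UN_disjoint) (auto simp: fin disj)
  have sumU: "(\<Sum>i\<in>U. xi n d i \<omega>) = (\<Sum>j<m. block_sum p d j (\<lambda>i. X i \<omega>))" for \<omega>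
  proof -
    have "(\<Sum>i\<in>U. xi n d i \<omega>) = (\<Sum>j<m. \<Sum>i\<in>block p d j. xi n d i \<omega>)"
      unfolding U_def by (subst sum.UNION_disjoint) (auto simp: fin disj)
    also have "\<dots> = (\<Sum>j<m. block_sum p d j (\<lambda>i. X i \<omega>))"
      by (intro sum.cong refl block_sum_eq[symmetric] le) auto
    finally show ?thesis .
  qed
  \<comment> \<open>The gaps and the incomplete window at the end; every summand whose indices wrap
    around is among these.\<close>
  define V where "V = {..<n} - U"
  have cV: "real (card V) = real n - real m * real p"
  proof -
    have "card V = n - m * p" unfolding V_def by (subst card_Diff_subset) (use U cU finite_subset in auto)
    moreover have "m * p \<le> n" using card_mono[OF _ U] cU by simp
    ultimately show ?thesis by (simp add: of_nat_diff)
  qed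
  define W where "W \<omega> = (\<Sum>i<n. xi n d i \<omega>) / sqrt (real n)" for \<omega>
  define W' where "W' \<omega> = (\<Sum>i\<in>U. xi n d i \<omega>) / sqrt (real n)" for \<omega>
  define Z where "Z \<omega> = (\<Sum>i\<in>V. xi n d i \<omega>) / sqrt (real n)" for \<omega>
  have WZ: "W \<omega> - W' \<omega> = Z \<omega>" for \<omega>
    unfolding W_def W'_def Z_def V_def using U
    by (subst sum_diff) (auto simp: diff_divide_distrib)
  have [measurable]: "W \<in> borel_measurable M" "W' \<in> borel_measurable M" "Z \<in> borel_measurable M"
    unfolding W_def [abs_def] W'_def [abs_def] Z_def [abs_def] by measurable
  have int: "integrable M (\<lambda>\<omega>. iexp (W \<omega>))" "integrable M (\<lambda>\<omega>. iexp (W' \<omega>))"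
    by (auto intro!: integrable_const_bound[where B = 1])
  have Zi: "integrable M Z" "integrable M (\<lambda>\<omega>. (Z \<omega>)\<^sup>2)"
    using integrable_sum_xi[OF d] by (auto simp: Z_def [abs_def] power_divide)
  have "expectation (\<lambda>\<omega>. (Z \<omega>)\<^sup>2) = (1 - real m / real n * real p) * s"
    using sum_xi_second_moment[of V n d] d n n0
    by (simp add: Z_def power_divide V_def cV[unfolded V_def] s_def field_simps)
  then have EZ: "expectation (\<lambda>\<omega>. \<bar>Z \<omega>\<bar>) \<le> sqrt ((1 - real m / real n * real p) * s)"
    using expectation_abs_le_sqrt[OF _ Zi] by simp
  have "cmod (expectation (\<lambda>\<omega>. iexp (W \<omega>)) - expectation (\<lambda>\<omega>. iexp (W' \<omega>))) =
      cmod (expectation (\<lambda>\<omega>. iexp (W \<omega>) - iexp (W' \<omega>)))"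
    using int by simp
  also have "\<dots> \<le> expectation (\<lambda>\<omega>. cmod (iexp (W \<omega>) - iexp (W' \<omega>)))" by (rule integral_norm_bound)
  also have "\<dots> \<le> expectation (\<lambda>\<omega>. \<bar>Z \<omega>\<bar>)"
  proof (rule integral_mono)
    show "integrable M (\<lambda>\<omega>. \<bar>Z \<omega>\<bar>)" using Zi(1) by simp
    show "integrable M (\<lambda>\<omega>. cmod (iexp (W \<omega>) - iexp (W' \<omega>)))" using int by simp
    show "cmod (iexp (W \<omega>) - iexp (W' \<omega>)) \<le> \<bar>Z \<omega>\<bar>" for \<omega>
      using norm_iexp_diff_le[of "W \<omega>" "W' \<omega>"] by (simp only: WZ)
  qed
  finally have 1: "cmod (expectation (\<lambda>\<omega>. iexp (W \<omega>)) - expectation (\<lambda>\<omega>. iexp (W' \<omega>)))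
     \<le> sqrt ((1 - real m / real n * real p) * s)"
    using EZ by simp
  define \<phi> where "\<phi> j = expectation (\<lambda>\<omega>. iexp (block_sum p d j (\<lambda>i. X i \<omega>) / sqrt (real n)))" for j
  have W'\<phi>: "expectation (\<lambda>\<omega>. iexp (W' \<omega>)) = (\<Prod>j<m. \<phi> j)"
    unfolding W'_def sumU \<phi>_def using char_block_sums[of "1 / sqrt (real n)" p d m] by simp
  have v0: "0 \<le> v" using h_var_nonneg g_var_nonneg by (simp add: v_def)
  have K0: "0 \<le> K" using C_nonneg by (simp add: K_def)
  \<comment> \<open>All factors have modulus at most 1, so by telescoping the products differ by at
    most the sum of the differences of the factors.\<close>
  have "cmod ((\<Prod>j<m. \<phi> j) - (\<Prod>j<m. of_real (exp (- v / (2 * real n))))) \<le>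
      (\<Sum>j<m. cmod (\<phi> j - of_real (exp (- v / (2 * real n)))))"
  proof (rule norm_prod_diff)
    fix j assume j: "j \<in> {..<m}"
    have [measurable]: "(\<lambda>\<omega>. block_sum p d j (\<lambda>i. X i \<omega>)) \<in> borel_measurable M"
      using block_sum_eq[OF le, of j] j by simp
    have "cmod (\<phi> j) \<le> expectation (\<lambda>\<omega>. cmod (iexp (block_sum p d j (\<lambda>i. X i \<omega>) / sqrt (real n))))"
      unfolding \<phi>_def by (rule integral_norm_bound)
    then show "cmod (\<phi> j) \<le> 1" by (simp add: prob_space)
    show "cmod (of_real (exp (- v / (2 * real n)))) \<le> 1" using v0 by simp
  qed
  also have "\<dots> \<le> (\<Sum>j<m. K ^ 3 / (real n * sqrt (real n)) + v\<^sup>2 / (real n)\<^sup>2)"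
    unfolding \<phi>_def K_def v_def using n by (intro sum_mono block_char_approx p d) simp
  also have "\<dots> = real m * (K ^ 3 / (real n * sqrt (real n)) + v\<^sup>2 / (real n)\<^sup>2)" by simp
  also have "\<dots> \<le> real n * (K ^ 3 / (real n * sqrt (real n)) + v\<^sup>2 / (real n)\<^sup>2)"
    using K0 by (intro mult_right_mono) (auto simp: m_def)
  also have "\<dots> = K ^ 3 / sqrt (real n) + v\<^sup>2 / real n"
    using n0 by (simp add: field_simps power2_eq_square)
  finally have 2: "cmod (expectation (\<lambda>\<omega>. iexp (W' \<omega>)) - of_real (exp (- (real m / real n * v) / 2))) \<le>
      K ^ 3 / sqrt (real n) + v\<^sup>2 / real n"
  proof -
    have "(\<Prod>j<m. complex_of_real (exp (- v / (2 * real n)))) = of_real (exp (- v / (2 * real n)) ^ m)"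
      by simp
    also have "exp (- v / (2 * real n)) ^ m = exp (- (real m / real n * v) / 2)"
      by (simp add: mult_ac flip: exp_of_nat_mult)
    finally show "cmod ((\<Prod>j<m. \<phi> j) - (\<Prod>j<m. of_real (exp (- v / (2 * real n))))) \<le>
      K ^ 3 / sqrt (real n) + v\<^sup>2 / real n \<Longrightarrow> ?thesis" by (simp add: W'\<phi>)
  qed
  have 3: "cmod (of_real (exp (- (real m / real n * v) / 2)) - of_real (exp (- s / 2))) =
      \<bar>exp (- (real m / real n * v) / 2) - exp (- s / 2)\<bar>"
    unfolding of_real_diff[symmetric] norm_of_real ..
  let ?a = "expectation (\<lambda>\<omega>. iexp (W \<omega>))" and ?b = "expectation (\<lambda>\<omega>. iexp (W' \<omega>))"
    and ?c = "complex_of_real (exp (- (real m / real n * v) / 2))" and ?e = "complex_of_real (exp (- s / 2))"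
  have "cmod (?a - ?e) \<le> cmod (?a - ?b) + cmod (?b - ?c) + cmod (?c - ?e)"
    using norm_triangle_ineq[of "?a - ?b" "?b - ?c"] norm_triangle_ineq[of "?a - ?c" "?c - ?e"] by simp
  then show ?thesis
    using 1 2 3 unfolding W_def by linarith
qed

text \<open>An iterated limit. For fixed \<open>p\<close> the bound of
  \<open>char_approx_blocks\<close> tends to \<open>R p\<close> as \<open>n\<close> grows, and
  \<open>R p\<close> tends to 0 because the blocks fill the fraction \<open>p / (p + d)\<close> of
  the cycle. So \<open>p\<close> is chosen first, depending on \<open>e\<close>.\<close>

theorem char_cyclic_sum_tendsto:
  assumes d: "1 \<le> d"
  shows "(\<lambda>n. expectation (\<lambda>\<omega>. iexp ((\<Sum>i<n. xi n d i \<omega>) / sqrt (real n)))) \<longlonglongrightarrow>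
     of_real (exp (- (h_var + g_var) / 2))"
proof (rule LIMSEQ_I)
  fix e :: real assume e: "0 < e"
  define s where "s = h_var + g_var"
  define R where "R p = sqrt ((1 - real p / real (p + d)) * s) + \<bar>exp (- (real p / real (p + d) * s) / 2) - exp (- s / 2)\<bar>" for p
  have pd: "(\<lambda>p. real p / real (p + d)) \<longlonglongrightarrow> 1"
  proof -
    have "(\<lambda>p. 1 - real d * (1 / real (p + d))) \<longlonglongrightarrow> 1 - real d * 0"
      by (intro tendsto_intros LIMSEQ_ignore_initial_segment[OF lim_1_over_n])
    moreover have "1 - real d * (1 / real (p + d)) = real p / real (p + d)" for p
      using d by (simp add: field_simps)
    ultimately show ?thesis by simp
  qed
  have "(\<lambda>p. sqrt ((1 - real p / real (p + d)) * s) + \<bar>exp (- (real p / real (p + d) * s) / 2) - exp (- s / 2)\<bar>)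
      \<longlonglongrightarrow> sqrt ((1 - 1) * s) + \<bar>exp (- (1 * s) / 2) - exp (- s / 2)\<bar>"
    by (intro tendsto_intros pd) auto
  then have "R \<longlonglongrightarrow> 0" by (simp add: R_def [abs_def])
  then have "\<forall>\<^sub>F p in sequentially. R p < e" using e by (simp add: order_tendstoD)
  then have "\<forall>\<^sub>F p in sequentially. R p < e \<and> 1 \<le> p"
    using eventually_ge_at_top[of 1] by eventually_elim simp
  then obtain p where p: "R p < e" "1 \<le> p" by (auto simp: eventually_sequentially)
  define K where "K = real p * (C + real d * C)"
  define r where "r n = real (n div (p + d)) / real n" for n
  have r: "r \<longlonglongrightarrow> 1 / real (p + d)"
    unfolding r_def [abs_def] using p by (intro tendsto_div_over_n) simp
  define b where "b n = sqrt ((1 - r n * real p) * s) +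
      (K ^ 3 / sqrt (real n) + (real p * s)\<^sup>2 / real n) +
      \<bar>exp (- (r n * (real p * s)) / 2) - exp (- s / 2)\<bar>" for n
  have "b \<longlonglongrightarrow> sqrt ((1 - 1 / real (p + d) * real p) * s) + (0 + 0) +
      \<bar>exp (- (1 / real (p + d) * (real p * s)) / 2) - exp (- s / 2)\<bar>"
    unfolding b_def [abs_def]
  proof (intro tendsto_intros r)
    show "(\<lambda>n. K ^ 3 / sqrt (real n)) \<longlonglongrightarrow> 0"
      by (intro real_tendsto_divide_at_top[OF tendsto_const] filterlim_compose[OF sqrt_at_top filterlim_real_sequentially])
  qed auto
  then have "b \<longlonglongrightarrow> R p" by (simp add: R_def)
  then have "\<forall>\<^sub>F n in sequentially. b n < e" using p by (simp add: order_tendstoD)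
  then have "\<forall>\<^sub>F n in sequentially. norm (expectation (\<lambda>\<omega>. iexp ((\<Sum>i<n. xi n d i \<omega>) / sqrt (real n))) -
      of_real (exp (- (h_var + g_var) / 2))) < e"
    using eventually_ge_at_top[of "2 * d + 1"]
  proof eventually_elim
    case (elim n)
    then show ?case
      using char_approx_blocks[OF p(2) d elim(2)] unfolding b_def r_def K_def s_def by (simp add: mult_ac)
  qed
  then show "\<exists>no. \<forall>n\<ge>no. norm (expectation (\<lambda>\<omega>. iexp ((\<Sum>i<n. xi n d i \<omega>) / sqrt (real n))) -
      of_real (exp (- (h_var + g_var) / 2))) < e"
    by (simp add: eventually_sequentially)
qed

end

subsection \<open>Characteristic functions and weak convergence\<close>

inductive trig_poly :: "('a::euclidean_space \<Rightarrow> complex) \<Rightarrow> bool" where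
  monomial: "trig_poly (\<lambda>y. c * iexp (t \<bullet> y))"
| add: "trig_poly f \<Longrightarrow> trig_poly g \<Longrightarrow> trig_poly (\<lambda>y. f y + g y)"

lemma trig_poly_const: "trig_poly (\<lambda>y. c)"
  using trig_poly.monomial[of c 0] by simp

lemma trig_poly_mult:
  assumes "trig_poly f" "trig_poly g" shows "trig_poly (\<lambda>y. f y * g y)"
  using assms
proof (induction rule: trig_poly.induct)
  case (monomial c t)
  then show ?case
  proof (induction rule: trig_poly.induct)
    case (monomial c' t')
    have "(\<lambda>y. (c * c') * iexp ((t + t') \<bullet> y)) = (\<lambda>y. (c * iexp (t \<bullet> y)) * (c' * iexp (t' \<bullet> y)))"
      by (simp add: inner_add_left distrib_left exp_add mult_ac)
    then show ?case using trig_poly.monomial[of "c * c'" "t + t'"] by (simp only:)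
  next
    case (add f g)
    then show ?case using trig_poly.add by (simp add: distrib_left)
  qed
next
  case (add f g)
  then show ?case using trig_poly.add by (simp add: distrib_right)
qed

lemma trig_poly_sum: "(\<And>i. i \<in> I \<Longrightarrow> trig_poly (f i)) \<Longrightarrow> trig_poly (\<lambda>y. \<Sum>i\<in>I. f i y)"
  by (induction I rule: infinite_finite_induct) (auto intro: trig_poly_const trig_poly.add)

lemma trig_poly_sin: "trig_poly (\<lambda>y. of_real (sin (t \<bullet> y)))"
proof -
  have "of_real (sin (t \<bullet> y)) = (- \<i> / 2) * iexp (t \<bullet> y) + (\<i> / 2) * iexp ((- t) \<bullet> y)" for y
    by (simp add: complex_eq_iff Re_exp Im_exp)
  then show ?thesis
    using trig_poly.add[OF trig_poly.monomial[of "- \<i> / 2" t] trig_poly.monomial[of "\<i> / 2" "- t"]] by simp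
qed

definition sin_clip :: "real \<Rightarrow> 'a::euclidean_space \<Rightarrow> 'a" where
  "sin_clip L y = (\<Sum>b\<in>Basis. (L * sin ((y \<bullet> b) / L)) *\<^sub>R b)"

text \<open>Each coordinate of \<open>sin_clip\<close> is a sine, a combination of two exponentials,
  and trigonometric polynomials are closed under sums and products because frequencies add.\<close>

lemma trig_poly_polynomial_sin_clip:
  assumes "real_polynomial_function p" shows "trig_poly (\<lambda>y. of_real (p (sin_clip L y)))"
  using assms
proof (induction rule: real_polynomial_function.induct)
  case (linear f)
  interpret bounded_linear f by fact
  have *: "complex_of_real (f (sin_clip L y)) = (\<Sum>b\<in>Basis. of_real (L * f b) * of_real (sin ((b /\<^sub>R L) \<bullet> y)))" for y
    by (simp add: sin_clip_def sum scale inner_commute divide_inverse mult_ac)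
  show ?case
    unfolding * by (intro trig_poly_sum trig_poly_mult trig_poly_const trig_poly_sin)
next
  case (add f g)
  then show ?case using trig_poly.add by simp
next
  case (mult f g)
  then show ?case using trig_poly_mult by simp
qed (simp add: trig_poly_const)

lemma trig_poly_continuous: "trig_poly f \<Longrightarrow> continuous_on UNIV f"
  by (induction rule: trig_poly.induct) (auto intro!: continuous_intros)

lemma trig_poly_bounded: "trig_poly f \<Longrightarrow> \<exists>B. \<forall>y. cmod (f y) \<le> B"
proof (induction rule: trig_poly.induct)
  case (monomial c t)
  show ?case by (intro exI[of _ "cmod c"]) (simp add: norm_mult)
next
  case (add f g)
  then show ?case by (meson norm_triangle_le add_mono)
qed

lemma (in prob_space) integrable_trig_poly:
  assumes "trig_poly f" and [measurable]: "V \<in> borel_measurable M"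
  shows "integrable M (\<lambda>\<omega>. f (V \<omega>))"
proof -
  have [measurable]: "f \<in> borel_measurable borel"
    by (intro borel_measurable_continuous_onI trig_poly_continuous assms(1))
  show ?thesis
    using trig_poly_bounded[OF assms(1)] by (auto intro!: integrable_const_bound)
qed

lemma trig_poly_integral_tendsto:
  fixes Y :: "nat \<Rightarrow> 'm \<Rightarrow> 'a::euclidean_space" and Z :: "'n \<Rightarrow> 'a"
  assumes M: "prob_space M" and N: "prob_space N"
    and Y: "\<And>n. Y n \<in> borel_measurable M" and Z: "Z \<in> borel_measurable N"
    and char: "\<And>t. (\<lambda>n. \<integral>\<omega>. iexp (t \<bullet> Y n \<omega>) \<partial>M) \<longlonglongrightarrow> (\<integral>\<omega>. iexp (t \<bullet> Z \<omega>) \<partial>N)"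
    and f: "trig_poly f"
  shows "(\<lambda>n. \<integral>\<omega>. f (Y n \<omega>) \<partial>M) \<longlonglongrightarrow> (\<integral>\<omega>. f (Z \<omega>) \<partial>N)"
  using f
proof (induction rule: trig_poly.induct)
  case (monomial c t)
  show ?case using char by (simp add: tendsto_mult_left)
next
  case (add f g)
  then show ?case
    by (simp add: prob_space.integrable_trig_poly[OF M _ Y] prob_space.integrable_trig_poly[OF N _ Z] tendsto_add)
qed

lemma abs_sin_minus_le: "\<bar>sin x - x\<bar> \<le> x\<^sup>2" for x :: real
proof -
  have "\<bar>Im (iexp x - (1 + \<i> * x))\<bar> \<le> cmod (iexp x - (1 + \<i> * x))" by (rule abs_Im_le_cmod)
  also have "\<dots> \<le> x\<^sup>2 / 2" using iexp_approx1[of x 1] by (simp add: numeral_2_eq_2)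
  finally have "\<bar>sin x - x\<bar> \<le> x\<^sup>2 / 2" by (simp add: Im_exp)
  then show ?thesis using zero_le_power2[of x] by linarith
qed

text \<open>From \<open>\<bar>sin x - x\<bar> \<le> x\<^sup>2\<close> in each coordinate. The factor
  \<open>1 / L\<close> makes the clipping error uniformly small on any fixed ball once
  \<open>L\<close> is large.\<close>

lemma norm_sin_clip_diff:
  fixes y :: "'a::euclidean_space"
  assumes "0 < L" shows "norm (sin_clip L y - y) \<le> real DIM('a) * (norm y)\<^sup>2 / L"
proof -
  have "norm (sin_clip L y - y) \<le> (\<Sum>b\<in>Basis. \<bar>(sin_clip L y - y) \<bullet> b\<bar>)" by (rule norm_le_l1)
  also have "\<dots> \<le> (\<Sum>b\<in>(Basis :: 'a set). (norm y)\<^sup>2 / L)"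
  proof (rule sum_mono)
    fix b :: 'a assume b: "b \<in> Basis"
    have "\<bar>(sin_clip L y - y) \<bullet> b\<bar> = L * \<bar>sin ((y \<bullet> b) / L) - (y \<bullet> b) / L\<bar>"
    proof -
      have "(sin_clip L y - y) \<bullet> b = L * (sin ((y \<bullet> b) / L) - (y \<bullet> b) / L)"
        using b assms by (simp add: sin_clip_def inner_diff_left right_diff_distrib)
      then show ?thesis using assms by (simp only: abs_mult abs_of_pos)
    qed
    also have "\<dots> \<le> L * ((y \<bullet> b) / L)\<^sup>2" using assms by (intro mult_left_mono abs_sin_minus_le) auto
    also have "\<dots> = (y \<bullet> b)\<^sup>2 / L" using assms by (simp add: power2_eq_square)
    also have "\<dots> \<le> (norm y)\<^sup>2 / L"
      using Basis_le_norm[OF b, of y] assms by (intro divide_right_mono) (auto simp: abs_le_square_iff[symmetric])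
    finally show "\<bar>(sin_clip L y - y) \<bullet> b\<bar> \<le> (norm y)\<^sup>2 / L" .
  qed
  finally show ?thesis by simp
qed

lemma sin_clip_in_cbox: "0 < L \<Longrightarrow> sin_clip L y \<in> cbox (- L *\<^sub>R One) (L *\<^sub>R One)"
proof -
  assume L: "0 < L"
  have "\<bar>sin_clip L y \<bullet> b\<bar> \<le> L" if "b \<in> Basis" for b
    using that L by (simp add: sin_clip_def abs_mult mult_left_le)
  then have "- L \<le> sin_clip L y \<bullet> b \<and> sin_clip L y \<bullet> b \<le> L" if "b \<in> Basis" for b
    using that by (simp add: abs_le_iff) fastforce
  then show ?thesis
    by (simp add: mem_box inner_sum_left_Basis)
qed

text \<open>Instead of truncating, \<open>f\<close> is composed with \<open>y \<mapsto> L sin (y / L)\<close>: this stays bounded by \<open>sup |f|\<close>, takes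
  values in a compact cube, and turns polynomials into trigonometric polynomials.\<close>

lemma trig_poly_approximation:
  fixes f :: "'a::euclidean_space \<Rightarrow> real"
  assumes cont: "continuous_on UNIV f" and B: "\<And>y. \<bar>f y\<bar> \<le> B" and e: "0 < e"
  obtains p where "trig_poly (\<lambda>y. of_real (p y))" "\<And>y. \<bar>f y - p y\<bar> \<le> e * (1 + (norm y)\<^sup>2)"
proof -
  have B0: "0 \<le> B" using B[of 0] by linarith
  obtain R where R: "1 \<le> R" "2 * B / R\<^sup>2 \<le> e / 2"
  proof
    \<comment> \<open>With this radius the trivial bound \<open>2 * B\<close> is at most
      \<open>e / 2 * (norm y)\<^sup>2\<close> as soon as \<open>norm y\<close> exceeds
      \<open>R\<close>.\<close>
    define R where "R = 1 + 4 * B / e"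
    show R1: "1 \<le> R" using B0 e by (simp add: R_def)
    have "2 * B / R\<^sup>2 \<le> 2 * B / R"
      using R1 B0 by (intro divide_left_mono) (auto simp: power2_eq_square)
    also have "\<dots> \<le> e / 2" using R1 B0 e by (simp add: R_def divide_le_eq field_simps)
    finally show "2 * B / R\<^sup>2 \<le> e / 2" .
  qed
  have "uniformly_continuous_on (cball 0 (R + 1)) f"
    by (intro compact_uniformly_continuous continuous_on_subset[OF cont]) auto
  then obtain \<delta> where \<delta>: "0 < \<delta>" "\<And>x y. x \<in> cball 0 (R + 1) \<Longrightarrow> y \<in> cball 0 (R + 1) \<Longrightarrow> dist y x < \<delta> \<Longrightarrow> \<bar>f y - f x\<bar> < e / 4"
    using e unfolding uniformly_continuous_on_def dist_real_def by (metis divide_pos_pos zero_less_numeral)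
  define \<eta> where "\<eta> = min 1 \<delta> / 2"
  have \<eta>: "0 < \<eta>" "\<eta> < \<delta>" "\<eta> < 1" using \<delta> by (auto simp: \<eta>_def)
  \<comment> \<open>Makes the bound of \<open>norm_sin_clip_diff\<close> at most
    \<open>\<eta>\<close> on the ball of radius \<open>R\<close>. As \<open>\<eta>\<close> is below
    1 and \<open>\<delta>\<close>, the clipped point stays in the ball of radius
    \<open>R + 1\<close> and uniform continuity applies.\<close>
  define L where "L = real DIM('a) * R\<^sup>2 / \<eta>"
  have L: "0 < L" using R \<eta> by (simp add: L_def)
  obtain q where q: "real_polynomial_function q" "\<And>x. x \<in> cbox (- L *\<^sub>R One) (L *\<^sub>R One) \<Longrightarrow> \<bar>f x - q x\<bar> < e / 4"
    using Stone_Weierstrass_real_polynomial_function[of "cbox (- L *\<^sub>R One) (L *\<^sub>R One)" f "e / 4"]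
      continuous_on_subset[OF cont] e by (metis compact_cbox subset_UNIV divide_pos_pos zero_less_numeral)
  show thesis
  proof (rule that[of "\<lambda>y. q (sin_clip L y)"])
    show "trig_poly (\<lambda>y. complex_of_real (q (sin_clip L y)))"
      by (rule trig_poly_polynomial_sin_clip[OF q(1)])
    fix y
    have 1: "\<bar>f (sin_clip L y) - q (sin_clip L y)\<bar> < e / 4"
      using q(2) sin_clip_in_cbox[OF L] by blast
    have 2: "\<bar>f y - f (sin_clip L y)\<bar> \<le> e / 4 + e / 2 * (norm y)\<^sup>2"
    proof (cases "norm y \<le> R")
      case True
      have "norm (sin_clip L y - y) \<le> real DIM('a) * (norm y)\<^sup>2 / L" by (rule norm_sin_clip_diff[OF L])
      also have "\<dots> \<le> real DIM('a) * R\<^sup>2 / L"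
        using True L by (intro divide_right_mono mult_left_mono power_mono) auto
      also have "\<dots> = \<eta>" using R \<eta> by (simp add: L_def)
      finally have d: "norm (sin_clip L y - y) \<le> \<eta>" .
      then have "norm (sin_clip L y) \<le> R + 1"
        using True \<eta> norm_triangle_ineq[of y "sin_clip L y - y"] by simp
      then have "\<bar>f y - f (sin_clip L y)\<bar> < e / 4"
        using True \<eta> d by (intro \<delta>) (auto simp: dist_norm norm_minus_commute)
      then show ?thesis using e by (smt (verit) mult_nonneg_nonneg zero_le_power2 divide_nonneg_pos)
    next
      case False
      have "\<bar>f y - f (sin_clip L y)\<bar> \<le> 2 * B" using B[of y] B[of "sin_clip L y"] by linarith
      also have "\<dots> = (2 * B / R\<^sup>2) * R\<^sup>2" using R by simp
      also have "\<dots> \<le> e / 2 * (norm y)\<^sup>2"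
        using R False e B0 by (intro mult_mono power_mono) auto
      finally show ?thesis using e by simp
    qed
    have "\<bar>f y - q (sin_clip L y)\<bar> \<le> e / 2 + e / 2 * (norm y)\<^sup>2" using 1 2 by linarith
    also have "\<dots> \<le> e * (1 + (norm y)\<^sup>2)"
    proof -
      have "0 \<le> e * (norm y)\<^sup>2" using e by simp
      then have "e / 2 + e / 2 * (norm y)\<^sup>2 \<le> e + e * (norm y)\<^sup>2" using e by linarith
      then show ?thesis by (simp only: distrib_left mult_1_right)
    qed
    finally show "\<bar>f y - q (sin_clip L y)\<bar> \<le> e * (1 + (norm y)\<^sup>2)" .
  qed
qed

text \<open>Levy's continuity theorem under bounded second moments, which take the place of a
  tightness argument: the quadratically growing error of \<open>trig_poly_approximation\<close> is
  integrated against them, while integrals of trigonometric polynomials converge by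
  assumption.\<close>

lemma integral_tendsto_of_char:
  fixes Y :: "nat \<Rightarrow> 'm \<Rightarrow> 'a::euclidean_space" and Z :: "'n \<Rightarrow> 'a" and f :: "'a \<Rightarrow> real"
  assumes M: "prob_space M" and N: "prob_space N"
    and Y: "\<And>n. Y n \<in> borel_measurable M" and Z: "Z \<in> borel_measurable N"
    and Y2: "\<And>n. integrable M (\<lambda>\<omega>. (norm (Y n \<omega>))\<^sup>2)"
      "\<forall>\<^sub>F n in sequentially. (\<integral>\<omega>. (norm (Y n \<omega>))\<^sup>2 \<partial>M) \<le> K"
    and Z2: "integrable N (\<lambda>\<omega>. (norm (Z \<omega>))\<^sup>2)"
    and char: "\<And>t. (\<lambda>n. \<integral>\<omega>. iexp (t \<bullet> Y n \<omega>) \<partial>M) \<longlonglongrightarrow> (\<integral>\<omega>. iexp (t \<bullet> Z \<omega>) \<partial>N)"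
    and f: "continuous_on UNIV f" "bounded (range f)"
  shows "(\<lambda>n. \<integral>\<omega>. f (Y n \<omega>) \<partial>M) \<longlonglongrightarrow> (\<integral>\<omega>. f (Z \<omega>) \<partial>N)"
proof (rule LIMSEQ_I)
  fix r :: real assume r: "0 < r"
  obtain B where B: "\<And>y. \<bar>f y\<bar> \<le> B" using f(2) by (auto simp: bounded_iff)
  define K' where "K' = max K (\<integral>\<omega>. (norm (Z \<omega>))\<^sup>2 \<partial>N)"
  have K'0: "0 \<le> K'" by (simp add: K'_def le_max_iff_disj)
  \<comment> \<open>Replacing \<open>f\<close> by \<open>p\<close> costs at most
    \<open>e * (1 + K') = r / 3\<close>, once under \<open>Y n\<close> and once under
    \<open>Z\<close>; the last third is for the convergence of the integrals of
    \<open>p\<close>.\<close>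
  define e where "e = r / 3 / (1 + K')"
  have e: "0 < e" "e * (1 + K') = r / 3" 
  proof -
    have "1 + K' \<noteq> 0" using K'0 by linarith
    then show "e * (1 + K') = r / 3" unfolding e_def by (metis nonzero_divide_eq_eq)
  qed (use r K'0 in \<open>simp add: e_def\<close>)
  obtain p where p: "trig_poly (\<lambda>y. of_real (p y))" "\<And>y. \<bar>f y - p y\<bar> \<le> e * (1 + (norm y)\<^sup>2)"
    using trig_poly_approximation[OF f(1) B e(1)] by metis
  have approx: "\<bar>(\<integral>\<omega>. f (V \<omega>) \<partial>L) - (\<integral>\<omega>. p (V \<omega>) \<partial>L)\<bar> \<le> r / 3"
    if L: "prob_space L" and V [measurable]: "V \<in> borel_measurable L"
      and V2: "integrable L (\<lambda>\<omega>. (norm (V \<omega>))\<^sup>2)" "(\<integral>\<omega>. (norm (V \<omega>))\<^sup>2 \<partial>L) \<le> K'" for L and V :: "'l \<Rightarrow> 'a"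
  proof -
    interpret L: prob_space L by fact
    have [measurable]: "f \<in> borel_measurable borel" by (intro borel_measurable_continuous_onI f)
    have fi: "integrable L (\<lambda>\<omega>. f (V \<omega>))"
      using B by (intro L.integrable_const_bound[where B = B]) auto
    have pi: "integrable L (\<lambda>\<omega>. p (V \<omega>))"
      using L.integrable_trig_poly[OF p(1) V] by (simp add: complex_of_real_integrable_eq)
    have "\<bar>(\<integral>\<omega>. f (V \<omega>) \<partial>L) - (\<integral>\<omega>. p (V \<omega>) \<partial>L)\<bar> = \<bar>\<integral>\<omega>. f (V \<omega>) - p (V \<omega>) \<partial>L\<bar>"
      using fi pi by simp
    also have "\<dots> \<le> (\<integral>\<omega>. \<bar>f (V \<omega>) - p (V \<omega>)\<bar> \<partial>L)" by (rule integral_abs_bound)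
    also have "\<dots> \<le> (\<integral>\<omega>. e * (1 + (norm (V \<omega>))\<^sup>2) \<partial>L)"
      using fi pi V2 p(2) by (intro integral_mono) auto
    also have "\<dots> = e * (1 + (\<integral>\<omega>. (norm (V \<omega>))\<^sup>2 \<partial>L))" using V2 by (simp add: L.prob_space)
    also have "\<dots> \<le> e * (1 + K')" using V2 e by (intro mult_left_mono) auto
    finally show ?thesis using e by simp
  qed
  have "(\<lambda>n. \<integral>\<omega>. complex_of_real (p (Y n \<omega>)) \<partial>M) \<longlonglongrightarrow> (\<integral>\<omega>. complex_of_real (p (Z \<omega>)) \<partial>N)"
    by (rule trig_poly_integral_tendsto[OF M N Y Z char p(1)])
  then have "(\<lambda>n. \<integral>\<omega>. p (Y n \<omega>) \<partial>M) \<longlonglongrightarrow> (\<integral>\<omega>. p (Z \<omega>) \<partial>N)"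
    by (simp add: tendsto_of_real_iff)
  then have "\<forall>\<^sub>F n in sequentially. \<bar>(\<integral>\<omega>. p (Y n \<omega>) \<partial>M) - (\<integral>\<omega>. p (Z \<omega>) \<partial>N)\<bar> < r / 3"
    using r unfolding tendsto_iff dist_real_def by (metis divide_pos_pos zero_less_numeral)
  with Y2(2) have "\<forall>\<^sub>F n in sequentially. norm ((\<integral>\<omega>. f (Y n \<omega>) \<partial>M) - (\<integral>\<omega>. f (Z \<omega>) \<partial>N)) < r"
  proof eventually_elim
    case (elim n)
    then have "(\<integral>\<omega>. (norm (Y n \<omega>))\<^sup>2 \<partial>M) \<le> K'" by (simp add: K'_def)
    from approx[OF M Y Y2(1) this] approx[OF N Z Z2] elim(2)
    show ?case by (simp add: K'_def abs_if split: if_splits)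
  qed
  then show "\<exists>no. \<forall>n\<ge>no. norm ((\<integral>\<omega>. f (Y n \<omega>) \<partial>M) - (\<integral>\<omega>. f (Z \<omega>) \<partial>N)) < r"
    by (simp add: eventually_sequentially)
qed

subsection \<open>Outer probability calculus\<close>

context prob_space
begin

text \<open>The definition asks for one sequence of covering events per \<open>e\<close>; in
  applications the cover also depends on the target level \<open>\<tau>\<close>. A diagonal choice
  of covers closes the gap, and covers are needed because the bad sets may be nonmeasurable.\<close>

lemma o_p_iff:
  fixes R :: "nat \<Rightarrow> 'a \<Rightarrow> 'b::real_normed_vector"
  shows "o_p M R a \<longleftrightarrow> (\<forall>e>0. \<forall>\<tau>>0. \<forall>\<^sub>F n in sequentially.
     \<exists>A\<in>events. {\<omega> \<in> space M. e * \<bar>a n\<bar> < norm (R n \<omega>)} \<subseteq> A \<and> prob A \<le> \<tau>)" (is "_ \<longleftrightarrow> ?r")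
proof
  assume *: "o_p M R a"
  show ?r
  proof (intro allI impI)
    fix e \<tau> :: real assume e: "0 < e" and \<tau>: "0 < \<tau>"
    obtain A where A: "\<forall>n. A n \<in> events \<and> {\<omega> \<in> space M. e * \<bar>a n\<bar> < norm (R n \<omega>)} \<subseteq> A n"
        "(\<lambda>n. prob (A n)) \<longlonglongrightarrow> 0"
      using *[unfolded o_p_def, rule_format, OF e] by (elim exE conjE)
    have "\<forall>\<^sub>F n in sequentially. prob (A n) < \<tau>" using A(2) \<tau> by (rule order_tendstoD)
    then show "\<forall>\<^sub>F n in sequentially.
        \<exists>A\<in>events. {\<omega> \<in> space M. e * \<bar>a n\<bar> < norm (R n \<omega>)} \<subseteq> A \<and> prob A \<le> \<tau>"
    proof eventually_elim
      case (elim n)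
      then show ?case using A(1) by (intro bexI[of _ "A n"]) auto
    qed
  qed
next
  assume *: ?r
  show "o_p M R a"
    unfolding o_p_def
  proof (intro allI impI)
    fix e :: real assume e: "0 < e"
    define bad where "bad n = {\<omega> \<in> space M. e * \<bar>a n\<bar> < norm (R n \<omega>)}" for n
    have "\<exists>B. \<forall>n. B n \<in> events \<and> bad n \<subseteq> B n \<and>
        ((\<exists>A\<in>events. bad n \<subseteq> A \<and> prob A \<le> 1 / real (Suc j)) \<longrightarrow> prob (B n) \<le> 1 / real (Suc j))" for j
    proof (rule choice, rule allI)
      fix n
      show "\<exists>B. B \<in> events \<and> bad n \<subseteq> B \<and>
        ((\<exists>A\<in>events. bad n \<subseteq> A \<and> prob A \<le> 1 / real (Suc j)) \<longrightarrow> prob B \<le> 1 / real (Suc j))"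
      proof (cases "\<exists>A\<in>events. bad n \<subseteq> A \<and> prob A \<le> 1 / real (Suc j)")
        case True
        then show ?thesis by blast
      next
        case False
        \<comment> \<open>Default cover when no small one exists; no bound is claimed then.\<close>
        then show ?thesis by (intro exI[of _ "space M"]) (auto simp: bad_def)
      qed
    qed
    then obtain B where B: "\<And>j n. B j n \<in> events" "\<And>j n. bad n \<subseteq> B j n"
        "\<And>j n. \<exists>A\<in>events. bad n \<subseteq> A \<and> prob A \<le> 1 / real (Suc j) \<Longrightarrow> prob (B j n) \<le> 1 / real (Suc j)"
      by metis
    \<comment> \<open>For every \<open>j\<close>, \<open>A n\<close> is contained in
      \<open>B j n\<close> once \<open>n \<ge> j\<close>, so its probability is eventually at most
      \<open>1 / real (Suc j)\<close>.\<close>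
    define A where "A n = (\<Inter>j\<le>n. B j n)" for n
    have Ae: "A n \<in> events" for n unfolding A_def using B(1) by (intro sets.finite_INT) auto
    have "(\<lambda>n. prob (A n)) \<longlonglongrightarrow> 0"
    proof (rule order_tendstoI)
      fix \<tau> :: real assume "0 < \<tau>"
      then obtain j where j: "1 / real (Suc j) < \<tau>" using nat_approx_posE by blast
      have "\<forall>\<^sub>F n in sequentially. \<exists>A\<in>events. bad n \<subseteq> A \<and> prob A \<le> 1 / real (Suc j)"
        unfolding bad_def using *[rule_format, OF e, of "1 / real (Suc j)"] by simp
      then show "\<forall>\<^sub>F n in sequentially. prob (A n) < \<tau>"
        using eventually_ge_at_top[of j]
      proof eventually_elim
        case (elim n)
        have "prob (A n) \<le> prob (B j n)"
          using elim(2) B(1) by (intro finite_measure_mono) (auto simp: A_def)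
        also have "\<dots> \<le> 1 / real (Suc j)" by (rule B(3)[OF elim(1)])
        finally show ?case using j by simp
      qed
    qed (auto intro!: always_eventually less_le_trans[OF _ measure_nonneg])
    moreover have "bad n \<subseteq> A n" for n using B(2) by (auto simp: A_def)
    ultimately show "\<exists>A. (\<forall>n. A n \<in> events \<and> {\<omega> \<in> space M. e * \<bar>a n\<bar> < norm (R n \<omega>)} \<subseteq> A n) \<and>
        (\<lambda>n. prob (A n)) \<longlonglongrightarrow> 0"
      using Ae unfolding bad_def by blast
  qed
qed

lemma o_p_cong:
  fixes R S :: "nat \<Rightarrow> 'a \<Rightarrow> 'b::real_normed_vector"
  assumes "o_p M R a" and eq: "\<forall>\<^sub>F n in sequentially. \<forall>\<omega>\<in>space M. S n \<omega> = R n \<omega>"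
  shows "o_p M S a"
  unfolding o_p_iff
proof (intro allI impI)
  fix e \<tau> :: real assume "0 < e" "0 < \<tau>"
  with assms(1) have "\<forall>\<^sub>F n in sequentially.
     \<exists>A\<in>events. {\<omega> \<in> space M. e * \<bar>a n\<bar> < norm (R n \<omega>)} \<subseteq> A \<and> prob A \<le> \<tau>"
    unfolding o_p_iff by blast
  with eq show "\<forall>\<^sub>F n in sequentially.
     \<exists>A\<in>events. {\<omega> \<in> space M. e * \<bar>a n\<bar> < norm (S n \<omega>)} \<subseteq> A \<and> prob A \<le> \<tau>"
  proof eventually_elim
    case (elim n)
    then have "{\<omega> \<in> space M. e * \<bar>a n\<bar> < norm (S n \<omega>)} = {\<omega> \<in> space M. e * \<bar>a n\<bar> < norm (R n \<omega>)}" by auto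
    then show ?case using elim(2) by simp
  qed
qed

lemma o_p_add:
  fixes R S :: "nat \<Rightarrow> 'a \<Rightarrow> 'b::real_normed_vector"
  assumes "o_p M R a" "o_p M S a"
  shows "o_p M (\<lambda>n \<omega>. R n \<omega> + S n \<omega>) a"
  unfolding o_p_iff
proof (intro allI impI)
  fix e \<tau> :: real assume "0 < e" "0 < \<tau>"
  then have "0 < e / 2" "0 < \<tau> / 2" by auto
  with assms have "\<forall>\<^sub>F n in sequentially.
     \<exists>A\<in>events. {\<omega> \<in> space M. e / 2 * \<bar>a n\<bar> < norm (R n \<omega>)} \<subseteq> A \<and> prob A \<le> \<tau> / 2"
    "\<forall>\<^sub>F n in sequentially.
     \<exists>A\<in>events. {\<omega> \<in> space M. e / 2 * \<bar>a n\<bar> < norm (S n \<omega>)} \<subseteq> A \<and> prob A \<le> \<tau> / 2"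
    unfolding o_p_iff by blast+
  then show "\<forall>\<^sub>F n in sequentially.
     \<exists>A\<in>events. {\<omega> \<in> space M. e * \<bar>a n\<bar> < norm (R n \<omega> + S n \<omega>)} \<subseteq> A \<and> prob A \<le> \<tau>"
  proof eventually_elim
    case (elim n)
    then obtain A B where A: "A \<in> events" "{\<omega> \<in> space M. e / 2 * \<bar>a n\<bar> < norm (R n \<omega>)} \<subseteq> A" "prob A \<le> \<tau> / 2"
      and B: "B \<in> events" "{\<omega> \<in> space M. e / 2 * \<bar>a n\<bar> < norm (S n \<omega>)} \<subseteq> B" "prob B \<le> \<tau> / 2"
      by blast
    have "prob (A \<union> B) \<le> \<tau>" using measure_Un_le[OF A(1) B(1)] A(3) B(3) by linarith
    moreover have "\<omega> \<in> A \<union> B" if \<omega>: "\<omega> \<in> space M" "e * \<bar>a n\<bar> < norm (R n \<omega> + S n \<omega>)" for \<omega>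
    proof -
      have "e / 2 * \<bar>a n\<bar> < norm (R n \<omega>) \<or> e / 2 * \<bar>a n\<bar> < norm (S n \<omega>)"
        using \<omega>(2) norm_triangle_ineq[of "R n \<omega>" "S n \<omega>"] by linarith
      then show ?thesis using A(2) B(2) \<omega>(1) by blast
    qed
    ultimately show ?case using A(1) B(1) by (intro bexI[of _ "A \<union> B"]) auto
  qed
qed

lemma o_p_uminus: "o_p M R a \<Longrightarrow> o_p M (\<lambda>n \<omega>. - R n \<omega>) a"
  by (simp add: o_p_def)

lemma o_p_scale_sqrt:
  assumes "o_p M R (\<lambda>n. 1 / sqrt (real n))"
  shows "o_p M (\<lambda>n \<omega>. sqrt (real n) *\<^sub>R R n \<omega>) (\<lambda>_. 1)"
  unfolding o_p_iff
proof (intro allI impI)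
  fix e \<tau> :: real assume "0 < e" "0 < \<tau>"
  with assms have "\<forall>\<^sub>F n in sequentially.
     \<exists>A\<in>events. {\<omega> \<in> space M. e * \<bar>1 / sqrt (real n)\<bar> < norm (R n \<omega>)} \<subseteq> A \<and> prob A \<le> \<tau>"
    unfolding o_p_iff by blast
  then show "\<forall>\<^sub>F n in sequentially.
     \<exists>A\<in>events. {\<omega> \<in> space M. e * \<bar>1\<bar> < norm (sqrt (real n) *\<^sub>R R n \<omega>)} \<subseteq> A \<and> prob A \<le> \<tau>"
    using eventually_gt_at_top[of 0]
  proof eventually_elim
    case (elim n)
    then have "{\<omega> \<in> space M. e * \<bar>1\<bar> < norm (sqrt (real n) *\<^sub>R R n \<omega>)} =
        {\<omega> \<in> space M. e * \<bar>1 / sqrt (real n)\<bar> < norm (R n \<omega>)}"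
      by (simp add: divide_less_eq mult.commute)
    then show ?case using elim by simp
  qed
qed

lemma prob_norm_gt_le:
  fixes V :: "'a \<Rightarrow> 'b::{real_normed_vector, second_countable_topology}"
  assumes [measurable]: "V \<in> borel_measurable M" and i: "integrable M (\<lambda>\<omega>. (norm (V \<omega>))\<^sup>2)" and c: "0 < c"
  shows "prob {\<omega> \<in> space M. c \<le> norm (V \<omega>)} \<le> expectation (\<lambda>\<omega>. (norm (V \<omega>))\<^sup>2) / c\<^sup>2"
proof -
  have "{\<omega> \<in> space M. c \<le> norm (V \<omega>)} = {\<omega> \<in> space M. c\<^sup>2 \<le> (norm (V \<omega>))\<^sup>2}"
    using c by (auto simp: power_mono_iff)
  moreover have "prob {\<omega> \<in> space M. c\<^sup>2 \<le> (norm (V \<omega>))\<^sup>2} \<le> expectation (\<lambda>\<omega>. (norm (V \<omega>))\<^sup>2) / c\<^sup>2"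
    by (rule integral_Markov_inequality_measure[where A = "{}"]) (use i c in auto)
  ultimately show ?thesis by simp
qed

lemma bounded_square_integrable:
  fixes V :: "'a \<Rightarrow> 'c::{real_normed_vector, second_countable_topology}"
  assumes [measurable]: "V \<in> borel_measurable M" and "\<And>\<omega>. norm (V \<omega>) \<le> K"
  shows "integrable M (\<lambda>\<omega>. (norm (V \<omega>))\<^sup>2)"
proof (rule integrable_const_bound)
  show "AE \<omega> in M. norm ((norm (V \<omega>))\<^sup>2) \<le> K\<^sup>2"
    using power_mono[OF assms(2) norm_ge_zero, where n = 2] by (intro AE_I2) simp
qed measurable

lemma o_p_of_second_moment:
  fixes R :: "nat \<Rightarrow> 'a \<Rightarrow> 'b::{real_normed_vector, second_countable_topology}"
  assumes [measurable]: "\<And>n. R n \<in> borel_measurable M" and i: "\<And>n. integrable M (\<lambda>\<omega>. (norm (R n \<omega>))\<^sup>2)"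
    and lim: "(\<lambda>n. real n * expectation (\<lambda>\<omega>. (norm (R n \<omega>))\<^sup>2)) \<longlonglongrightarrow> 0"
  shows "o_p M R (\<lambda>n. 1 / sqrt (real n))"
  unfolding o_p_iff
proof (intro allI impI)
  fix e \<tau> :: real assume e: "0 < e" and \<tau>: "0 < \<tau>"
  have "\<forall>\<^sub>F n in sequentially. real n * expectation (\<lambda>\<omega>. (norm (R n \<omega>))\<^sup>2) < \<tau> * e\<^sup>2"
    using lim e \<tau> by (intro order_tendstoD) auto
  then show "\<forall>\<^sub>F n in sequentially. \<exists>A\<in>events.
      {\<omega> \<in> space M. e * \<bar>1 / sqrt (real n)\<bar> < norm (R n \<omega>)} \<subseteq> A \<and> prob A \<le> \<tau>"
    using eventually_gt_at_top[of 0]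
  proof eventually_elim
    case (elim n)
    let ?c = "e / sqrt (real n)"
    have "prob {\<omega> \<in> space M. ?c \<le> norm (R n \<omega>)} \<le> expectation (\<lambda>\<omega>. (norm (R n \<omega>))\<^sup>2) / ?c\<^sup>2"
      using e elim by (intro prob_norm_gt_le i) auto
    also have "\<dots> = real n * expectation (\<lambda>\<omega>. (norm (R n \<omega>))\<^sup>2) / e\<^sup>2"
      by (simp add: power_divide)
    also have "\<dots> \<le> \<tau>" using elim e by (simp add: divide_le_eq)
    finally show ?case
      by (intro bexI[of _ "{\<omega> \<in> space M. ?c \<le> norm (R n \<omega>)}"]) auto
  qed
qed

text \<open>\<open>u + w\<close> is an admissible majorant of \<open>h\<close>, and every admissible
  majorant dominates \<open>u - w\<close>. A possibly nonmeasurable \<open>h\<close> is thereby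
  compared with a measurable \<open>u\<close> through ordinary integrals.\<close>

lemma outer_exp_approx:
  assumes u: "integrable M u" and w: "integrable M w"
    and h: "\<And>\<omega>. \<omega> \<in> space M \<Longrightarrow> \<bar>h \<omega> - u \<omega>\<bar> \<le> w \<omega>"
  shows "\<bar>outer_exp M h - expectation u\<bar> \<le> expectation w"
proof -
  define S where "S = {integral\<^sup>L M g | g. g \<in> borel_measurable M \<and> integrable M g \<and> (\<forall>\<omega>\<in>space M. h \<omega> \<le> g \<omega>)}"
  have lower: "expectation u - expectation w \<le> s" if s: "s \<in> S" for s
  proof -
    obtain g where g: "s = integral\<^sup>L M g" "integrable M g" "\<forall>\<omega>\<in>space M. h \<omega> \<le> g \<omega>"
      using s by (auto simp: S_def)
    have "expectation (\<lambda>\<omega>. u \<omega> - w \<omega>) \<le> expectation g"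
    proof (rule integral_mono)
      fix \<omega> assume "\<omega> \<in> space M"
      then show "u \<omega> - w \<omega> \<le> g \<omega>" using h[of \<omega>] g(3) by fastforce
    qed (use u w g in auto)
    then show ?thesis using u w g by simp
  qed
  have "h \<omega> \<le> u \<omega> + w \<omega>" if "\<omega> \<in> space M" for \<omega> using h[OF that] by linarith
  then have in_S: "expectation (\<lambda>\<omega>. u \<omega> + w \<omega>) \<in> S"
    unfolding S_def using u w by (intro CollectI exI[of _ "\<lambda>\<omega>. u \<omega> + w \<omega>"]) auto
  have "Inf S \<le> expectation (\<lambda>\<omega>. u \<omega> + w \<omega>)"
    using lower by (intro cInf_lower in_S) (auto simp: bdd_below_def)
  moreover have "expectation u - expectation w \<le> Inf S"
    using lower in_S by (intro cInf_greatest) auto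
  ultimately show ?thesis using u w unfolding outer_exp_def S_def by simp
qed

text \<open>A Slutsky lemma with measurable main term \<open>Y\<close> and a possibly nonmeasurable
  \<open>Y'\<close>. Uniform continuity of \<open>f\<close> is available on balls only; the second
  moments of \<open>Y\<close> control the complement.\<close>

lemma conv_dist_perturb:
  fixes Y Y' :: "nat \<Rightarrow> 'a \<Rightarrow> 'b::euclidean_space"
  assumes Y [measurable]: "\<And>n. Y n \<in> borel_measurable M"
    and Y2: "\<And>n. integrable M (\<lambda>\<omega>. (norm (Y n \<omega>))\<^sup>2)"
      "\<forall>\<^sub>F n in sequentially. (\<integral>\<omega>. (norm (Y n \<omega>))\<^sup>2 \<partial>M) \<le> K"
    and lim: "\<And>f :: 'b \<Rightarrow> real. continuous_on UNIV f \<Longrightarrow> bounded (range f) \<Longrightarrow>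
       (\<lambda>n. \<integral>\<omega>. f (Y n \<omega>) \<partial>M) \<longlonglongrightarrow> (\<integral>\<omega>. f (Z \<omega>) \<partial>N)"
    and pert: "o_p M (\<lambda>n \<omega>. Y' n \<omega> - Y n \<omega>) (\<lambda>_. 1)"
  shows "conv_dist M Y' N Z"
  unfolding conv_dist_def
proof safe
  fix f :: "'b \<Rightarrow> real" assume f: "continuous_on UNIV f" "bounded (range f)"
  have fm [measurable]: "f \<in> borel_measurable borel" by (intro borel_measurable_continuous_onI f)
  obtain B where B: "\<And>y. \<bar>f y\<bar> \<le> B" using f(2) by (auto simp: bounded_iff)
  have B0: "0 \<le> B" using B[of 0] by linarith
  have "(\<lambda>n. outer_exp M (\<lambda>\<omega>. f (Y' n \<omega>)) - (\<integral>\<omega>. f (Y n \<omega>) \<partial>M)) \<longlonglongrightarrow> 0"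
  proof (rule LIMSEQ_I)
    fix e :: real assume e: "0 < e"
    \<comment> \<open>Chosen so that \<open>2 * B / R\<^sup>2\<close> times the second moment is at
      most \<open>e / 4\<close>; \<open>max K 0\<close> keeps \<open>R\<close> at least 1 whatever
      the sign of \<open>K\<close>.\<close>
    define R where "R = 1 + 8 * B * max K 0 / e"
    have R: "1 \<le> R" using B0 e by (simp add: R_def)
    have RK: "2 * B / R\<^sup>2 * k \<le> e / 4" if "k \<le> K" "0 \<le> k" for k
    proof -
      have "2 * B * k \<le> 2 * B * max K 0" using that B0 by (intro mult_left_mono) auto
      also have "\<dots> \<le> e / 4 * R" using e by (simp add: R_def field_simps)
      also have "\<dots> \<le> e / 4 * R\<^sup>2" using R e by (intro mult_left_mono) (auto simp: power2_eq_square)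
      finally show ?thesis using R by (simp add: divide_le_eq)
    qed
    have "uniformly_continuous_on (cball 0 (R + 1)) f"
      by (intro compact_uniformly_continuous continuous_on_subset[OF f(1)]) auto
    then obtain \<delta> where \<delta>: "0 < \<delta>" "\<And>x y. x \<in> cball 0 (R + 1) \<Longrightarrow> y \<in> cball 0 (R + 1) \<Longrightarrow> dist y x < \<delta> \<Longrightarrow> \<bar>f y - f x\<bar> < e / 4"
      using e unfolding uniformly_continuous_on_def dist_real_def by (metis divide_pos_pos zero_less_numeral)
    define \<eta> where "\<eta> = min 1 \<delta> / 2"
    have \<eta>: "0 < \<eta>" "\<eta> < \<delta>" "\<eta> < 1" using \<delta> by (auto simp: \<eta>_def)
    define \<tau> where "\<tau> = e / (8 * (B + 1))"
    have \<tau>: "0 < \<tau>" using B0 e by (simp add: \<tau>_def)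
    have \<tau>B: "2 * B * \<tau> \<le> e / 4" using B0 e by (simp add: \<tau>_def field_simps)
    have "\<forall>\<^sub>F n in sequentially. \<exists>A\<in>events. {\<omega> \<in> space M. \<eta> * \<bar>1\<bar> < norm (Y' n \<omega> - Y n \<omega>)} \<subseteq> A \<and> prob A \<le> \<tau>"
      using pert \<eta>(1) \<tau> unfolding o_p_iff by blast
    with Y2(2) have "\<forall>\<^sub>F n in sequentially. \<bar>outer_exp M (\<lambda>\<omega>. f (Y' n \<omega>)) - (\<integral>\<omega>. f (Y n \<omega>) \<partial>M)\<bar> < e"
    proof eventually_elim
      case (elim n)
      then obtain A where A: "A \<in> events" "{\<omega> \<in> space M. \<eta> * \<bar>1\<bar> < norm (Y' n \<omega> - Y n \<omega>)} \<subseteq> A" "prob A \<le> \<tau>"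
        by blast
      \<comment> \<open>Majorant of the change of \<open>f\<close>: the constant
        \<open>e / 4\<close> where both points lie in the ball and are close, \<open>2 * B\<close>
        on the exceptional event \<open>A\<close>, and a quadratic term that is at least
        \<open>2 * B\<close> once \<open>norm (Y n \<omega>)\<close> exceeds
        \<open>R\<close>.\<close>
      define w where "w \<omega> = e / 4 + 2 * B * indicator A \<omega> + 2 * B / R\<^sup>2 * (norm (Y n \<omega>))\<^sup>2" for \<omega>
      have wi: "integrable M w" unfolding w_def [abs_def] using A(1) Y2(1)[of n] by (simp add: emeasure_eq_measure)
      have "\<bar>outer_exp M (\<lambda>\<omega>. f (Y' n \<omega>)) - (\<integral>\<omega>. f (Y n \<omega>) \<partial>M)\<bar> \<le> expectation w"
      proof (rule outer_exp_approx[OF _ wi])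
        show "integrable M (\<lambda>\<omega>. f (Y n \<omega>))"
          using B by (intro integrable_const_bound[where B = B]) auto
        fix \<omega> assume \<omega>: "\<omega> \<in> space M"
        have le2B: "\<bar>f (Y' n \<omega>) - f (Y n \<omega>)\<bar> \<le> 2 * B" using B[of "Y' n \<omega>"] B[of "Y n \<omega>"] by linarith
        have nn: "0 \<le> 2 * B * indicator A \<omega>" "0 \<le> 2 * B / R\<^sup>2 * (norm (Y n \<omega>))\<^sup>2" using B0 by auto
        show "\<bar>f (Y' n \<omega>) - f (Y n \<omega>)\<bar> \<le> w \<omega>"
        proof (cases "\<omega> \<in> A \<or> R < norm (Y n \<omega>)")
          case True
          then show ?thesis
          proof
            assume "\<omega> \<in> A"
            then have "w \<omega> = e / 4 + 2 * B + 2 * B / R\<^sup>2 * (norm (Y n \<omega>))\<^sup>2" by (simp add: w_def)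
            then show ?thesis using le2B nn(2) e by linarith
          next
            assume "R < norm (Y n \<omega>)"
            then have "R\<^sup>2 \<le> (norm (Y n \<omega>))\<^sup>2" using R by (intro power_mono) auto
            then have "2 * B / R\<^sup>2 * R\<^sup>2 \<le> 2 * B / R\<^sup>2 * (norm (Y n \<omega>))\<^sup>2" using B0 by (intro mult_left_mono) auto
            then have "2 * B \<le> 2 * B / R\<^sup>2 * (norm (Y n \<omega>))\<^sup>2" using R by simp
            then show ?thesis unfolding w_def using le2B nn(1) e by linarith
          qed
        next
          case False
          then have d: "norm (Y' n \<omega> - Y n \<omega>) \<le> \<eta>" using A(2) \<omega> by (fastforce simp: not_less)
          then have "norm (Y' n \<omega>) \<le> R + 1"
            using False \<eta> norm_triangle_ineq[of "Y n \<omega>" "Y' n \<omega> - Y n \<omega>"] by simp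
          then have "\<bar>f (Y' n \<omega>) - f (Y n \<omega>)\<bar> < e / 4"
            using False \<eta> d by (intro \<delta>) (auto simp: dist_norm)
          then show ?thesis unfolding w_def using nn by linarith
        qed
      qed
      also have "expectation w = e / 4 + 2 * B * prob A + 2 * B / R\<^sup>2 * expectation (\<lambda>\<omega>. (norm (Y n \<omega>))\<^sup>2)"
        unfolding w_def using A(1) Y2(1)[of n] by (simp add: emeasure_eq_measure prob_space)
      also have "\<dots> \<le> e / 4 + 2 * B * \<tau> + e / 4"
        using A(3) B0 RK[OF elim(1)] by (intro add_mono mult_left_mono order_refl) auto
      finally show ?case using \<tau>B e by linarith
    qed
    then show "\<exists>no. \<forall>n\<ge>no. norm (outer_exp M (\<lambda>\<omega>. f (Y' n \<omega>)) - (\<integral>\<omega>. f (Y n \<omega>) \<partial>M) - 0) < e"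
      by (simp add: eventually_sequentially)
  qed
  from tendsto_add[OF this lim[OF f]]
  show "(\<lambda>n. outer_exp M (\<lambda>\<omega>. f (Y' n \<omega>))) \<longlonglongrightarrow> (\<integral>\<omega>. f (Z \<omega>) \<partial>N)" by simp
qed

lemma o_p_zero: "o_p M (\<lambda>n \<omega>. 0 :: 'b::real_normed_vector) a"
  unfolding o_p_def by (intro allI impI exI[of _ "\<lambda>_. {}"]) (auto simp: not_less)

lemma centered_normal_moments:
  assumes "centered_normal M Y"
  shows "integrable M (\<lambda>\<omega>. (Y \<omega>)\<^sup>2)"
    and "expectation (\<lambda>\<omega>. iexp (Y \<omega>)) = exp (- expectation (\<lambda>\<omega>. (Y \<omega>)\<^sup>2) / 2)"
proof -
  have Y [measurable]: "Y \<in> borel_measurable M" using assms by (simp add: centered_normal_def)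
  obtain \<sigma> where "(\<sigma> = 0 \<and> distr M borel Y = return borel 0) \<or>
      (\<sigma> > 0 \<and> distributed M lborel Y (normal_density 0 \<sigma>))"
    using assms unfolding centered_normal_def by blast
  then have "integrable M (\<lambda>\<omega>. (Y \<omega>)\<^sup>2) \<and>
      expectation (\<lambda>\<omega>. iexp (Y \<omega>)) = exp (- expectation (\<lambda>\<omega>. (Y \<omega>)\<^sup>2) / 2)"
  proof
    assume "\<sigma> = 0 \<and> distr M borel Y = return borel 0"
    then have D: "distr M borel Y = return borel 0" by simp
    have "AE y in distr M borel Y. y = 0" unfolding D by (subst AE_return) auto
    then have ae: "AE \<omega> in M. Y \<omega> = 0" by (subst (asm) AE_distr_iff) auto
    have "integrable M (\<lambda>\<omega>. (Y \<omega>)\<^sup>2) \<longleftrightarrow> integrable M (\<lambda>\<omega>. 0 :: real)"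
      using ae by (intro integrable_cong_AE) auto
    moreover have "expectation (\<lambda>\<omega>. (Y \<omega>)\<^sup>2) = expectation (\<lambda>\<omega>. 0)"
      using ae by (intro integral_cong_AE) auto
    moreover have "expectation (\<lambda>\<omega>. iexp (Y \<omega>)) = expectation (\<lambda>\<omega>. 1)"
      using ae by (intro integral_cong_AE) auto
    ultimately show ?thesis by (simp add: prob_space)
  next
    assume "\<sigma> > 0 \<and> distributed M lborel Y (normal_density 0 \<sigma>)"
    then have \<sigma>: "0 < \<sigma>" and D: "distributed M lborel Y (normal_density 0 \<sigma>)" by auto
    have "variance Y = \<sigma>\<^sup>2" by (rule normal_distributed_variance[OF \<sigma> D])
    moreover have "expectation Y = 0" by (rule normal_distributed_expectation[OF \<sigma> D])
    ultimately have Y2: "expectation (\<lambda>\<omega>. (Y \<omega>)\<^sup>2) = \<sigma>\<^sup>2" by simp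
    \<comment> \<open>The Bochner integral of a nonintegrable function is 0 by convention, so the
      nonzero value \<open>\<sigma>\<^sup>2\<close> already forces integrability.\<close>
    then have i: "integrable M (\<lambda>\<omega>. (Y \<omega>)\<^sup>2)"
      using \<sigma> not_integrable_integral_eq[of M "\<lambda>\<omega>. (Y \<omega>)\<^sup>2"] by fastforce
    \<comment> \<open>Standardising reduces the claim to the standard normal characteristic function
      at \<open>\<sigma>\<close>.\<close>
    have "distributed M lborel (\<lambda>\<omega>. (Y \<omega> - 0) / \<sigma>) std_normal_density"
      using D normal_standard_normal_convert[OF \<sigma>, of Y 0] by simp
    then have "distr M lborel (\<lambda>\<omega>. Y \<omega> / \<sigma>) = std_normal_distribution"
      by (simp add: distributed_def)
    moreover have "distr M borel (\<lambda>\<omega>. Y \<omega> / \<sigma>) = distr M lborel (\<lambda>\<omega>. Y \<omega> / \<sigma>)"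
      by (rule distr_cong) auto
    ultimately have S: "distr M borel (\<lambda>\<omega>. Y \<omega> / \<sigma>) = std_normal_distribution" by simp
    have "expectation (\<lambda>\<omega>. iexp (Y \<omega>)) = expectation (\<lambda>\<omega>. iexp (\<sigma> * (Y \<omega> / \<sigma>)))" using \<sigma> by simp
    also have "\<dots> = char (distr M borel (\<lambda>\<omega>. Y \<omega> / \<sigma>)) \<sigma>"
      unfolding char_def by (rule integral_distr[symmetric]) measurable
    also have "\<dots> = exp (- (\<sigma>\<^sup>2) / 2)" unfolding S char_std_normal_distribution by simp
    finally show ?thesis using i Y2 by (simp add: exp_of_real)
  qed
  then show "integrable M (\<lambda>\<omega>. (Y \<omega>)\<^sup>2)"
    "expectation (\<lambda>\<omega>. iexp (Y \<omega>)) = exp (- expectation (\<lambda>\<omega>. (Y \<omega>)\<^sup>2) / 2)" by auto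
qed

end

subsection \<open>Empirical measures on regular graphs\<close>

text \<open>Undirected edges, each listed in one orientation. The last clause encodes that every
  vertex has degree \<open>2 * card T / n\<close>, in the form in which it is applied to vertex
  weights. The clause \<open>n \<le> card T\<close> keeps the second moment of degenerate edge
  averages of order at most \<open>1 / n\<close>.\<close>

definition regular_graph :: "nat \<Rightarrow> (nat \<times> nat) set \<Rightarrow> bool" where
  "regular_graph n T \<longleftrightarrow> 0 < n \<and> T \<subseteq> {..<n} \<times> {..<n} \<and> n \<le> card T \<and>
     (\<forall>i j. (i, j) \<in> T \<longrightarrow> i \<noteq> j \<and> (j, i) \<notin> T) \<and>
     (\<forall>a :: nat \<Rightarrow> real. real n * (\<Sum>(i, j)\<in>T. a i + a j) = 2 * real (card T) * (\<Sum>i<n. a i))"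

lemma regular_graphD:
  assumes "regular_graph n T"
  shows "0 < n" "finite T" "T \<noteq> {}" "0 < card T" "n \<le> card T"
    and "\<And>i j. (i, j) \<in> T \<Longrightarrow> i \<noteq> j \<and> (j, i) \<notin> T"
  using assms unfolding regular_graph_def
  by (auto intro: finite_subset[of T "{..<n} \<times> {..<n}"])

lemma regular_graph_sum:
  fixes a :: "nat \<Rightarrow> 'b::euclidean_space"
  assumes T: "regular_graph n T"
  shows "(1 / real (card T)) *\<^sub>R (\<Sum>(i, j)\<in>T. a i + a j) = (2 / real n) *\<^sub>R (\<Sum>i<n. a i)"
proof (rule euclidean_eqI)
  fix b :: 'b assume "b \<in> Basis"
  have "real n * (\<Sum>(i, j)\<in>T. a i \<bullet> b + a j \<bullet> b) = 2 * real (card T) * (\<Sum>i<n. a i \<bullet> b)"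
  proof -
    have "\<forall>c :: nat \<Rightarrow> real. real n * (\<Sum>(i, j)\<in>T. c i + c j) = 2 * real (card T) * (\<Sum>i<n. c i)"
      using T by (simp add: regular_graph_def)
    from spec[OF this, of "\<lambda>i. a i \<bullet> b"] show ?thesis by simp
  qed
  then have "(\<Sum>(i, j)\<in>T. a i \<bullet> b + a j \<bullet> b) / real (card T) = 2 * (\<Sum>i<n. a i \<bullet> b) / real n"
    using regular_graphD(1,4)[OF T] by (simp add: field_simps)
  then show "((1 / real (card T)) *\<^sub>R (\<Sum>(i, j)\<in>T. a i + a j)) \<bullet> b = ((2 / real n) *\<^sub>R (\<Sum>i<n. a i)) \<bullet> b"
    by (simp add: inner_sum_left inner_add_left split_beta)
qed

definition ordered_pairs :: "nat \<Rightarrow> (nat \<times> nat) set" where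
  "ordered_pairs n = {(i, j). i < j \<and> j < n}"

lemma finite_ordered_pairs: "finite (ordered_pairs n)"
  by (rule finite_subset[of _ "{..<n} \<times> {..<n}"]) (auto simp: ordered_pairs_def)

text \<open>By induction, since the new vertex \<open>n\<close> is joined to all earlier ones.
  Constant weights then give the number of edges.\<close>

lemma sum_ordered_pairs:
  fixes a :: "nat \<Rightarrow> real"
  shows "(\<Sum>(i, j)\<in>ordered_pairs n. a i + a j) = (real n - 1) * (\<Sum>i<n. a i)"
proof (induction n)
  case (Suc n)
  have *: "ordered_pairs (Suc n) = ordered_pairs n \<union> (\<lambda>i. (i, n)) ` {..<n}"
    by (auto simp: ordered_pairs_def)
  have "(\<Sum>(i, j)\<in>ordered_pairs (Suc n). a i + a j) =
      (\<Sum>(i, j)\<in>ordered_pairs n. a i + a j) + (\<Sum>(i, j)\<in>(\<lambda>i. (i, n)) ` {..<n}. a i + a j)"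
    unfolding * by (rule sum.union_disjoint) (auto simp: finite_ordered_pairs, auto simp: ordered_pairs_def)
  also have "(\<Sum>(i, j)\<in>(\<lambda>i. (i, n)) ` {..<n}. a i + a j) = (\<Sum>i<n. a i) + real n * a n"
    by (subst sum.reindex) (auto simp: inj_on_def sum.distrib)
  finally show ?case using Suc by (simp add: algebra_simps)
qed (simp add: ordered_pairs_def)

lemma card_ordered_pairs: "real (card (ordered_pairs n)) = real n * (real n - 1) / 2"
  using sum_ordered_pairs[of "\<lambda>_. 1" n] by (simp add: split_beta mult.commute)

text \<open>From three vertices on, the complete graph has at least as many edges as
  vertices.\<close>

lemma regular_graph_ordered_pairs:
  assumes "3 \<le> n" shows "regular_graph n (ordered_pairs n)"
proof -
  have "real n * 2 \<le> real n * (real n - 1)" using assms by (intro mult_left_mono) auto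
  then have "real n \<le> real (card (ordered_pairs n))" unfolding card_ordered_pairs by simp
  then have "n \<le> card (ordered_pairs n)" by simp
  moreover have "ordered_pairs n \<subseteq> {..<n} \<times> {..<n}"
    "\<forall>i j. (i, j) \<in> ordered_pairs n \<longrightarrow> i \<noteq> j \<and> (j, i) \<notin> ordered_pairs n"
    by (auto simp: ordered_pairs_def)
  ultimately show ?thesis
    using assms unfolding regular_graph_def card_ordered_pairs sum_ordered_pairs by simp
qed

lemma bij_betw_add_mod:
  fixes n k :: nat assumes "0 < n" shows "bij_betw (\<lambda>i. (i + k) mod n) {..<n} {..<n}"
proof -
  have "inj_on (\<lambda>i. (i + k) mod n) {..<n}"
  proof (rule inj_onI)
    fix i j assume *: "i \<in> {..<n}" "j \<in> {..<n}" "(i + k) mod n = (j + k) mod n"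
    define r where "r = k mod n"
    have "r < n" using assms by (simp add: r_def)
    moreover have "(i + r) mod n = (j + r) mod n" using *(3) by (simp add: r_def mod_simps)
    ultimately show "i = j" using *(1,2) by (auto simp: mod_if split: if_splits)
  qed
  moreover have "(\<lambda>i. (i + k) mod n) ` {..<n} \<subseteq> {..<n}" using assms by auto
  ultimately show ?thesis by (simp add: bij_betw_def endo_inj_surj)
qed

lemma regular_graph_cyclic_edges:
  assumes d: "1 \<le> d" "2 * d + 1 \<le> n" shows "regular_graph n (cyclic_edges n d {..<n})"
proof -
  have n: "0 < n" using d by simp
  have card: "card (cyclic_edges n d {..<n}) = n * d" using card_cyclic_edges[of "{..<n}" n d] d by simp
  have "(\<Sum>(i, j)\<in>cyclic_edges n d {..<n}. a i + a j) = 2 * real d * (\<Sum>i<n. a i)" for a :: "nat \<Rightarrow> real"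
  proof -
    have "(\<Sum>(i, j)\<in>cyclic_edges n d {..<n}. a i + a j) = (\<Sum>i<n. \<Sum>k\<in>{1..d}. a i + a ((i + k) mod n))"
      by (rule sum_cyclic_edges) (use d in auto)
    also have "\<dots> = real d * (\<Sum>i<n. a i) + (\<Sum>k\<in>{1..d}. \<Sum>i<n. a ((i + k) mod n))"
      by (simp add: sum.distrib sum_distrib_left) (rule sum.swap)
    \<comment> \<open>For fixed \<open>k\<close> the shift by \<open>k\<close> permutes the
      vertices, so second endpoints contribute the same sum as first endpoints.\<close>
    also have "(\<Sum>k\<in>{1..d}. \<Sum>i<n. a ((i + k) mod n)) = (\<Sum>k\<in>{1..d}. \<Sum>i<n. a i)"
      by (intro sum.cong refl sum.reindex_bij_betw[OF bij_betw_add_mod[OF n]])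
    finally show ?thesis by simp
  qed
  moreover have "cyclic_edges n d {..<n} \<subseteq> {..<n} \<times> {..<n}" using n by (auto simp: cyclic_edges_def)
  ultimately show ?thesis
    using n d cyclic_edges_asym[of "{..<n}" n d] unfolding regular_graph_def card by (simp add: mult_ac)
qed

lemma integral_uniform_count_measure_scaleR:
  fixes f :: "'i \<Rightarrow> 'b::{banach, second_countable_topology}"
  assumes "finite A"
  shows "integral\<^sup>L (uniform_count_measure A) f = (1 / real (card A)) *\<^sub>R sum f A"
  using assms by (simp add: uniform_count_measure_def lebesgue_integral_point_measure_finite scaleR_sum_right)

lemma distr_uniform_count_prob_dists:
  fixes \<phi> :: "'i \<Rightarrow> real^'q::finite"
  assumes "finite A" "A \<noteq> {}"
  shows "distr (uniform_count_measure A) borel \<phi> \<in> prob_dists"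
  unfolding prob_dists_def
  by (auto intro!: prob_space.prob_space_distr prob_space_uniform_count_measure assms)

lemma integral_distr_uniform_count:
  fixes \<phi> :: "'i \<Rightarrow> real^'q::finite" and f :: "real^'q \<Rightarrow> 'b::{banach, second_countable_topology}"
  assumes "finite A" "f \<in> borel_measurable borel"
  shows "integral\<^sup>L (distr (uniform_count_measure A) borel \<phi>) f = (1 / real (card A)) *\<^sub>R (\<Sum>x\<in>A. f (\<phi> x))"
  using assms by (subst integral_distr) (auto simp: integral_uniform_count_measure_scaleR)

lemma integral_emp_P:
  fixes f :: "real^'q::finite \<Rightarrow> 'b::{banach, second_countable_topology}"
  assumes "f \<in> borel_measurable borel"
  shows "integral\<^sup>L (emp_P n X \<omega>) f = (1 / real n) *\<^sub>R (\<Sum>i<n. f (X i \<omega>))"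
  unfolding emp_P_def using assms by (simp add: integral_distr_uniform_count)

text \<open>Both symmetrized empirical measures of pairwise differences have this form, for the edge sets
  \<open>ordered_pairs n\<close> and \<open>cyclic_edges n d {..<n}\<close>.\<close>

definition sym_emp :: "(nat \<times> nat) set \<Rightarrow> (nat \<Rightarrow> 'a \<Rightarrow> real^'q::finite) \<Rightarrow> 'a \<Rightarrow> (real^'q) measure" where
  "sym_emp T X \<omega> = distr (uniform_count_measure (T \<times> (UNIV :: bool set))) borel
     (\<lambda>((i, j), b). sgn_of b *\<^sub>R (X j \<omega> - X i \<omega>))"

lemma distr_uniform_count_bij:
  assumes b: "bij_betw g A B" and fin: "finite A" and eq: "\<And>x. x \<in> A \<Longrightarrow> \<phi> x = \<psi> (g x)"
  shows "distr (uniform_count_measure A) borel \<phi> = distr (uniform_count_measure B) (borel :: 'b::topological_space measure) \<psi>"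
proof (rule measure_eqI)
  fix S assume "S \<in> sets (distr (uniform_count_measure A) borel \<phi>)"
  then have S: "S \<in> sets borel" by simp
  have fB: "finite B" using b fin by (simp add: bij_betw_finite)
  have cc: "card A = card B" using b by (rule bij_betw_same_card)
  have "g ` (\<phi> -` S \<inter> A) = \<psi> -` S \<inter> B" using b eq by (auto simp: bij_betw_def)
  moreover have "inj_on g (\<phi> -` S \<inter> A)" using b by (auto simp: bij_betw_def inj_on_def)
  ultimately have "card (\<phi> -` S \<inter> A) = card (\<psi> -` S \<inter> B)" by (metis card_image)
  then show "emeasure (distr (uniform_count_measure A) borel \<phi>) S = emeasure (distr (uniform_count_measure B) borel \<psi>) S"
    using S fin fB cc
    by (simp add: emeasure_distr space_uniform_count_measure emeasure_uniform_count_measure)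
qed simp

lemma emp_Q_eq_sym_emp: "emp_Q n X \<omega> = sym_emp (ordered_pairs n) X \<omega>"
  unfolding emp_Q_def sym_emp_def
proof (rule distr_uniform_count_bij)
  show "bij_betw (\<lambda>(i, j, b). ((i, j), b)) {(i, j, b). i < j \<and> j < n} (ordered_pairs n \<times> (UNIV :: bool set))"
    by (rule bij_betw_byWitness[where f' = "\<lambda>((i, j), b). (i, j, b)"]) (auto simp: ordered_pairs_def)
  show "finite {(i, j, b :: bool). i < j \<and> j < n}"
    by (rule finite_subset[of _ "{..<n} \<times> {..<n} \<times> UNIV"]) auto
qed auto

lemma emp_Qd_eq_sym_emp:
  assumes "2 * d + 1 \<le> n" shows "emp_Qd n d X \<omega> = sym_emp (cyclic_edges n d {..<n}) X \<omega>"
  unfolding emp_Qd_def sym_emp_def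
proof (rule distr_uniform_count_bij)
  let ?e = "\<lambda>(i, k). (i, (i + k) mod n)"
  have b: "bij_betw ?e ({..<n} \<times> {1..d}) (cyclic_edges n d {..<n})"
    using inj_on_cyclic_edges[of "{..<n}" n d] assms by (auto simp: bij_betw_def cyclic_edges_def)
  have "bij_betw (\<lambda>(i, k, b). ((i, k), b)) ({..<n} \<times> {1..d} \<times> (UNIV :: bool set)) (({..<n} \<times> {1..d}) \<times> UNIV)"
    by (rule bij_betw_byWitness[where f' = "\<lambda>((i, j), b). (i, j, b)"]) auto
  from bij_betw_trans[OF this bij_betw_map_prod[OF b bij_betw_id]]
  show "bij_betw (map_prod ?e id \<circ> (\<lambda>(i, k, b). ((i, k), b)))
      ({..<n} \<times> {1..d} \<times> (UNIV :: bool set)) (cyclic_edges n d {..<n} \<times> UNIV)" .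
qed auto

lemma sym_emp_prob_dists: "finite T \<Longrightarrow> T \<noteq> {} \<Longrightarrow> sym_emp T X \<omega> \<in> prob_dists"
  unfolding sym_emp_def by (rule distr_uniform_count_prob_dists) auto

lemma integral_sym_emp:
  fixes f :: "real^'q::finite \<Rightarrow> 'b::{banach, second_countable_topology}"
  assumes "finite T" "f \<in> borel_measurable borel"
  shows "integral\<^sup>L (sym_emp T X \<omega>) f =
    (1 / real (card T)) *\<^sub>R (\<Sum>(i, j)\<in>T. (1 / 2) *\<^sub>R (f (X i \<omega> - X j \<omega>) + f (X j \<omega> - X i \<omega>)))"
proof -
  have "integral\<^sup>L (sym_emp T X \<omega>) f = (1 / real (card T * 2)) *\<^sub>R
      (\<Sum>e\<in>T. \<Sum>b\<in>UNIV. f (sgn_of b *\<^sub>R (X (snd e) \<omega> - X (fst e) \<omega>)))"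
    unfolding sym_emp_def using assms
    by (subst integral_distr_uniform_count)
      (auto simp: card_cartesian_product sum.cartesian_product split_beta)
  also have "\<dots> = (1 / real (card T)) *\<^sub>R (\<Sum>(i, j)\<in>T. (1 / 2) *\<^sub>R (f (X i \<omega> - X j \<omega>) + f (X j \<omega> - X i \<omega>)))"
    by (simp add: UNIV_bool sgn_of_def split_beta add.commute flip: scaleR_sum_right)
  finally show ?thesis .
qed

section \<open>Hoeffding projections and the weak law of large numbers\<close>

context iid_sample
begin

definition even_kernel :: "(real^'q \<Rightarrow> real) \<Rightarrow> real \<Rightarrow> bool" where
  "even_kernel \<kappa> B \<longleftrightarrow> \<kappa> \<in> borel_measurable borel \<and> (\<forall>y. \<bar>\<kappa> y\<bar> \<le> B) \<and> (\<forall>y. \<kappa> (- y) = \<kappa> y) \<and>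
     expectation (\<lambda>\<omega>. \<kappa> (X 0 \<omega> - X 1 \<omega>)) = 0"

definition proj1 :: "(real^'q \<Rightarrow> real) \<Rightarrow> real^'q \<Rightarrow> real" where
  "proj1 \<kappa> x = (\<integral>y. \<kappa> (x - y) \<partial>P)"

definition proj2 :: "(real^'q \<Rightarrow> real) \<Rightarrow> real^'q \<Rightarrow> real^'q \<Rightarrow> real" where
  "proj2 \<kappa> x y = \<kappa> (x - y) - proj1 \<kappa> x - proj1 \<kappa> y"

lemma hoeffding_pair_kernels:
  assumes k: "even_kernel \<kappa> B" and k': "even_kernel \<kappa>' B"
  shows "hoeffding_pair M X P (proj1 \<kappa>) (proj2 \<kappa>') (3 * B)"
proof -
  interpret PP: prob_space P by (rule prob_space_P)
  have int: "integrable P (\<lambda>y. f (x - y))" if f: "even_kernel f B" for f x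
  proof -
    have [measurable]: "f \<in> borel_measurable borel" using f by (simp add: even_kernel_def)
    show ?thesis
      using f by (intro PP.integrable_const_bound[where B = B]) (auto simp: even_kernel_def)
  qed
  have p_meas [measurable]: "proj1 f \<in> borel_measurable borel" if f: "even_kernel f B" for f
  proof -
    have [measurable]: "f \<in> borel_measurable borel" using f by (simp add: even_kernel_def)
    show ?thesis unfolding proj1_def [abs_def] by measurable
  qed
  have p_bd: "\<bar>proj1 f x\<bar> \<le> B" if f: "even_kernel f B" for f x
  proof -
    have "\<bar>proj1 f x\<bar> \<le> (\<integral>y. \<bar>f (x - y)\<bar> \<partial>P)" unfolding proj1_def by (rule integral_abs_bound)
    also have "\<dots> \<le> (\<integral>y. B \<partial>P)"
      using int[OF f, of x] f by (intro integral_mono) (auto simp: even_kernel_def)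
    finally show ?thesis using PP.prob_space by simp
  qed
  have p_int: "integrable P (proj1 f)" if f: "even_kernel f B" for f
    using p_meas[OF f] p_bd[OF f] by (intro PP.integrable_const_bound[where B = B]) auto
  have p_cent: "integral\<^sup>L P (proj1 f) = 0" if f: "even_kernel f B" for f
  proof -
    have [measurable]: "f \<in> borel_measurable borel" using f by (simp add: even_kernel_def)
    have "(\<integral>\<omega>. f (X 0 \<omega> - X 1 \<omega>) \<partial>M) = (\<integral>x. (\<integral>y. f (x - y) \<partial>P) \<partial>P)"
      by (rule integral_pair[where C = B]) (use f in \<open>auto simp: even_kernel_def\<close>)
    then show ?thesis using f by (simp add: even_kernel_def proj1_def [abs_def])
  qed
  have B0: "0 \<le> B" using k unfolding even_kernel_def by (meson abs_ge_zero order_trans)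
  have [measurable]: "\<kappa>' \<in> borel_measurable borel" using k' by (simp add: even_kernel_def)
  note [measurable] = p_meas[OF k] p_meas[OF k']
  show ?thesis
  proof
    show "proj1 \<kappa> \<in> borel_measurable borel" by measurable
    show "case_prod (proj2 \<kappa>') \<in> borel_measurable (borel \<Otimes>\<^sub>M borel)"
      unfolding proj2_def [abs_def] split_beta' by measurable
    show "\<bar>proj1 \<kappa> x\<bar> \<le> 3 * B" for x using p_bd[OF k, of x] B0 by linarith
    show "\<bar>proj2 \<kappa>' x y\<bar> \<le> 3 * B" for x y
    proof -
      have "\<bar>\<kappa>' (x - y)\<bar> \<le> B" using k' by (simp add: even_kernel_def)
      then show ?thesis using p_bd[OF k', of x] p_bd[OF k', of y] unfolding proj2_def by linarith
    qed
    show "integral\<^sup>L P (proj1 \<kappa>) = 0" by (rule p_cent[OF k])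
    show "integral\<^sup>L P (proj2 \<kappa>' x) = 0" for x
    proof -
      have "integral\<^sup>L P (proj2 \<kappa>' x) = (\<integral>y. \<kappa>' (x - y) \<partial>P) - proj1 \<kappa>' x - integral\<^sup>L P (proj1 \<kappa>')"
        unfolding proj2_def [abs_def] using int[OF k', of x] p_int[OF k'] PP.prob_space by simp
      then show ?thesis by (simp add: p_cent[OF k'] flip: proj1_def)
    qed
    show "proj2 \<kappa>' x y = proj2 \<kappa>' y x" for x y
    proof -
      have "\<kappa>' (x - y) = \<kappa>' (- (x - y))" using k' by (simp add: even_kernel_def del: minus_diff_eq)
      then show ?thesis by (simp add: proj2_def)
    qed
  qed
qed

lemma integral_sym_emp_even:
  fixes f :: "real^'q \<Rightarrow> 'c::{banach, second_countable_topology}"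
  assumes "finite T" "f \<in> borel_measurable borel" and even: "\<And>y. f (- y) = f y"
  shows "integral\<^sup>L (sym_emp T X \<omega>) f = (1 / real (card T)) *\<^sub>R (\<Sum>(i, j)\<in>T. f (X i \<omega> - X j \<omega>))"
proof -
  have "f (X j \<omega> - X i \<omega>) = f (X i \<omega> - X j \<omega>)" for i j using even[of "X i \<omega> - X j \<omega>"] by simp
  then show ?thesis
    by (simp add: integral_sym_emp[OF assms(1,2)] flip: scaleR_2)
qed

text \<open>Both variances are at most \<open>(3 * B)\<^sup>2\<close>. The weights \<open>a\<close>
  and \<open>b\<close> serve the full decomposition as well as either part alone, with the other
  weight set to 0.\<close>

lemma edge_sum_second_moment:
  assumes k: "even_kernel \<kappa> B" and T: "finite T" "\<And>i j. (i, j) \<in> T \<Longrightarrow> i \<noteq> j \<and> (j, i) \<notin> T"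
  shows "expectation (\<lambda>\<omega>. (a / real n * (\<Sum>i<n. proj1 \<kappa> (X i \<omega>)) +
      b / real (card T) * (\<Sum>(i, j)\<in>T. proj2 \<kappa> (X i \<omega>) (X j \<omega>)))\<^sup>2) \<le>
    9 * B\<^sup>2 * (a\<^sup>2 / real n + b\<^sup>2 / real (card T))"
proof -
  interpret hoeffding_pair M X P "proj1 \<kappa>" "proj2 \<kappa>" "3 * B" by (rule hoeffding_pair_kernels[OF k k])
  have "(proj1 \<kappa> x)\<^sup>2 \<le> (3 * B)\<^sup>2" "(proj2 \<kappa> x y)\<^sup>2 \<le> (3 * B)\<^sup>2" for x y
    using power_mono[OF h_bound[of x], of 2] power_mono[OF g_bound[of x y], of 2] by simp_all
  then have "h_var \<le> expectation (\<lambda>\<omega>. (3 * B)\<^sup>2)" "g_var \<le> expectation (\<lambda>\<omega>. (3 * B)\<^sup>2)"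
    unfolding h_var_def g_var_def by (intro integral_mono integrable_const_bound[where B = "(3 * B)\<^sup>2"]; simp)+
  then have var: "h_var \<le> 9 * B\<^sup>2" "g_var \<le> 9 * B\<^sup>2" by (simp_all add: prob_space power_mult_distrib)
  have "expectation (\<lambda>\<omega>. (a / real n * (\<Sum>i<n. proj1 \<kappa> (X i \<omega>)) +
      b / real (card T) * (\<Sum>(i, j)\<in>T. proj2 \<kappa> (X i \<omega>) (X j \<omega>)))\<^sup>2) =
      (a / real n)\<^sup>2 * real n * h_var + (b / real (card T))\<^sup>2 * real (card T) * g_var"
    using second_moment[of "{..<n}" T "a / real n" "b / real (card T)"] T by simp
  also have "\<dots> = a\<^sup>2 / real n * h_var + b\<^sup>2 / real (card T) * g_var"
    by (simp add: power2_eq_square)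
  also have "\<dots> \<le> a\<^sup>2 / real n * (9 * B\<^sup>2) + b\<^sup>2 / real (card T) * (9 * B\<^sup>2)"
    using var by (intro add_mono mult_left_mono) auto
  finally show ?thesis by (simp add: algebra_simps)
qed

text \<open>The constant is \<open>45 = 9 * (2\<^sup>2 + 1\<^sup>2)\<close>: weight 2 on the linear
  part, weight 1 on the degenerate part, whose edges number at least \<open>n\<close>.\<close>

lemma sym_emp_second_moment:
  assumes k: "even_kernel \<kappa> B" and T: "regular_graph n T"
  shows "expectation (\<lambda>\<omega>. (integral\<^sup>L (sym_emp T X \<omega>) \<kappa>)\<^sup>2) \<le> 45 * B\<^sup>2 / real n"
proof -
  note TD = regular_graphD[OF T]
  have "integral\<^sup>L (sym_emp T X \<omega>) \<kappa> = 2 / real n * (\<Sum>i<n. proj1 \<kappa> (X i \<omega>)) +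
      1 / real (card T) * (\<Sum>(i, j)\<in>T. proj2 \<kappa> (X i \<omega>) (X j \<omega>))" for \<omega>
  proof -
    have "integral\<^sup>L (sym_emp T X \<omega>) \<kappa> = (1 / real (card T)) *\<^sub>R (\<Sum>(i, j)\<in>T. \<kappa> (X i \<omega> - X j \<omega>))"
      using k TD by (intro integral_sym_emp_even) (auto simp: even_kernel_def)
    also have "(\<Sum>(i, j)\<in>T. \<kappa> (X i \<omega> - X j \<omega>)) =
        (\<Sum>(i, j)\<in>T. proj1 \<kappa> (X i \<omega>) + proj1 \<kappa> (X j \<omega>)) + (\<Sum>(i, j)\<in>T. proj2 \<kappa> (X i \<omega>) (X j \<omega>))"
      unfolding sum.distrib[symmetric] by (intro sum.cong) (auto simp: proj2_def)
    finally show ?thesis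
      using regular_graph_sum[OF T, of "\<lambda>i. proj1 \<kappa> (X i \<omega>)"] by (simp add: add_divide_distrib)
  qed
  then have "expectation (\<lambda>\<omega>. (integral\<^sup>L (sym_emp T X \<omega>) \<kappa>)\<^sup>2) \<le> 9 * B\<^sup>2 * (2\<^sup>2 / real n + 1\<^sup>2 / real (card T))"
    using edge_sum_second_moment[OF k TD(2,6), of 2 n 1] by simp
  also have "\<dots> \<le> 9 * B\<^sup>2 * (2\<^sup>2 / real n + 1\<^sup>2 / real n)"
    using TD by (intro mult_left_mono add_left_mono divide_left_mono) auto
  finally show ?thesis by (simp add: add_divide_distrib[symmetric])
qed

lemma sym_emp_integral_measurable:
  fixes f :: "real^'q \<Rightarrow> 'c::{banach, second_countable_topology}"
  assumes [measurable]: "f \<in> borel_measurable borel" and "finite T"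
  shows "(\<lambda>\<omega>. integral\<^sup>L (sym_emp T X \<omega>) f) \<in> borel_measurable M"
  unfolding integral_sym_emp[OF assms(2,1)] split_beta by measurable

lemma norm_sym_emp_integral_le:
  fixes f :: "real^'q \<Rightarrow> 'c::{banach, second_countable_topology}"
  assumes f: "f \<in> borel_measurable borel" "\<And>y. norm (f y) \<le> B" and T: "finite T" "T \<noteq> {}"
  shows "norm (integral\<^sup>L (sym_emp T X \<omega>) f) \<le> B"
proof -
  have p: "sym_emp T X \<omega> \<in> prob_dists" by (rule sym_emp_prob_dists[OF T])
  interpret S: prob_space "sym_emp T X \<omega>" using p by (simp add: prob_dists_def)
  have "integrable (sym_emp T X \<omega>) f"
    using f by (intro integrable_bounded_prob_dist[OF p]) (auto simp: bounded_iff)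
  then have "(\<integral>y. norm (f y) \<partial>sym_emp T X \<omega>) \<le> (\<integral>y. B \<partial>sym_emp T X \<omega>)"
    using f by (intro integral_mono) auto
  then show ?thesis
    by (intro order_trans[OF integral_norm_bound]) (simp add: S.prob_space)
qed

text \<open>Chebyshev's inequality for a symmetrised and centered version of \<open>f\<close>. The
  bound depends on the graph only through \<open>n\<close>, so it covers fixed and growing
  \<open>d\<close> alike.\<close>

lemma sym_emp_law_of_large_numbers:
  fixes f :: "real^'q \<Rightarrow> real"
  assumes Q: "Q = distr M borel (\<lambda>\<omega>. X 0 \<omega> - X 1 \<omega>)"
    and m [measurable]: "f \<in> borel_measurable borel" and bd: "\<And>y. \<bar>f y\<bar> \<le> C"
    and T: "regular_graph n T" and \<delta>: "0 < \<delta>"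
  shows "prob {\<omega> \<in> space M. \<delta> \<le> \<bar>integral\<^sup>L (sym_emp T X \<omega>) f - integral\<^sup>L Q f\<bar>} \<le> 45 * (2 * C)\<^sup>2 / \<delta>\<^sup>2 / real n"
proof -
  note TD = regular_graphD[OF T]
  have fi: "integrable M (\<lambda>\<omega>. f (X i \<omega> - X j \<omega>))" for i j
    using bd by (intro integrable_const_bound[where B = C]) auto
  have Qf: "integral\<^sup>L Q f = expectation (\<lambda>\<omega>. f (X 0 \<omega> - X 1 \<omega>))"
    unfolding Q by (rule integral_distr) measurable
  have swap: "expectation (\<lambda>\<omega>. f (X 1 \<omega> - X 0 \<omega>)) = integral\<^sup>L Q f"
    unfolding Qf using integral_pair[of 0 1 "\<lambda>x y. f (x - y)" C] integral_pair[of 1 0 "\<lambda>x y. f (x - y)" C] bd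
    by simp
  have absQ: "\<bar>integral\<^sup>L Q f\<bar> \<le> C"
  proof -
    have "\<bar>integral\<^sup>L Q f\<bar> \<le> expectation (\<lambda>\<omega>. \<bar>f (X 0 \<omega> - X 1 \<omega>)\<bar>)" unfolding Qf by (rule integral_abs_bound)
    also have "\<dots> \<le> expectation (\<lambda>\<omega>. C)" using fi bd by (intro integral_mono) auto
    finally show ?thesis by (simp add: prob_space)
  qed
  \<comment> \<open>Symmetrising leaves integrals under \<open>sym_emp\<close> unchanged, and the
    integral under \<open>Q\<close> too, because \<open>X 0\<close> and \<open>X 1\<close> are
    exchangeable.\<close>
  define \<kappa> where "\<kappa> y = (f y + f (- y)) / 2 - integral\<^sup>L Q f" for y
  have \<kappa>m [measurable]: "\<kappa> \<in> borel_measurable borel" unfolding \<kappa>_def [abs_def] by measurable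
  have k: "even_kernel \<kappa> (2 * C)"
    unfolding even_kernel_def
  proof (intro conjI allI)
    show "\<bar>\<kappa> y\<bar> \<le> 2 * C" for y 
      using bd[of y, unfolded abs_le_iff] bd[of "- y", unfolded abs_le_iff] absQ[unfolded abs_le_iff]
      unfolding \<kappa>_def abs_le_iff by (auto simp: field_simps)
    have "expectation (\<lambda>\<omega>. \<kappa> (X 0 \<omega> - X 1 \<omega>)) =
        (expectation (\<lambda>\<omega>. f (X 0 \<omega> - X 1 \<omega>)) + expectation (\<lambda>\<omega>. f (X 1 \<omega> - X 0 \<omega>))) / 2 - integral\<^sup>L Q f"
      using fi[of 0 1] fi[of 1 0] by (simp add: \<kappa>_def prob_space)
    then show "expectation (\<lambda>\<omega>. \<kappa> (X 0 \<omega> - X 1 \<omega>)) = 0" unfolding swap Qf[symmetric] by simp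
  qed (auto simp: \<kappa>_def)
  have eq: "integral\<^sup>L (sym_emp T X \<omega>) f - integral\<^sup>L Q f = integral\<^sup>L (sym_emp T X \<omega>) \<kappa>" for \<omega>
  proof -
    have "integral\<^sup>L (sym_emp T X \<omega>) \<kappa> =
        (1 / real (card T)) * (\<Sum>(i, j)\<in>T. (f (X i \<omega> - X j \<omega>) + f (X j \<omega> - X i \<omega>)) / 2 - integral\<^sup>L Q f)"
      using TD k by (subst integral_sym_emp_even) (auto simp: even_kernel_def \<kappa>_def)
    also have "\<dots> = (1 / real (card T)) * (\<Sum>(i, j)\<in>T. (f (X i \<omega> - X j \<omega>) + f (X j \<omega> - X i \<omega>)) / 2) - integral\<^sup>L Q f"
      using TD(4) by (simp add: split_beta sum_subtractf right_diff_distrib)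
    also have "\<dots> = integral\<^sup>L (sym_emp T X \<omega>) f - integral\<^sup>L Q f"
      using TD by (subst integral_sym_emp) (auto simp: split_beta)
    finally show ?thesis by simp
  qed
  have [measurable]: "(\<lambda>\<omega>. integral\<^sup>L (sym_emp T X \<omega>) \<kappa>) \<in> borel_measurable M"
    by (intro sym_emp_integral_measurable TD) measurable
  have i: "integrable M (\<lambda>\<omega>. (norm (integral\<^sup>L (sym_emp T X \<omega>) \<kappa>))\<^sup>2)"
  proof (rule integrable_const_bound)
    have "norm (integral\<^sup>L (sym_emp T X \<omega>) \<kappa>) \<le> 2 * C" for \<omega>
      using k TD by (intro norm_sym_emp_integral_le) (auto simp: even_kernel_def)
    then show "AE \<omega> in M. norm ((norm (integral\<^sup>L (sym_emp T X \<omega>) \<kappa>))\<^sup>2) \<le> (2 * C)\<^sup>2"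
      using power_mono[of "norm (integral\<^sup>L (sym_emp T X _) \<kappa>)" "2 * C" 2] by (intro AE_I2) simp
  qed measurable
  have "prob {\<omega> \<in> space M. \<delta> \<le> norm (integral\<^sup>L (sym_emp T X \<omega>) \<kappa>)} \<le>
      expectation (\<lambda>\<omega>. (norm (integral\<^sup>L (sym_emp T X \<omega>) \<kappa>))\<^sup>2) / \<delta>\<^sup>2"
    by (intro prob_norm_gt_le i \<delta>) measurable
  also have "\<dots> \<le> (45 * (2 * C)\<^sup>2 / real n) / \<delta>\<^sup>2"
    using sym_emp_second_moment[OF k T] by (intro divide_right_mono) auto
  finally show ?thesis by (simp add: eq mult.commute)
qed

text \<open>The empirical measure charges 0 only if two sample points joined by an edge coincide.
  Each coincidence has probability \<open>measure Q {0}\<close>, and there are finitely many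
  edges.\<close>

lemma sym_emp_no_mass_at_0:
  assumes Q: "Q = distr M borel (\<lambda>\<omega>. X 0 \<omega> - X 1 \<omega>)" and Q0: "measure Q {0} = 0"
    and T: "finite T" "T \<noteq> {}" "\<And>i j. (i, j) \<in> T \<Longrightarrow> i \<noteq> j"
  shows "\<exists>A\<in>events. prob A = 0 \<and> {\<omega> \<in> space M. measure (sym_emp T X \<omega>) {0} \<noteq> 0} \<subseteq> A"
proof -
  define A where "A = (\<Union>(i, j)\<in>T. {\<omega> \<in> space M. X i \<omega> - X j \<omega> = 0})"
  have ev: "{\<omega> \<in> space M. X i \<omega> - X j \<omega> = 0} \<in> events" for i j by measurable
  have A: "A \<in> events" unfolding A_def using T(1) ev by (intro sets.finite_UN) auto
  have p0: "prob {\<omega> \<in> space M. X i \<omega> - X j \<omega> = 0} = 0" if "i \<noteq> j" for i j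
  proof -
    have *: "expectation (\<lambda>\<omega>. indicat_real {0} (X i \<omega> - X j \<omega>)) = prob {\<omega> \<in> space M. X i \<omega> - X j \<omega> = 0}" for i j
    proof -
      have "expectation (\<lambda>\<omega>. indicat_real {0} (X i \<omega> - X j \<omega>)) = expectation (indicator {\<omega> \<in> space M. X i \<omega> - X j \<omega> = 0})"
        by (intro Bochner_Integration.integral_cong) (auto simp: indicator_def)
      then show ?thesis using ev[of i j] by simp
    qed
    have "expectation (\<lambda>\<omega>. indicat_real {0} (X i \<omega> - X j \<omega>)) = expectation (\<lambda>\<omega>. indicat_real {0} (X 0 \<omega> - X 1 \<omega>))"
      using integral_pair[OF that, of "\<lambda>x y. indicat_real {0} (x - y)" 1]
        integral_pair[of 0 1 "\<lambda>x y. indicat_real {0} (x - y)" 1] by (simp add: indicator_def)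
    also have "\<dots> = integral\<^sup>L Q (indicat_real {0})" unfolding Q by (rule integral_distr[symmetric]) auto
    also have "\<dots> = 0" using Q0 by (simp add: Q)
    finally show ?thesis unfolding * .
  qed
  have "prob A \<le> (\<Sum>e\<in>T. prob {\<omega> \<in> space M. X (fst e) \<omega> - X (snd e) \<omega> = 0})"
    unfolding A_def split_beta by (intro finite_measure_subadditive_finite T) (use ev in auto)
  also have "\<dots> = 0" using T(3) p0 by (intro sum.neutral) auto
  finally have "prob A = 0" by (simp add: measure_le_0_iff)
  moreover have "\<omega> \<in> A" if \<omega>: "\<omega> \<in> space M" "measure (sym_emp T X \<omega>) {0} \<noteq> 0" for \<omega>
  proof (rule ccontr)
    assume "\<omega> \<notin> A"
    then have ne: "X i \<omega> - X j \<omega> \<noteq> 0" if "(i, j) \<in> T" for i j using \<omega>(1) that by (auto simp: A_def)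
    have "(\<Sum>(i, j)\<in>T. indicat_real {0} (X i \<omega> - X j \<omega>)) = 0"
      using ne by (intro sum.neutral) (auto simp: indicator_def)
    then have "integral\<^sup>L (sym_emp T X \<omega>) (indicat_real {0}) = 0"
      using T by (subst integral_sym_emp_even) (auto simp: indicator_def)
    moreover have "sets (sym_emp T X \<omega>) = sets borel" by (simp add: sym_emp_def)
    ultimately show False using \<omega>(2) by simp
  qed
  ultimately show ?thesis using A by (intro bexI[of _ A]) auto
qed

end

subsection \<open>Expansion of the estimators\<close>

lemma norm_mean_le:
  fixes v :: "'i \<Rightarrow> 'c::real_normed_vector"
  assumes "\<And>i. norm (v i) \<le> K" "0 \<le> K"
  shows "norm ((1 / real (card I)) *\<^sub>R (\<Sum>i\<in>I. v i)) \<le> K"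
proof -
  have "norm (\<Sum>i\<in>I. v i) \<le> real (card I) * K" using assms by (intro sum_norm_bound) auto
  then have "(1 / real (card I)) * norm (\<Sum>i\<in>I. v i) \<le> (1 / real (card I)) * (real (card I) * K)"
    by (intro mult_left_mono) auto
  also have "\<dots> \<le> K" using assms by simp
  finally show ?thesis by simp
qed

text \<open>\<open>J\<close> takes values in a general Euclidean space; symmetric matrices come in
  only when the covariances of \<open>G1\<close> and \<open>G2\<close> are matched.\<close>

locale pair_kernel = iid_sample M X P
  for M :: "'a measure" and X :: "nat \<Rightarrow> 'a \<Rightarrow> real^'q::finite" and P +
  fixes J :: "real^'q \<Rightarrow> 'b::euclidean_space" and B :: real
  assumes J_measurable [measurable]: "J \<in> borel_measurable borel"
    and J_bound: "\<And>y. norm (J y) \<le> B"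
    and J_even: "\<And>y. J (- y) = J y"
    and J_centered: "expectation (\<lambda>\<omega>. J (X 0 \<omega> - X 1 \<omega>)) = 0"
begin

definition H1 :: "real^'q \<Rightarrow> 'b" where "H1 x = (\<integral>y. J (x - y) \<partial>P)"
definition H2 :: "real^'q \<Rightarrow> real^'q \<Rightarrow> 'b" where "H2 x y = J (x - y) - H1 x - H1 y"

definition edge_mean :: "(nat \<times> nat) set \<Rightarrow> 'a \<Rightarrow> 'b" where
  "edge_mean T \<omega> = (1 / real (card T)) *\<^sub>R (\<Sum>(i, j)\<in>T. H2 (X i \<omega>) (X j \<omega>))"

lemma B_nonneg: "0 \<le> B"
  using J_bound[of 0] norm_ge_zero order_trans by blast

lemma J_integrable: "integrable P (\<lambda>y. J (x - y))"
proof -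
  interpret PP: prob_space P by (rule prob_space_P)
  show ?thesis using J_bound by (intro PP.integrable_const_bound[where B = B]) auto
qed

lemma J_X_integrable: "integrable M (\<lambda>\<omega>. J (X i \<omega> - X j \<omega>))"
  using J_bound by (intro integrable_const_bound[where B = B]) auto

lemma H1_measurable [measurable]: "H1 \<in> borel_measurable borel"
proof -
  interpret PP: prob_space P by (rule prob_space_P)
  show ?thesis unfolding H1_def [abs_def] by measurable
qed

lemma H2_measurable [measurable]: "case_prod H2 \<in> borel_measurable (borel \<Otimes>\<^sub>M borel)"
  unfolding H2_def [abs_def] split_beta' by measurable

lemma H1_bound: "norm (H1 x) \<le> B"
proof -
  interpret PP: prob_space P by (rule prob_space_P)
  have "(\<integral>y. norm (J (x - y)) \<partial>P) \<le> (\<integral>y. B \<partial>P)"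
    using J_integrable J_bound by (intro integral_mono) auto
  then show ?thesis
    unfolding H1_def using PP.prob_space by (intro order_trans[OF integral_norm_bound]) simp
qed

lemma H2_bound: "norm (H2 x y) \<le> 3 * B"
  using norm_triangle_ineq4[of "J (x - y) - H1 x" "H1 y"] norm_triangle_ineq4[of "J (x - y)" "H1 x"]
    J_bound[of "x - y"] H1_bound[of x] H1_bound[of y] unfolding H2_def by linarith

text \<open>Reduces the vector-valued kernel to scalar ones. The bound uses some \<open>c\<close>
  above \<open>norm A\<close> so that two directions can share one constant.\<close>

lemma even_kernel_inner:
  assumes "norm A \<le> c" shows "even_kernel (\<lambda>y. A \<bullet> J y) (c * B)"
  unfolding even_kernel_def
proof (intro conjI allI)
  fix y
  have "\<bar>A \<bullet> J y\<bar> \<le> norm A * norm (J y)" by (rule Cauchy_Schwarz_ineq2)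
  also have "\<dots> \<le> c * B" using assms J_bound[of y] order_trans[OF norm_ge_zero assms] by (intro mult_mono) auto
  finally show "\<bar>A \<bullet> J y\<bar> \<le> c * B" .
next
  show "expectation (\<lambda>\<omega>. A \<bullet> J (X 0 \<omega> - X 1 \<omega>)) = 0"
    using J_X_integrable J_centered by simp
qed (auto simp: J_even)

lemma proj1_inner: "proj1 (\<lambda>y. A \<bullet> J y) x = A \<bullet> H1 x"
  unfolding proj1_def H1_def using J_integrable by simp

lemma proj2_inner: "proj2 (\<lambda>y. A \<bullet> J y) x y = A \<bullet> H2 x y"
  unfolding proj2_def H2_def proj1_inner by (simp add: inner_diff_right)

text \<open>The Hoeffding identity is exact for every sample, so only the differentiability
  remainder stays to be estimated.\<close>

lemma integral_sym_emp_J: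
  assumes T: "regular_graph n T"
  shows "integral\<^sup>L (sym_emp T X \<omega>) J = 2 *\<^sub>R integral\<^sup>L (emp_P n X \<omega>) H1 + edge_mean T \<omega>"
proof -
  note TD = regular_graphD[OF T]
  have "integral\<^sup>L (sym_emp T X \<omega>) J = (1 / real (card T)) *\<^sub>R (\<Sum>(i, j)\<in>T. J (X i \<omega> - X j \<omega>))"
    using TD by (intro integral_sym_emp_even J_even) auto
  also have "(\<Sum>(i, j)\<in>T. J (X i \<omega> - X j \<omega>)) =
      (\<Sum>(i, j)\<in>T. H1 (X i \<omega>) + H1 (X j \<omega>)) + (\<Sum>(i, j)\<in>T. H2 (X i \<omega>) (X j \<omega>))"
    unfolding sum.distrib[symmetric] by (intro sum.cong) (auto simp: H2_def)
  finally show ?thesis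
    using regular_graph_sum[OF T, of "\<lambda>i. H1 (X i \<omega>)"]
    by (simp add: edge_mean_def scaleR_add_right integral_emp_P)
qed

lemma second_moment_components:
  fixes V :: "'a \<Rightarrow> 'b"
  assumes [measurable]: "V \<in> borel_measurable M" and bd: "\<And>\<omega>. norm (V \<omega>) \<le> K"
    and c: "\<And>b. b \<in> Basis \<Longrightarrow> expectation (\<lambda>\<omega>. (b \<bullet> V \<omega>)\<^sup>2) \<le> c"
  shows "expectation (\<lambda>\<omega>. (norm (V \<omega>))\<^sup>2) \<le> real DIM('b) * c"
proof -
  have i: "integrable M (\<lambda>\<omega>. (b \<bullet> V \<omega>)\<^sup>2)" if "b \<in> Basis" for b
  proof -
    have "norm (b \<bullet> V \<omega>) \<le> K" for \<omega>
      using Basis_le_norm[OF that, of "V \<omega>"] bd[of \<omega>] by (simp add: inner_commute)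
    then show ?thesis using bounded_square_integrable[of "\<lambda>\<omega>. b \<bullet> V \<omega>" K] by simp
  qed
  have "expectation (\<lambda>\<omega>. (norm (V \<omega>))\<^sup>2) = expectation (\<lambda>\<omega>. \<Sum>b\<in>Basis. (b \<bullet> V \<omega>)\<^sup>2)"
  proof -
    have "(norm v)\<^sup>2 = (\<Sum>b\<in>Basis. (b \<bullet> v)\<^sup>2)" for v :: 'b
      unfolding power2_norm_eq_inner by (subst euclidean_inner) (simp add: power2_eq_square inner_commute)
    then show ?thesis by simp
  qed
  also have "\<dots> = (\<Sum>b\<in>Basis. expectation (\<lambda>\<omega>. (b \<bullet> V \<omega>)\<^sup>2))" using i by simp
  also have "\<dots> \<le> (\<Sum>b\<in>(Basis :: 'b set). c)" by (intro sum_mono c)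
  finally show ?thesis by simp
qed

lemma edge_mean_measurable [measurable]: "edge_mean T \<in> borel_measurable M"
  unfolding edge_mean_def [abs_def] split_beta by measurable

lemma edge_mean_bound: "norm (edge_mean T \<omega>) \<le> 3 * B"
  unfolding edge_mean_def split_beta using B_nonneg by (intro norm_mean_le H2_bound) auto

lemma emp_P_H1_measurable [measurable]: "(\<lambda>\<omega>. integral\<^sup>L (emp_P n X \<omega>) H1) \<in> borel_measurable M"
  unfolding integral_emp_P[OF H1_measurable] by measurable

lemma emp_P_H1_bound: "norm (integral\<^sup>L (emp_P n X \<omega>) H1) \<le> B"
  unfolding integral_emp_P[OF H1_measurable]
  using norm_mean_le[of "\<lambda>i. H1 (X i \<omega>)" B "{..<n}"] H1_bound B_nonneg by simp

lemma edge_mean_second_moment: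
  assumes T: "finite T" "\<And>i j. (i, j) \<in> T \<Longrightarrow> i \<noteq> j \<and> (j, i) \<notin> T"
  shows "expectation (\<lambda>\<omega>. (norm (edge_mean T \<omega>))\<^sup>2) \<le> real DIM('b) * (9 * B\<^sup>2 / real (card T))"
proof (rule second_moment_components[OF _ edge_mean_bound])
  fix b :: 'b assume b: "b \<in> Basis"
  have "b \<bullet> edge_mean T \<omega> = 1 / real (card T) * (\<Sum>(i, j)\<in>T. proj2 (\<lambda>y. b \<bullet> J y) (X i \<omega>) (X j \<omega>))" for \<omega>
    by (simp add: edge_mean_def proj2_inner inner_sum_right split_beta)
  then show "expectation (\<lambda>\<omega>. (b \<bullet> edge_mean T \<omega>)\<^sup>2) \<le> 9 * B\<^sup>2 / real (card T)"
    using edge_sum_second_moment[OF even_kernel_inner[of b 1] T, of 0 0 1] b by simp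
qed simp

lemma emp_P_H1_second_moment: "expectation (\<lambda>\<omega>. (norm (integral\<^sup>L (emp_P n X \<omega>) H1))\<^sup>2) \<le> real DIM('b) * (9 * B\<^sup>2 / real n)"
proof (rule second_moment_components[OF _ emp_P_H1_bound])
  fix b :: 'b assume b: "b \<in> Basis"
  have "b \<bullet> integral\<^sup>L (emp_P n X \<omega>) H1 = 1 / real n * (\<Sum>i<n. proj1 (\<lambda>y. b \<bullet> J y) (X i \<omega>))" for \<omega>
    by (simp add: integral_emp_P proj1_inner inner_sum_right)
  then show "expectation (\<lambda>\<omega>. (b \<bullet> integral\<^sup>L (emp_P n X \<omega>) H1)\<^sup>2) \<le> 9 * B\<^sup>2 / real n"
    using edge_sum_second_moment[OF even_kernel_inner[of b 1], of "{}" 1 n 0] b by simp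
qed simp

lemma sym_emp_J_second_moment:
  assumes T: "regular_graph n T"
  shows "integrable M (\<lambda>\<omega>. (norm (integral\<^sup>L (sym_emp T X \<omega>) J))\<^sup>2)"
    and "expectation (\<lambda>\<omega>. (norm (integral\<^sup>L (sym_emp T X \<omega>) J))\<^sup>2) \<le> real DIM('b) * (45 * B\<^sup>2 / real n)"
proof -
  note TD = regular_graphD[OF T]
  have m [measurable]: "(\<lambda>\<omega>. integral\<^sup>L (sym_emp T X \<omega>) J) \<in> borel_measurable M"
    by (rule sym_emp_integral_measurable[OF J_measurable TD(2)])
  have bd: "norm (integral\<^sup>L (sym_emp T X \<omega>) J) \<le> B" for \<omega>
    by (rule norm_sym_emp_integral_le[OF J_measurable J_bound TD(2,3)])
  show "integrable M (\<lambda>\<omega>. (norm (integral\<^sup>L (sym_emp T X \<omega>) J))\<^sup>2)"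
    by (rule bounded_square_integrable[OF m bd])
  show "expectation (\<lambda>\<omega>. (norm (integral\<^sup>L (sym_emp T X \<omega>) J))\<^sup>2) \<le> real DIM('b) * (45 * B\<^sup>2 / real n)"
  proof (rule second_moment_components[OF m bd])
    fix b :: 'b assume b: "b \<in> Basis"
    have "b \<bullet> integral\<^sup>L (sym_emp T X \<omega>) J = integral\<^sup>L (sym_emp T X \<omega>) (\<lambda>y. b \<bullet> J y)" for \<omega>
    proof -
      have "integrable (sym_emp T X \<omega>) J"
        using J_bound by (intro integrable_bounded_prob_dist sym_emp_prob_dists TD) (auto simp: bounded_iff)
      then show ?thesis by simp
    qed
    then show "expectation (\<lambda>\<omega>. (b \<bullet> integral\<^sup>L (sym_emp T X \<omega>) J)\<^sup>2) \<le> 45 * B\<^sup>2 / real n"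
      using sym_emp_second_moment[OF even_kernel_inner[of b 1] T] b by simp
  qed
qed

text \<open>The second moment is of order \<open>1 / card T\<close>, hence negligible at scale
  \<open>1 / sqrt n\<close> when the edges outnumber \<open>n\<close> by a diverging factor. For
  fixed \<open>d\<close> the ratio stays \<open>1 / d\<close>, and the term survives in the
  limit.\<close>

lemma edge_mean_o_p:
  assumes T: "\<forall>\<^sub>F n in sequentially. regular_graph n (T n)"
    and lim: "(\<lambda>n. real n / real (card (T n))) \<longlonglongrightarrow> 0"
  shows "o_p M (\<lambda>n. edge_mean (T n)) (\<lambda>n. 1 / sqrt (real n))"
proof (rule o_p_of_second_moment)
  show "integrable M (\<lambda>\<omega>. (norm (edge_mean (T n) \<omega>))\<^sup>2)" for n
    by (rule bounded_square_integrable[OF _ edge_mean_bound]) simp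
  show "(\<lambda>n. real n * expectation (\<lambda>\<omega>. (norm (edge_mean (T n) \<omega>))\<^sup>2)) \<longlonglongrightarrow> 0"
  proof (rule Lim_null_comparison)
    show "(\<lambda>n. real DIM('b) * (9 * B\<^sup>2) * (real n / real (card (T n)))) \<longlonglongrightarrow> 0"
      using tendsto_mult_left[OF lim, of "real DIM('b) * (9 * B\<^sup>2)"] by simp
    show "\<forall>\<^sub>F n in sequentially. norm (real n * expectation (\<lambda>\<omega>. (norm (edge_mean (T n) \<omega>))\<^sup>2)) \<le>
        real DIM('b) * (9 * B\<^sup>2) * (real n / real (card (T n)))"
      using T
    proof eventually_elim
      case (elim n)
      have "real n * expectation (\<lambda>\<omega>. (norm (edge_mean (T n) \<omega>))\<^sup>2) \<le>
          real n * (real DIM('b) * (9 * B\<^sup>2 / real (card (T n))))"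
        by (intro mult_left_mono edge_mean_second_moment regular_graphD[OF elim]) auto
      then show ?case by (simp add: abs_mult mult_ac)
    qed
  qed
qed simp

text \<open>The neighbourhood estimate applies outside three events: mass at 0 (null when
  \<open>Q\<close> has none there), a test function off by \<open>\<delta>\<close> (weak law), and a
  \<open>J\<close>-integral beyond order \<open>1 / sqrt n\<close> (second moment). The relative
  error then becomes an absolute error at that scale.\<close>

lemma estimator_remainder_o_p:
  fixes Sig :: "(real^'q) measure \<Rightarrow> 'b"
  assumes Q: "Q = distr M borel (\<lambda>\<omega>. X 0 \<omega> - X 1 \<omega>)"
    and T: "\<forall>\<^sub>F n in sequentially. regular_graph n (T n)"
    and nbhd: "\<And>e. 0 < e \<Longrightarrow> \<exists>(Fs :: (real^'q \<Rightarrow> real) set) \<delta>. finite Fs \<and>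
     (\<forall>f\<in>Fs. continuous_on UNIV f \<and> bounded (range f)) \<and> 0 < \<delta> \<and>
     (\<forall>R\<in>prob_dists. (measure Q {0} = 0 \<longrightarrow> measure R {0} = 0) \<longrightarrow>
        (\<forall>f\<in>Fs. \<bar>integral\<^sup>L R f - integral\<^sup>L Q f\<bar> < \<delta>) \<longrightarrow>
        norm (Sig R - Sig Q - integral\<^sup>L R J) \<le> e * norm (integral\<^sup>L R J))"
  shows "o_p M (\<lambda>n \<omega>. Sig (sym_emp (T n) X \<omega>) - Sig Q - integral\<^sup>L (sym_emp (T n) X \<omega>) J)
     (\<lambda>n. 1 / sqrt (real n))"
  unfolding o_p_iff
proof (intro allI impI)
  fix e \<tau> :: real assume e: "0 < e" and \<tau>: "0 < \<tau>"
  define c where "c = real DIM('b) * (45 * B\<^sup>2)"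
  have c: "0 \<le> c" by (simp add: c_def)
  \<comment> \<open>The tail event of the \<open>J\<close>-integral has probability at most
    \<open>c * (e' / e)\<^sup>2\<close>; this choice makes it at most \<open>\<tau> / 2\<close>, and
    \<open>c + 1\<close> avoids division by 0.\<close>
  define e' where "e' = e * sqrt (\<tau> / 2 / (c + 1))"
  have e': "0 < e'" using e \<tau> c by (simp add: e'_def)
  have e'c: "c * (e' / e)\<^sup>2 \<le> \<tau> / 2"
  proof -
    have "(e' / e)\<^sup>2 = \<tau> / 2 / (c + 1)" using e \<tau> c by (simp add: e'_def)
    then have "c * (e' / e)\<^sup>2 = \<tau> / 2 * (c / (c + 1))" by simp
    also have "\<dots> \<le> \<tau> / 2 * 1" using \<tau> c by (intro mult_left_mono) auto
    finally show ?thesis by simp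
  qed
  obtain Fs :: "(real^'q \<Rightarrow> real) set" and \<delta> where Fs: "finite Fs"
      "\<forall>f\<in>Fs. continuous_on UNIV f \<and> bounded (range f)" and \<delta>: "0 < \<delta>"
    and good: "\<forall>R\<in>prob_dists. (measure Q {0} = 0 \<longrightarrow> measure R {0} = 0) \<longrightarrow>
        (\<forall>f\<in>Fs. \<bar>integral\<^sup>L R f - integral\<^sup>L Q f\<bar> < \<delta>) \<longrightarrow>
        norm (Sig R - Sig Q - integral\<^sup>L R J) \<le> e' * norm (integral\<^sup>L R J)"
    using nbhd[OF e'] by (elim exE conjE)
  have "\<forall>f\<in>Fs. \<exists>C. \<forall>y. \<bar>f y\<bar> \<le> C" using Fs(2) by (auto simp: bounded_iff)
  then obtain C where C: "\<And>f y. f \<in> Fs \<Longrightarrow> \<bar>f y\<bar> \<le> C f" by metis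
  define K where "K = (\<Sum>f\<in>Fs. 45 * (2 * C f)\<^sup>2 / \<delta>\<^sup>2)"
  have "(\<lambda>n. K / real n) \<longlonglongrightarrow> 0" by (rule lim_const_over_n)
  then have "\<forall>\<^sub>F n in sequentially. K / real n < \<tau> / 2" using \<tau> by (intro order_tendstoD) auto
  with T show "\<forall>\<^sub>F n in sequentially. \<exists>A\<in>events. {\<omega> \<in> space M. e * \<bar>1 / sqrt (real n)\<bar> <
      norm (Sig (sym_emp (T n) X \<omega>) - Sig Q - integral\<^sup>L (sym_emp (T n) X \<omega>) J)} \<subseteq> A \<and> prob A \<le> \<tau>"
  proof eventually_elim
    case (elim n)
    note TD = regular_graphD[OF elim(1)]
    let ?S = "\<lambda>\<omega>. sym_emp (T n) X \<omega>"
    have "\<exists>A0\<in>events. prob A0 = 0 \<and> (measure Q {0} = 0 \<longrightarrow> {\<omega> \<in> space M. measure (?S \<omega>) {0} \<noteq> 0} \<subseteq> A0)"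
    proof (cases "measure Q {0} = 0")
      case True
      then show ?thesis using sym_emp_no_mass_at_0[OF Q True TD(2,3)] TD(6) by blast
    next
      case False
      then show ?thesis by (intro bexI[of _ "{}"]) auto
    qed
    then obtain A0 where A0: "A0 \<in> events" "prob A0 = 0"
        "measure Q {0} = 0 \<Longrightarrow> {\<omega> \<in> space M. measure (?S \<omega>) {0} \<noteq> 0} \<subseteq> A0"
      by blast
    define Af where "Af f = {\<omega> \<in> space M. \<delta> \<le> \<bar>integral\<^sup>L (?S \<omega>) f - integral\<^sup>L Q f\<bar>}" for f
    define A1 where "A1 = (\<Union>f\<in>Fs. Af f)"
    define A2 where "A2 = {\<omega> \<in> space M. e / e' / sqrt (real n) \<le> norm (integral\<^sup>L (?S \<omega>) J)}"
    have Jm [measurable]: "(\<lambda>\<omega>. integral\<^sup>L (?S \<omega>) J) \<in> borel_measurable M"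
      by (rule sym_emp_integral_measurable[OF J_measurable TD(2)])
    have fm: "f \<in> borel_measurable borel" if "f \<in> Fs" for f
      using Fs(2) that by (auto intro: borel_measurable_continuous_onI)
    have Afe: "Af f \<in> events" if "f \<in> Fs" for f
    proof -
      have [measurable]: "(\<lambda>\<omega>. integral\<^sup>L (?S \<omega>) f) \<in> borel_measurable M"
        by (rule sym_emp_integral_measurable[OF fm[OF that] TD(2)])
      show ?thesis unfolding Af_def by measurable
    qed
    have A1: "A1 \<in> events" unfolding A1_def using Fs(1) Afe by (intro sets.finite_UN) auto
    have A2: "A2 \<in> events" unfolding A2_def by measurable
    have "prob A1 \<le> (\<Sum>f\<in>Fs. prob (Af f))"
      unfolding A1_def using Fs(1) Afe by (intro finite_measure_subadditive_finite) auto
    also have "\<dots> \<le> (\<Sum>f\<in>Fs. 45 * (2 * C f)\<^sup>2 / \<delta>\<^sup>2 / real n)"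
      unfolding Af_def by (intro sum_mono sym_emp_law_of_large_numbers[OF Q _ _ elim(1) \<delta>] fm C)
    also have "\<dots> = K / real n" by (simp add: K_def sum_divide_distrib)
    finally have p1: "prob A1 \<le> \<tau> / 2" using elim(2) by linarith
    have p2: "prob A2 \<le> \<tau> / 2"
    proof -
      have "prob A2 \<le> expectation (\<lambda>\<omega>. (norm (integral\<^sup>L (?S \<omega>) J))\<^sup>2) / (e / e' / sqrt (real n))\<^sup>2"
        unfolding A2_def using e e' TD(1)
        by (intro prob_norm_gt_le sym_emp_J_second_moment[OF elim(1)] Jm) auto
      also have "\<dots> \<le> c / real n / (e / e' / sqrt (real n))\<^sup>2"
        using sym_emp_J_second_moment(2)[OF elim(1)] by (intro divide_right_mono) (auto simp: c_def)
      also have "\<dots> = c * (e' / e)\<^sup>2" using TD(1) e e' by (simp add: power_divide power_mult_distrib)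
      finally show ?thesis using e'c by linarith
    qed
    have "prob (A0 \<union> A1 \<union> A2) \<le> \<tau>"
      using measure_Un_le[OF sets.Un[OF A0(1) A1] A2] measure_Un_le[OF A0(1) A1] A0(2) p1 p2 by linarith
    moreover have "\<omega> \<in> A0 \<union> A1 \<union> A2"
      if \<omega>: "\<omega> \<in> space M" "e * \<bar>1 / sqrt (real n)\<bar> < norm (Sig (?S \<omega>) - Sig Q - integral\<^sup>L (?S \<omega>) J)" for \<omega>
    proof (rule ccontr)
      assume no: "\<omega> \<notin> A0 \<union> A1 \<union> A2"
      have "?S \<omega> \<in> prob_dists" by (rule sym_emp_prob_dists[OF TD(2,3)])
      moreover have "measure Q {0} = 0 \<longrightarrow> measure (?S \<omega>) {0} = 0" using no A0(3) \<omega>(1) by blast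
      moreover have "\<forall>f\<in>Fs. \<bar>integral\<^sup>L (?S \<omega>) f - integral\<^sup>L Q f\<bar> < \<delta>"
        using no \<omega>(1) by (auto simp: A1_def Af_def not_le)
      ultimately have "norm (Sig (?S \<omega>) - Sig Q - integral\<^sup>L (?S \<omega>) J) \<le> e' * norm (integral\<^sup>L (?S \<omega>) J)"
        using good by blast
      also have "\<dots> \<le> e' * (e / e' / sqrt (real n))"
        using no \<omega>(1) e' by (intro mult_left_mono) (auto simp: A2_def not_le)
      also have "\<dots> = e * \<bar>1 / sqrt (real n)\<bar>" using e' by simp
      finally show False using \<omega>(2) by linarith
    qed
    ultimately show ?case using A0(1) A1 A2 by (intro bexI[of _ "A0 \<union> A1 \<union> A2"]) auto
  qed
qed

text \<open>Cramer-Wold: the inner product with \<open>t\<close> is a normalised sum of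
  \<open>xi\<close>, with \<open>h\<close> from the direction \<open>fst t\<close> and
  \<open>g\<close> from \<open>snd t\<close>. Vertex and edge terms being orthogonal, the limiting
  variance has no mixed term, which is the source of the independence of the two limits.\<close>

lemma joint_char_tendsto:
  assumes d: "1 \<le> d"
  shows "(\<lambda>n. expectation (\<lambda>\<omega>. iexp (t \<bullet> (sqrt (real n) *\<^sub>R integral\<^sup>L (emp_P n X \<omega>) H1,
            sqrt (real n * real d) *\<^sub>R edge_mean (cyclic_edges n d {..<n}) \<omega>)))) \<longlonglongrightarrow>
     of_real (exp (- (expectation (\<lambda>\<omega>. (fst t \<bullet> H1 (X 0 \<omega>))\<^sup>2) +
        expectation (\<lambda>\<omega>. (snd t \<bullet> H2 (X 0 \<omega>) (X 1 \<omega>))\<^sup>2)) / 2))"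
proof -
  define c where "c = max (norm (fst t)) (norm (snd t))"
  interpret hoeffding_pair M X P "proj1 (\<lambda>y. fst t \<bullet> J y)" "proj2 (\<lambda>y. snd t \<bullet> J y)" "3 * (c * B)"
    by (intro hoeffding_pair_kernels even_kernel_inner) (auto simp: c_def)
  have "(\<Sum>i<n. xi n d i \<omega>) / sqrt (real n) = t \<bullet> (sqrt (real n) *\<^sub>R integral\<^sup>L (emp_P n X \<omega>) H1,
            sqrt (real n * real d) *\<^sub>R edge_mean (cyclic_edges n d {..<n}) \<omega>)" if n: "2 * d + 1 \<le> n" for n \<omega>
  proof -
    have sq: "sqrt (real n) * (1 / real n) = 1 / sqrt (real n)"
      "sqrt (real n * real d) * (1 / (real n * real d)) = 1 / sqrt (real d) / sqrt (real n)"
      using n d by (auto simp: real_sqrt_mult field_simps)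
    have "fst t \<bullet> (sqrt (real n) *\<^sub>R integral\<^sup>L (emp_P n X \<omega>) H1) =
        (sqrt (real n) * (1 / real n)) * (\<Sum>i<n. fst t \<bullet> H1 (X i \<omega>))"
      by (simp add: integral_emp_P inner_sum_right)
    moreover have "snd t \<bullet> (sqrt (real n * real d) *\<^sub>R edge_mean (cyclic_edges n d {..<n}) \<omega>) =
        (sqrt (real n * real d) * (1 / (real n * real d))) *
          (\<Sum>i<n. \<Sum>k\<in>{1..d}. snd t \<bullet> H2 (X i \<omega>) (X ((i + k) mod n) \<omega>))"
      unfolding edge_mean_def sum_cyclic_edges[OF order_refl n]
      using card_cyclic_edges[OF order_refl n] by (simp add: inner_sum_right)
    ultimately show ?thesis
      unfolding sq inner_prod_def fst_conv snd_conv xi_def proj1_inner proj2_inner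
      by (simp add: sum.distrib add_divide_distrib sum_distrib_left sum_divide_distrib)
  qed
  then have "\<forall>\<^sub>F n in sequentially. expectation (\<lambda>\<omega>. iexp ((\<Sum>i<n. xi n d i \<omega>) / sqrt (real n))) =
      expectation (\<lambda>\<omega>. iexp (t \<bullet> (sqrt (real n) *\<^sub>R integral\<^sup>L (emp_P n X \<omega>) H1,
            sqrt (real n * real d) *\<^sub>R edge_mean (cyclic_edges n d {..<n}) \<omega>)))"
    by (intro eventually_sequentiallyI[of "2 * d + 1"]) simp
  from Lim_transform_eventually[OF char_cyclic_sum_tendsto[OF d] this]
  show ?thesis by (simp add: h_var_def g_var_def proj1_inner proj2_inner)
qed

end

section \<open>Symmetric matrices and the Gaussian pair\<close>

lemma frob_eq_inner: "frob A C = A \<bullet> C"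
  unfolding frob_def trace_def matrix_matrix_mult_def transpose_def
  by (simp add: inner_vec_def) (rule sum.swap)

text \<open>The covariance conditions are given for symmetric \<open>A\<close>, whereas
  characteristic functions test all matrices; against symmetric values a matrix acts only through
  its symmetric part.\<close>

definition sym_part :: "real^'q^'q::finite \<Rightarrow> real^'q^'q" where
  "sym_part A = (1 / 2) *\<^sub>R (A + transpose A)"

lemma sym_mat_sym_part: "sym_mat (sym_part A)"
  by (simp add: sym_mat_def sym_part_def transpose_def vec_eq_iff)

lemma inner_transpose: "transpose A \<bullet> transpose C = A \<bullet> C"
  unfolding inner_vec_def transpose_def by simp (rule sum.swap)

lemma sym_part_inner: "sym_mat S \<Longrightarrow> sym_part A \<bullet> S = A \<bullet> S"
  using inner_transpose[of A S] by (simp add: sym_part_def inner_add_left sym_mat_def)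

lemma gauss_sym_mat_inner:
  assumes "gauss_sym_mat N G" shows "centered_normal N (\<lambda>\<omega>. A \<bullet> G \<omega>)"
  using assms by (simp add: gauss_sym_mat_def frob_eq_inner)

text \<open>Normality is given projection by projection for each matrix; independence multiplies the
  two characteristic functions into the joint one.\<close>

lemma gauss_pair_moments:
  fixes G1 G2 :: "'b \<Rightarrow> real^'q^'q::finite"
  assumes N: "prob_space N" and G: "gauss_sym_mat N G1" "gauss_sym_mat N G2"
    and ind: "prob_space.indep_var N borel G1 borel G2"
  shows "integrable N (\<lambda>\<omega>. (norm (G1 \<omega>, G2 \<omega>))\<^sup>2)"
    and "(\<integral>\<omega>. iexp (t \<bullet> (G1 \<omega>, G2 \<omega>)) \<partial>N) =
      of_real (exp (- ((\<integral>\<omega>. (fst t \<bullet> G1 \<omega>)\<^sup>2 \<partial>N) + (\<integral>\<omega>. (snd t \<bullet> G2 \<omega>)\<^sup>2 \<partial>N)) / 2))"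
proof -
  interpret N: prob_space N by fact
  have m [measurable]: "G1 \<in> borel_measurable N" "G2 \<in> borel_measurable N"
    using G by (auto simp: gauss_sym_mat_def)
  have sq: "integrable N (\<lambda>\<omega>. (norm (G \<omega>))\<^sup>2)" if "gauss_sym_mat N G" for G :: "'b \<Rightarrow> real^'q^'q"
  proof -
    have "(norm v)\<^sup>2 = (\<Sum>b\<in>Basis. (b \<bullet> v)\<^sup>2)" for v :: "real^'q^'q"
      unfolding power2_norm_eq_inner by (subst euclidean_inner) (simp add: power2_eq_square inner_commute)
    then show ?thesis
      using N.centered_normal_moments(1)[OF gauss_sym_mat_inner[OF that]] by simp
  qed
  show "integrable N (\<lambda>\<omega>. (norm (G1 \<omega>, G2 \<omega>))\<^sup>2)"
    using sq[OF G(1)] sq[OF G(2)] by (simp add: norm_Pair)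
  have "N.indep_var borel ((\<lambda>x. iexp (fst t \<bullet> x)) \<circ> G1) borel ((\<lambda>x. iexp (snd t \<bullet> x)) \<circ> G2)"
    using ind by (rule N.indep_var_compose) measurable
  then have i: "N.indep_var borel (\<lambda>\<omega>. iexp (fst t \<bullet> G1 \<omega>)) borel (\<lambda>\<omega>. iexp (snd t \<bullet> G2 \<omega>))"
    by (simp add: o_def)
  have "(\<integral>\<omega>. iexp (t \<bullet> (G1 \<omega>, G2 \<omega>)) \<partial>N) = (\<integral>\<omega>. iexp (fst t \<bullet> G1 \<omega>) * iexp (snd t \<bullet> G2 \<omega>) \<partial>N)"
    by (simp add: inner_prod_def distrib_left exp_add)
  also have "\<dots> = (\<integral>\<omega>. iexp (fst t \<bullet> G1 \<omega>) \<partial>N) * (\<integral>\<omega>. iexp (snd t \<bullet> G2 \<omega>) \<partial>N)"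
    by (rule N.indep_var_lebesgue_integral[OF i]) (auto intro!: N.integrable_const_bound[where B = 1])
  also have "\<dots> = of_real (exp (- (\<integral>\<omega>. (fst t \<bullet> G1 \<omega>)\<^sup>2 \<partial>N) / 2)) * of_real (exp (- (\<integral>\<omega>. (snd t \<bullet> G2 \<omega>)\<^sup>2 \<partial>N) / 2))"
    by (simp only: N.centered_normal_moments(2)[OF gauss_sym_mat_inner[OF G(1)]]
        N.centered_normal_moments(2)[OF gauss_sym_mat_inner[OF G(2)]])
  also have "\<dots> = of_real (exp (- ((\<integral>\<omega>. (fst t \<bullet> G1 \<omega>)\<^sup>2 \<partial>N) + (\<integral>\<omega>. (snd t \<bullet> G2 \<omega>)\<^sup>2 \<partial>N)) / 2))"
    by (simp add: add_divide_distrib diff_divide_distrib flip: of_real_mult exp_add)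
  finally show "(\<integral>\<omega>. iexp (t \<bullet> (G1 \<omega>, G2 \<omega>)) \<partial>N) =
      of_real (exp (- ((\<integral>\<omega>. (fst t \<bullet> G1 \<omega>)\<^sup>2 \<partial>N) + (\<integral>\<omega>. (snd t \<bullet> G2 \<omega>)\<^sup>2 \<partial>N)) / 2))" .
qed

section \<open>Limits of linear images of the joint statistic\<close>

context pair_kernel
begin

definition joint_stat :: "nat \<Rightarrow> nat \<Rightarrow> 'a \<Rightarrow> 'b \<times> 'b" where
  "joint_stat d n \<omega> = (sqrt (real n) *\<^sub>R integral\<^sup>L (emp_P n X \<omega>) H1,
     sqrt (real n * real d) *\<^sub>R edge_mean (cyclic_edges n d {..<n}) \<omega>)"

lemma joint_stat_measurable [measurable]: "joint_stat d n \<in> borel_measurable M"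
  unfolding joint_stat_def [abs_def] by measurable

lemma norm_joint_stat:
  "(norm (joint_stat d n \<omega>))\<^sup>2 = real n * (norm (integral\<^sup>L (emp_P n X \<omega>) H1))\<^sup>2 +
     real n * real d * (norm (edge_mean (cyclic_edges n d {..<n}) \<omega>))\<^sup>2"
  by (simp add: joint_stat_def norm_Pair power_mult_distrib)

lemma joint_stat_square_integrable: "integrable M (\<lambda>\<omega>. (norm (joint_stat d n \<omega>))\<^sup>2)"
  unfolding norm_joint_stat
  using bounded_square_integrable[OF emp_P_H1_measurable emp_P_H1_bound]
    bounded_square_integrable[OF edge_mean_measurable edge_mean_bound] by simp

lemma joint_stat_second_moment:
  assumes d: "1 \<le> d" "2 * d + 1 \<le> n"
  shows "expectation (\<lambda>\<omega>. (norm (joint_stat d n \<omega>))\<^sup>2) \<le> 18 * real DIM('b) * B\<^sup>2"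
proof -
  let ?E = "cyclic_edges n d {..<n}"
  have n: "0 < n" using d by simp
  note TD = regular_graphD[OF regular_graph_cyclic_edges[OF d]]
  have "expectation (\<lambda>\<omega>. (norm (joint_stat d n \<omega>))\<^sup>2) =
      real n * expectation (\<lambda>\<omega>. (norm (integral\<^sup>L (emp_P n X \<omega>) H1))\<^sup>2) +
      real n * real d * expectation (\<lambda>\<omega>. (norm (edge_mean ?E \<omega>))\<^sup>2)"
    unfolding norm_joint_stat
    using bounded_square_integrable[OF emp_P_H1_measurable emp_P_H1_bound]
      bounded_square_integrable[OF edge_mean_measurable edge_mean_bound] by simp
  also have "\<dots> \<le> real n * (real DIM('b) * (9 * B\<^sup>2 / real n)) +
      real n * real d * (real DIM('b) * (9 * B\<^sup>2 / real (card ?E)))"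
    by (intro add_mono mult_left_mono emp_P_H1_second_moment edge_mean_second_moment TD) auto
  \<comment> \<open>The scalings cancel \<open>n\<close> and the edge number \<open>n * d\<close>,
    leaving 9 for each component.\<close>
  also have "\<dots> = 18 * real DIM('b) * B\<^sup>2"
    using n d card_cyclic_edges[OF order_refl d(2)] by simp
  finally show ?thesis .
qed

text \<open>The common source of all distributional limits: \<open>L\<close> is the identity for the
  joint limit, twice the first component for the complete graph or growing \<open>d\<close>, and
  that plus a multiple of the second component for fixed \<open>d\<close>. The perturbation absorbs
  the estimator.\<close>

lemma conv_dist_linear_joint_stat:
  fixes L :: "'b \<times> 'b \<Rightarrow> 'c::euclidean_space" and G1 G2 :: "'n \<Rightarrow> 'b"
  assumes N: "prob_space N" and m [measurable]: "G1 \<in> borel_measurable N" "G2 \<in> borel_measurable N"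
    and Z2: "integrable N (\<lambda>\<omega>. (norm (G1 \<omega>, G2 \<omega>))\<^sup>2)"
    and char: "\<And>t. (\<integral>\<omega>. iexp (t \<bullet> (G1 \<omega>, G2 \<omega>)) \<partial>N) =
      of_real (exp (- (expectation (\<lambda>\<omega>. (fst t \<bullet> H1 (X 0 \<omega>))\<^sup>2) +
        expectation (\<lambda>\<omega>. (snd t \<bullet> H2 (X 0 \<omega>) (X 1 \<omega>))\<^sup>2)) / 2))"
    and d: "1 \<le> d" and L: "bounded_linear L"
    and pert: "o_p M (\<lambda>n \<omega>. Y n \<omega> - L (joint_stat d n \<omega>)) (\<lambda>_. 1)"
  shows "conv_dist M Y N (\<lambda>\<omega>. L (G1 \<omega>, G2 \<omega>))"
proof -
  interpret L: bounded_linear L by fact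
  obtain K where K: "0 < K" "\<And>x. norm (L x) \<le> norm x * K" using L.pos_bounded by blast
  have Lc: "continuous_on UNIV L" by (rule linear_continuous_on[OF L])
  have Lm [measurable]: "L \<in> borel_measurable borel" by (rule borel_measurable_continuous_onI[OF Lc])
  have L2: "(norm (L x))\<^sup>2 \<le> K\<^sup>2 * (norm x)\<^sup>2" for x
    using power_mono[OF K(2)[of x], of 2] by (simp add: power_mult_distrib mult.commute)
  have Li: "integrable M (\<lambda>\<omega>. (norm (L (joint_stat d n \<omega>)))\<^sup>2)" for n
  proof (rule Bochner_Integration.integrable_bound)
    show "integrable M (\<lambda>\<omega>. K\<^sup>2 * (norm (joint_stat d n \<omega>))\<^sup>2)"
      by (intro integrable_mult_right joint_stat_square_integrable)
    have "(\<lambda>\<omega>. L (joint_stat d n \<omega>)) \<in> borel_measurable M"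
      by (rule measurable_compose[OF joint_stat_measurable Lm])
    then show "(\<lambda>\<omega>. (norm (L (joint_stat d n \<omega>)))\<^sup>2) \<in> borel_measurable M"
      by (intro borel_measurable_power measurable_compose[OF _ borel_measurable_norm])
    show "AE \<omega> in M. norm ((norm (L (joint_stat d n \<omega>)))\<^sup>2) \<le> norm (K\<^sup>2 * (norm (joint_stat d n \<omega>))\<^sup>2)"
      by (rule AE_I2) (metis L2 abs_ge_self abs_power2 order_trans real_norm_def)
  qed
  have ev: "\<forall>\<^sub>F n in sequentially. expectation (\<lambda>\<omega>. (norm (joint_stat d n \<omega>))\<^sup>2) \<le> 18 * real DIM('b) * B\<^sup>2"
    using joint_stat_second_moment[OF d] by (intro eventually_sequentiallyI[of "2 * d + 1"])
  have lim: "(\<lambda>n. \<integral>\<omega>. f (joint_stat d n \<omega>) \<partial>M) \<longlonglongrightarrow> (\<integral>\<omega>. f (G1 \<omega>, G2 \<omega>) \<partial>N)"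
    if "continuous_on UNIV f" "bounded (range f)" for f :: "'b \<times> 'b \<Rightarrow> real"
  proof (rule integral_tendsto_of_char[OF prob_space_axioms N _ _ joint_stat_square_integrable ev Z2 _ that])
    show "(\<lambda>n. \<integral>\<omega>. iexp (t \<bullet> joint_stat d n \<omega>) \<partial>M) \<longlonglongrightarrow> (\<integral>\<omega>. iexp (t \<bullet> (G1 \<omega>, G2 \<omega>)) \<partial>N)" for t
      unfolding char joint_stat_def by (rule joint_char_tendsto[OF d])
  qed measurable
  show ?thesis
  proof (rule conv_dist_perturb[OF _ Li _ _ pert])
    show "\<forall>\<^sub>F n in sequentially. expectation (\<lambda>\<omega>. (norm (L (joint_stat d n \<omega>)))\<^sup>2) \<le> K\<^sup>2 * (18 * real DIM('b) * B\<^sup>2)"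
      using ev
    proof eventually_elim
      case (elim n)
      have "expectation (\<lambda>\<omega>. (norm (L (joint_stat d n \<omega>)))\<^sup>2) \<le> expectation (\<lambda>\<omega>. K\<^sup>2 * (norm (joint_stat d n \<omega>))\<^sup>2)"
        using L2 Li joint_stat_square_integrable by (intro integral_mono) auto
      also have "\<dots> = K\<^sup>2 * expectation (\<lambda>\<omega>. (norm (joint_stat d n \<omega>))\<^sup>2)" by simp
      also have "\<dots> \<le> K\<^sup>2 * (18 * real DIM('b) * B\<^sup>2)" using elim by (intro mult_left_mono) auto
      finally show ?case .
    qed
    fix f :: "'c \<Rightarrow> real" assume f: "continuous_on UNIV f" "bounded (range f)"
    have "continuous_on UNIV (f \<circ> L)" by (intro continuous_on_compose Lc continuous_on_subset[OF f(1)]) auto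
    moreover have "bounded (range (f \<circ> L))" using f(2) by (rule bounded_subset) auto
    ultimately show "(\<lambda>n. \<integral>\<omega>. f (L (joint_stat d n \<omega>)) \<partial>M) \<longlonglongrightarrow> (\<integral>\<omega>. f (L (G1 \<omega>, G2 \<omega>)) \<partial>N)"
      using lim[of "f \<circ> L"] by simp
  qed measurable
qed

end

theorem theorem1:
  fixes M :: "'a measure" and X :: "nat \<Rightarrow> 'a \<Rightarrow> real^'q::finite"
    and P :: "(real^'q) measure"
    and \<Q> :: "(real^'q) measure set" and Sig :: "(real^'q) measure \<Rightarrow> real^'q^'q"
    and J :: "real^'q \<Rightarrow> real^'q^'q"
    and N :: "'b measure" and G1 G2 :: "'b \<Rightarrow> real^'q^'q"
    and H1 :: "real^'q \<Rightarrow> real^'q^'q" and H2 :: "real^'q \<Rightarrow> real^'q \<Rightarrow> real^'q^'q"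
  assumes M: "prob_space M"
    and iid: "prob_space.indep_vars M (\<lambda>_. borel) X UNIV" "\<And>i. distr M borel (X i) = P"
    and Qdef: "Q = distr M borel (\<lambda>\<omega>. X 0 \<omega> - X 1 \<omega>)"
    and cases: "(case_a \<Q> Sig \<and> is_deriv \<Q> Sig Q J)
             \<or> ((\<forall>x. measure P {x} = 0) \<and> \<Q> = tyler_dom \<and> Sig = tyler_fun \<and>
                is_deriv \<Q> Sig Q J \<and> continuous_on (- {0}) J \<and> J 0 = 0)"
    and QinQ: "Q \<in> \<Q>"
    and H1_def: "\<And>x. H1 x = (\<integral>\<omega>. J (x - X 0 \<omega>) \<partial>M)"
    and H2_def: "\<And>x y. H2 x y = J (x - y) - H1 x - H1 y"
    and N: "prob_space N"
    and G: "gauss_sym_mat N G1" "gauss_sym_mat N G2" "prob_space.indep_var N borel G1 borel G2"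
    and cov1: "\<And>A. sym_mat A \<Longrightarrow>
       (\<integral>\<omega>. (frob A (G1 \<omega>))\<^sup>2 \<partial>N) = (\<integral>\<omega>. (frob A (H1 (X 0 \<omega>)))\<^sup>2 \<partial>M)"
    and cov2: "\<And>A. sym_mat A \<Longrightarrow>
       (\<integral>\<omega>. (frob A (G2 \<omega>))\<^sup>2 \<partial>N) = (\<integral>\<omega>. (frob A (H2 (X 0 \<omega>) (X 1 \<omega>)))\<^sup>2 \<partial>M)"
  defines "Mnd \<equiv> (\<lambda>d n \<omega>. (1 / (real n * real d)) *\<^sub>R
              (\<Sum>i<n. \<Sum>k\<in>{1..d}. H2 (X i \<omega>) (X ((i + k) mod n) \<omega>)))"
  shows
    \<comment> \<open>(i)\<close>
    "(\<forall>d :: nat \<Rightarrow> nat. (\<forall>n\<ge>3. 1 \<le> d n \<and> 2 * d n + 1 \<le> n) \<and> filterlim d at_top sequentially \<longrightarrow>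
        o_p M (\<lambda>n \<omega>. est \<Q> Sig (emp_Q n X \<omega>) - Sig Q - 2 *\<^sub>R integral\<^sup>L (emp_P n X \<omega>) H1)
              (\<lambda>n. 1 / sqrt (real n)) \<and>
        o_p M (\<lambda>n \<omega>. est \<Q> Sig (emp_Qd n (d n) X \<omega>) - Sig Q - 2 *\<^sub>R integral\<^sup>L (emp_P n X \<omega>) H1)
              (\<lambda>n. 1 / sqrt (real n)))
     \<and> \<comment> \<open>(ii)\<close>
     (\<forall>d::nat. 1 \<le> d \<longrightarrow>
        o_p M (\<lambda>n \<omega>. est \<Q> Sig (emp_Qd n d X \<omega>) - est \<Q> Sig (emp_Q n X \<omega>) - Mnd d n \<omega>)
              (\<lambda>n. 1 / sqrt (real n)))
     \<and> \<comment> \<open>(iii)\<close>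
     (\<forall>d::nat. 1 \<le> d \<longrightarrow>
        conv_dist M (\<lambda>n \<omega>. (sqrt (real n) *\<^sub>R integral\<^sup>L (emp_P n X \<omega>) H1,
                              sqrt (real n * real d) *\<^sub>R Mnd d n \<omega>))
                  N (\<lambda>\<omega>. (G1 \<omega>, G2 \<omega>)))
     \<and> \<comment> \<open>(iv)\<close>
     (\<forall>d :: nat \<Rightarrow> nat. (\<forall>n\<ge>3. 1 \<le> d n \<and> 2 * d n + 1 \<le> n) \<and> filterlim d at_top sequentially \<longrightarrow>
        conv_dist M (\<lambda>n \<omega>. sqrt (real n) *\<^sub>R (est \<Q> Sig (emp_Q n X \<omega>) - Sig Q)) N (\<lambda>\<omega>. 2 *\<^sub>R G1 \<omega>) \<and>
        conv_dist M (\<lambda>n \<omega>. sqrt (real n) *\<^sub>R (est \<Q> Sig (emp_Qd n (d n) X \<omega>) - Sig Q)) N (\<lambda>\<omega>. 2 *\<^sub>R G1 \<omega>))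
     \<and>
     (\<forall>d::nat. 1 \<le> d \<longrightarrow>
        conv_dist M (\<lambda>n \<omega>. sqrt (real n) *\<^sub>R (est \<Q> Sig (emp_Qd n d X \<omega>) - Sig Q))
                  N (\<lambda>\<omega>. 2 *\<^sub>R G1 \<omega> + (1 / sqrt (real d)) *\<^sub>R G2 \<omega>))"
proof -
  have dom: "case_a \<Q> Sig \<or> \<Q> = tyler_dom" and deriv: "is_deriv \<Q> Sig Q J" using cases by auto
  interpret iid_sample M X P
    by (intro iid_sample.intro iid_sample_axioms.intro M iid)
  have Jm [measurable]: "J \<in> borel_measurable borel" and Jeven: "\<And>y. J (- y) = J y"
    and Jsym: "\<And>y. sym_mat (J y)" and JQ: "integral\<^sup>L Q J = 0" and Jb: "bounded (range J)"
    using deriv by (auto simp: is_deriv_def)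
  obtain B where B: "\<And>y. norm (J y) \<le> B" using Jb by (auto simp: bounded_iff)
  interpret K: pair_kernel M X P J B
  proof
    have "expectation (\<lambda>\<omega>. J (X 0 \<omega> - X 1 \<omega>)) = integral\<^sup>L Q J"
      unfolding Qdef by (rule integral_distr[symmetric]) measurable
    then show "expectation (\<lambda>\<omega>. J (X 0 \<omega> - X 1 \<omega>)) = 0" using JQ by simp
  qed (fact Jm B Jeven)+
  have H1: "H1 = K.H1"
    by (rule ext, unfold H1_def K.H1_def, rule integral_X) measurable
  have H2: "H2 = K.H2"
    by (intro ext) (simp only: H2_def K.H2_def H1)
  have H1sym: "sym_mat (K.H1 x)" for x
  proof -
    have "linear (transpose :: real^'q^'q \<Rightarrow> real^'q^'q)"
      by (rule linearI) (simp_all add: transpose_def vec_eq_iff)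
    then have "transpose (integral\<^sup>L P (\<lambda>y. J (x - y))) = (\<integral>y. transpose (J (x - y)) \<partial>P)"
      by (intro integral_bounded_linear[symmetric] K.J_integrable) (simp add: linear_conv_bounded_linear)
    then show ?thesis using Jsym by (simp add: K.H1_def sym_mat_def)
  qed
  have H2sym: "sym_mat (K.H2 x y)" for x y
    using H1sym[of x] H1sym[of y] Jsym[of "x - y"]
    by (simp add: K.H2_def sym_mat_def transpose_def vec_eq_iff)
  have estQ: "est \<Q> Sig Q = Sig Q" using QinQ by (simp add: est_def)
  \<comment> \<open>The expansion is proved for \<open>est\<close> itself: membership in
    \<open>\<Q>\<close> is guaranteed on the neighbourhood, so the default value never occurs
    there.\<close>
  have rem: "o_p M (\<lambda>n \<omega>. est \<Q> Sig (sym_emp (T n) X \<omega>) - Sig Q - integral\<^sup>L (sym_emp (T n) X \<omega>) J)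
     (\<lambda>n. 1 / sqrt (real n))" if T: "\<forall>\<^sub>F n in sequentially. regular_graph n (T n)" for T
  proof -
    have "o_p M (\<lambda>n \<omega>. est \<Q> Sig (sym_emp (T n) X \<omega>) - est \<Q> Sig Q - integral\<^sup>L (sym_emp (T n) X \<omega>) J)
       (\<lambda>n. 1 / sqrt (real n))"
    proof (rule K.estimator_remainder_o_p[OF Qdef T])
      fix e :: real assume "0 < e"
      obtain Fs :: "(real^'q \<Rightarrow> real) set" and \<delta> where Fs: "finite Fs"
        "\<forall>f\<in>Fs. continuous_on UNIV f \<and> bounded (range f)" "0 < \<delta>"
        and good: "\<forall>R\<in>prob_dists. (measure Q {0} = 0 \<longrightarrow> measure R {0} = 0) \<longrightarrow>
        (\<forall>f\<in>Fs. \<bar>integral\<^sup>L R f - integral\<^sup>L Q f\<bar> < \<delta>) \<longrightarrow>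
        R \<in> \<Q> \<and> norm (Sig R - Sig Q - integral\<^sup>L R J) \<le> e * norm (integral\<^sup>L R J)"
        using estimator_neighbourhood[OF dom QinQ deriv \<open>0 < e\<close>] by (elim exE conjE)
      show "\<exists>(Fs :: (real^'q \<Rightarrow> real) set) \<delta>. finite Fs \<and>
         (\<forall>f\<in>Fs. continuous_on UNIV f \<and> bounded (range f)) \<and> 0 < \<delta> \<and>
         (\<forall>R\<in>prob_dists. (measure Q {0} = 0 \<longrightarrow> measure R {0} = 0) \<longrightarrow>
            (\<forall>f\<in>Fs. \<bar>integral\<^sup>L R f - integral\<^sup>L Q f\<bar> < \<delta>) \<longrightarrow>
            norm (est \<Q> Sig R - est \<Q> Sig Q - integral\<^sup>L R J) \<le> e * norm (integral\<^sup>L R J))"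
      proof (rule exI[of _ Fs], rule exI[of _ \<delta>], intro conjI)
        show "\<forall>R\<in>prob_dists. (measure Q {0} = 0 \<longrightarrow> measure R {0} = 0) \<longrightarrow>
            (\<forall>f\<in>Fs. \<bar>integral\<^sup>L R f - integral\<^sup>L Q f\<bar> < \<delta>) \<longrightarrow>
            norm (est \<Q> Sig R - est \<Q> Sig Q - integral\<^sup>L R J) \<le> e * norm (integral\<^sup>L R J)"
          unfolding estQ using good by (simp add: est_def)
      qed (use Fs in auto)
    qed
    then show ?thesis by (simp only: estQ)
  qed
  have regQ: "\<forall>\<^sub>F n in sequentially. regular_graph n (ordered_pairs n)"
    using regular_graph_ordered_pairs by (intro eventually_sequentiallyI[of 3])
  have regQd: "\<forall>\<^sub>F n in sequentially. regular_graph n (cyclic_edges n (d n) {..<n})"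
    if "\<forall>\<^sub>F n in sequentially. 1 \<le> d n \<and> 2 * d n + 1 \<le> n" for d :: "nat \<Rightarrow> nat"
    using that by eventually_elim (rule regular_graph_cyclic_edges; simp)
  have limQ: "(\<lambda>n. real n / real (card (ordered_pairs n))) \<longlonglongrightarrow> 0"
  proof -
    have "(\<lambda>n. 2 / (real (Suc n) - 1)) \<longlonglongrightarrow> 0" using lim_const_over_n[of "2::real"] by simp
    then have "(\<lambda>n. 2 / (real n - 1)) \<longlonglongrightarrow> 0" by (rule LIMSEQ_imp_Suc)
    moreover have "\<forall>\<^sub>F n in sequentially. 2 / (real n - 1) = real n / real (card (ordered_pairs n))"
      unfolding card_ordered_pairs by (intro eventually_sequentiallyI[of 2]) (simp add: field_simps)
    ultimately show ?thesis by (rule Lim_transform_eventually)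
  qed
  have limQd: "(\<lambda>n. real n / real (card (cyclic_edges n (d n) {..<n}))) \<longlonglongrightarrow> 0"
    if d: "\<forall>\<^sub>F n in sequentially. 1 \<le> d n \<and> 2 * d n + 1 \<le> n" "filterlim d at_top sequentially" for d :: "nat \<Rightarrow> nat"
  proof -
    have "(\<lambda>n. 1 / real (d n)) \<longlonglongrightarrow> 0"
      using filterlim_compose[OF lim_1_over_n d(2)] by simp
    moreover have "\<forall>\<^sub>F n in sequentially. 1 / real (d n) = real n / real (card (cyclic_edges n (d n) {..<n}))"
      using d(1)
    proof eventually_elim
      case (elim n)
      then show ?case using card_cyclic_edges[of "{..<n}" n "d n"] by simp
    qed
    ultimately show ?thesis by (rule Lim_transform_eventually)
  qed
  \<comment> \<open>The common expansion for any sequence of regular graphs. The degenerate term is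
    kept; whether it is negligible is decided separately.\<close>
  have emean: "o_p M (\<lambda>n \<omega>. est \<Q> Sig (sym_emp (T n) X \<omega>) - Sig Q - 2 *\<^sub>R integral\<^sup>L (emp_P n X \<omega>) H1 - K.edge_mean (T n) \<omega>)
      (\<lambda>n. 1 / sqrt (real n))" if T: "\<forall>\<^sub>F n in sequentially. regular_graph n (T n)" for T
    using rem[OF T]
  proof (rule o_p_cong)
    show "\<forall>\<^sub>F n in sequentially. \<forall>\<omega>\<in>space M.
        est \<Q> Sig (sym_emp (T n) X \<omega>) - Sig Q - 2 *\<^sub>R integral\<^sup>L (emp_P n X \<omega>) H1 - K.edge_mean (T n) \<omega> =
        est \<Q> Sig (sym_emp (T n) X \<omega>) - Sig Q - integral\<^sup>L (sym_emp (T n) X \<omega>) J"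
      using T by eventually_elim (simp add: K.integral_sym_emp_J H1)
  qed
  have expand: "o_p M (\<lambda>n \<omega>. est \<Q> Sig (sym_emp (T n) X \<omega>) - Sig Q - 2 *\<^sub>R integral\<^sup>L (emp_P n X \<omega>) H1)
      (\<lambda>n. 1 / sqrt (real n))"
    if T: "\<forall>\<^sub>F n in sequentially. regular_graph n (T n)"
      and lim: "(\<lambda>n. real n / real (card (T n))) \<longlonglongrightarrow> 0" for T
    using o_p_add[OF emean[OF T] K.edge_mean_o_p[OF T lim]] by simp
  \<comment> \<open>Below \<open>n = 3\<close> no integer satisfies both inequalities, so the
    constraint can be imposed only from 3 on.\<close>
  have ev_d: "\<forall>\<^sub>F n in sequentially. 1 \<le> d n \<and> 2 * d n + 1 \<le> n"
    if "\<forall>n\<ge>3. 1 \<le> d n \<and> 2 * d n + 1 \<le> n" for d :: "nat \<Rightarrow> nat"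
    using that by (intro eventually_sequentiallyI[of 3]) blast
  have ev_const: "\<forall>\<^sub>F n in sequentially. 1 \<le> d \<and> 2 * d + 1 \<le> n" if "1 \<le> d" for d :: nat
    using that by (intro eventually_sequentiallyI[of "2 * d + 1"]) simp
  have Qd_eq: "\<forall>\<^sub>F n in sequentially. \<forall>\<omega>\<in>space M. emp_Qd n (d n) X \<omega> = sym_emp (cyclic_edges n (d n) {..<n}) X \<omega>"
    if "\<forall>\<^sub>F n in sequentially. 1 \<le> d n \<and> 2 * d n + 1 \<le> n" for d :: "nat \<Rightarrow> nat"
    using that by eventually_elim (simp add: emp_Qd_eq_sym_emp)
  have Mnd_eq: "\<forall>\<^sub>F n in sequentially. \<forall>\<omega>\<in>space M. Mnd d n \<omega> = K.edge_mean (cyclic_edges n d {..<n}) \<omega>"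
    if d: "1 \<le> d" for d
    using ev_const[OF d]
  proof eventually_elim
    case (elim n)
    then show ?case
      by (simp add: Mnd_def K.edge_mean_def H2 card_cyclic_edges sum_cyclic_edges)
  qed
  have i1: "o_p M (\<lambda>n \<omega>. est \<Q> Sig (emp_Q n X \<omega>) - Sig Q - 2 *\<^sub>R integral\<^sup>L (emp_P n X \<omega>) H1)
      (\<lambda>n. 1 / sqrt (real n))"
    unfolding emp_Q_eq_sym_emp by (rule expand[OF regQ limQ])
  have i2: "o_p M (\<lambda>n \<omega>. est \<Q> Sig (emp_Qd n (d n) X \<omega>) - Sig Q - 2 *\<^sub>R integral\<^sup>L (emp_P n X \<omega>) H1)
      (\<lambda>n. 1 / sqrt (real n))"
    if d: "\<forall>n\<ge>3. 1 \<le> d n \<and> 2 * d n + 1 \<le> n" "filterlim d at_top sequentially" for d :: "nat \<Rightarrow> nat"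
  proof (rule o_p_cong[OF expand[OF regQd[OF ev_d[OF d(1)]] limQd[OF ev_d[OF d(1)] d(2)]]])
    show "\<forall>\<^sub>F n in sequentially. \<forall>\<omega>\<in>space M.
       est \<Q> Sig (emp_Qd n (d n) X \<omega>) - Sig Q - 2 *\<^sub>R integral\<^sup>L (emp_P n X \<omega>) H1 =
       est \<Q> Sig (sym_emp (cyclic_edges n (d n) {..<n}) X \<omega>) - Sig Q - 2 *\<^sub>R integral\<^sup>L (emp_P n X \<omega>) H1"
      using Qd_eq[OF ev_d[OF d(1)]] by eventually_elim simp
  qed
  have fixed: "o_p M (\<lambda>n \<omega>. est \<Q> Sig (emp_Qd n d X \<omega>) - Sig Q - 2 *\<^sub>R integral\<^sup>L (emp_P n X \<omega>) H1 -
      K.edge_mean (cyclic_edges n d {..<n}) \<omega>) (\<lambda>n. 1 / sqrt (real n))" if d: "1 \<le> d" for d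
  proof (rule o_p_cong[OF emean[OF regQd[OF ev_const[OF d]]]])
    show "\<forall>\<^sub>F n in sequentially. \<forall>\<omega>\<in>space M.
       est \<Q> Sig (emp_Qd n d X \<omega>) - Sig Q - 2 *\<^sub>R integral\<^sup>L (emp_P n X \<omega>) H1 - K.edge_mean (cyclic_edges n d {..<n}) \<omega> =
       est \<Q> Sig (sym_emp (cyclic_edges n d {..<n}) X \<omega>) - Sig Q - 2 *\<^sub>R integral\<^sup>L (emp_P n X \<omega>) H1 -
         K.edge_mean (cyclic_edges n d {..<n}) \<omega>"
      using Qd_eq[OF ev_const[OF d]] by eventually_elim simp
  qed
  \<comment> \<open>Subtracting the expansion for the complete graph from that for fixed
    \<open>d\<close> cancels the \<open>H1\<close> terms and leaves the degenerate average.\<close>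
  have ii: "o_p M (\<lambda>n \<omega>. est \<Q> Sig (emp_Qd n d X \<omega>) - est \<Q> Sig (emp_Q n X \<omega>) - Mnd d n \<omega>)
      (\<lambda>n. 1 / sqrt (real n))" if d: "1 \<le> d" for d
  proof (rule o_p_cong[OF o_p_add[OF fixed[OF d] o_p_uminus[OF i1]]])
    show "\<forall>\<^sub>F n in sequentially. \<forall>\<omega>\<in>space M. est \<Q> Sig (emp_Qd n d X \<omega>) - est \<Q> Sig (emp_Q n X \<omega>) - Mnd d n \<omega> =
        est \<Q> Sig (emp_Qd n d X \<omega>) - Sig Q - 2 *\<^sub>R integral\<^sup>L (emp_P n X \<omega>) H1 - K.edge_mean (cyclic_edges n d {..<n}) \<omega> +
        - (est \<Q> Sig (emp_Q n X \<omega>) - Sig Q - 2 *\<^sub>R integral\<^sup>L (emp_P n X \<omega>) H1)"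
      using Mnd_eq[OF d] by eventually_elim simp
  qed
  have Gm: "G1 \<in> borel_measurable N" "G2 \<in> borel_measurable N"
    and Gsym: "\<And>\<omega>. \<omega> \<in> space N \<Longrightarrow> sym_mat (G1 \<omega>)" "\<And>\<omega>. \<omega> \<in> space N \<Longrightarrow> sym_mat (G2 \<omega>)"
    using G by (auto simp: gauss_sym_mat_def)
  \<comment> \<open>Both sides see \<open>A\<close> only through its symmetric part, so the
    covariance condition extends to arbitrary \<open>A\<close>.\<close>
  have v1: "(\<integral>\<omega>. (A \<bullet> G1 \<omega>)\<^sup>2 \<partial>N) = expectation (\<lambda>\<omega>. (A \<bullet> K.H1 (X 0 \<omega>))\<^sup>2)" for A
  proof -
    have "(\<integral>\<omega>. (A \<bullet> G1 \<omega>)\<^sup>2 \<partial>N) = (\<integral>\<omega>. (sym_part A \<bullet> G1 \<omega>)\<^sup>2 \<partial>N)"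
      by (intro Bochner_Integration.integral_cong) (auto simp: sym_part_inner Gsym)
    then show ?thesis
      using cov1[OF sym_mat_sym_part, of A] by (simp add: frob_eq_inner H1 sym_part_inner H1sym)
  qed
  have v2: "(\<integral>\<omega>. (A \<bullet> G2 \<omega>)\<^sup>2 \<partial>N) = expectation (\<lambda>\<omega>. (A \<bullet> K.H2 (X 0 \<omega>) (X 1 \<omega>))\<^sup>2)" for A
  proof -
    have "(\<integral>\<omega>. (A \<bullet> G2 \<omega>)\<^sup>2 \<partial>N) = (\<integral>\<omega>. (sym_part A \<bullet> G2 \<omega>)\<^sup>2 \<partial>N)"
      by (intro Bochner_Integration.integral_cong) (auto simp: sym_part_inner Gsym)
    then show ?thesis
      using cov2[OF sym_mat_sym_part, of A] by (simp add: frob_eq_inner H2 sym_part_inner H2sym)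
  qed
  note gauss = gauss_pair_moments[OF N G]
  note conv = K.conv_dist_linear_joint_stat[OF N Gm gauss(1) gauss(2)[unfolded v1 v2]]
  have iii: "conv_dist M (\<lambda>n \<omega>. (sqrt (real n) *\<^sub>R integral\<^sup>L (emp_P n X \<omega>) H1,
      sqrt (real n * real d) *\<^sub>R Mnd d n \<omega>)) N (\<lambda>\<omega>. (G1 \<omega>, G2 \<omega>))" if d: "1 \<le> d" for d
  proof (rule conv[OF d, of "\<lambda>x. x"])
    show "o_p M (\<lambda>n \<omega>. (sqrt (real n) *\<^sub>R integral\<^sup>L (emp_P n X \<omega>) H1, sqrt (real n * real d) *\<^sub>R Mnd d n \<omega>) -
        K.joint_stat d n \<omega>) (\<lambda>_. 1)"
    proof (rule o_p_cong[OF o_p_zero])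
      show "\<forall>\<^sub>F n in sequentially. \<forall>\<omega>\<in>space M.
        (sqrt (real n) *\<^sub>R integral\<^sup>L (emp_P n X \<omega>) H1, sqrt (real n * real d) *\<^sub>R Mnd d n \<omega>) - K.joint_stat d n \<omega> = 0"
        using Mnd_eq[OF d] by eventually_elim (simp add: K.joint_stat_def H1 zero_prod_def)
    qed
  qed (rule bounded_linear_ident)
  \<comment> \<open>Only the first component of the joint statistic enters the limit, so the fixed
    value 1 is taken for \<open>d\<close>, however fast d(n) grows.\<close>
  have iv: "conv_dist M (\<lambda>n \<omega>. sqrt (real n) *\<^sub>R (R n \<omega> - Sig Q)) N (\<lambda>\<omega>. 2 *\<^sub>R G1 \<omega>)"
    if R: "o_p M (\<lambda>n \<omega>. R n \<omega> - Sig Q - 2 *\<^sub>R integral\<^sup>L (emp_P n X \<omega>) H1) (\<lambda>n. 1 / sqrt (real n))" for R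
  proof -
    have "conv_dist M (\<lambda>n \<omega>. sqrt (real n) *\<^sub>R (R n \<omega> - Sig Q)) N (\<lambda>\<omega>. 2 *\<^sub>R fst (G1 \<omega>, G2 \<omega>))"
    proof (rule conv[OF order_refl])
      show "bounded_linear (\<lambda>x :: (real^'q^'q) \<times> (real^'q^'q). 2 *\<^sub>R fst x)"
        by (intro bounded_linear_const_scaleR bounded_linear_fst)
      show "o_p M (\<lambda>n \<omega>. sqrt (real n) *\<^sub>R (R n \<omega> - Sig Q) - 2 *\<^sub>R fst (K.joint_stat 1 n \<omega>)) (\<lambda>_. 1)"
        using o_p_scale_sqrt[OF R] by (simp add: K.joint_stat_def H1 scaleR_diff_right mult.commute)
    qed
    then show ?thesis by simp
  qed
  have v: "conv_dist M (\<lambda>n \<omega>. sqrt (real n) *\<^sub>R (est \<Q> Sig (emp_Qd n d X \<omega>) - Sig Q))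
      N (\<lambda>\<omega>. 2 *\<^sub>R G1 \<omega> + (1 / sqrt (real d)) *\<^sub>R G2 \<omega>)" if d: "1 \<le> d" for d
  proof -
    have "conv_dist M (\<lambda>n \<omega>. sqrt (real n) *\<^sub>R (est \<Q> Sig (emp_Qd n d X \<omega>) - Sig Q))
      N (\<lambda>\<omega>. 2 *\<^sub>R fst (G1 \<omega>, G2 \<omega>) + (1 / sqrt (real d)) *\<^sub>R snd (G1 \<omega>, G2 \<omega>))"
    proof (rule conv[OF d])
      show "bounded_linear (\<lambda>x :: (real^'q^'q) \<times> (real^'q^'q). 2 *\<^sub>R fst x + (1 / sqrt (real d)) *\<^sub>R snd x)"
        by (intro bounded_linear_add bounded_linear_const_scaleR bounded_linear_fst bounded_linear_snd)
      \<comment> \<open>The origin of the factor d^(-1/2): the estimator scales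
        \<open>edge_mean\<close> by sqrt n, the joint statistic by sqrt (n d).\<close>
      have "(1 / sqrt (real d)) * sqrt (real n * real d) = sqrt (real n)" for n
        using d by (simp add: real_sqrt_mult)
      then show "o_p M (\<lambda>n \<omega>. sqrt (real n) *\<^sub>R (est \<Q> Sig (emp_Qd n d X \<omega>) - Sig Q) -
          (2 *\<^sub>R fst (K.joint_stat d n \<omega>) + (1 / sqrt (real d)) *\<^sub>R snd (K.joint_stat d n \<omega>))) (\<lambda>_. 1)"
        using o_p_scale_sqrt[OF fixed[OF d]]
        by (simp add: K.joint_stat_def H1 scaleR_diff_right mult.commute algebra_simps)
    qed
    then show ?thesis by simp
  qed
  show ?thesis
    using i1 i2 ii iii iv[OF i1] iv[OF i2] v by blast
qed

end
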